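(* Let $q$ be an odd prime power. Then for all sufficiently large $n$, $$\lfloor n/2 \rfloor - q + 1 \le \mathrm{ex}_q(n,PG_2(q)) \le n/2.$$ Moreover, for $q=3$ and all sufficiently large even $n$, $\mathrm{ex}_3(n,PG_2(3)) = n/2 - 1$.
   Context: A $k$-graph $H$ consists of a vertex set and a set of $k$-element subsets (edges). For $S \subseteq V(H)$, $N_H(S) = \{T \subseteq V(H)\setminus S : S \cup T \in E(H)\}$ and $\delta_s(H) = \min_{|S|=s}|N_H(S)|$. For a $k$-graph $F$, $\mathrm{ex}_s(n,F)$ is the largest $m$ such that there is a $k$-graph $H$ on $n$ vertices not containing $F$ (as a not necessarily induced subgraph) with $\delta_s(H) \ge m$. The projective geometry $PG_m(q)$ over the field $\mathbb{F}_q$ is the $(q+1)$-graph whose vertices are the one-dimensional subspaces of $\mathbb{F}_q^{m+1}$, and for each two-dimensional subspace the set of one-dimensional subspaces it contains is an edge. *)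

theory Defs
  imports Complex_Main
begin

definition k_graph :: "nat \<Rightarrow> 'v set \<Rightarrow> 'v set set \<Rightarrow> bool" where
  "k_graph k V E \<longleftrightarrow> finite V \<and> (\<forall>e\<in>E. e \<subseteq> V \<and> card e = k)"

definition nbhd :: "'v set \<Rightarrow> 'v set set \<Rightarrow> 'v set \<Rightarrow> 'v set set" where
  "nbhd V E S = {T. T \<subseteq> V - S \<and> S \<union> T \<in> E}"

text \<open>delta_s(H) \<ge> m, i.e. every s-subset S of V(H) has |N_H(S)| \<ge> m
  (the minimum over an empty family being +infinity).\<close>
definition min_codeg_ge :: "nat \<Rightarrow> 'v set \<Rightarrow> 'v set set \<Rightarrow> nat \<Rightarrow> bool" where
  "min_codeg_ge s V E m \<longleftrightarrow> (\<forall>S. S \<subseteq> V \<and> card S = s \<longrightarrow> m \<le> card (nbhd V E S))"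

definition contains :: "'w set \<Rightarrow> 'w set set \<Rightarrow> 'v set \<Rightarrow> 'v set set \<Rightarrow> bool" where
  "contains VF EF VH EH \<longleftrightarrow>
     (\<exists>f. inj_on f VF \<and> f ` VF \<subseteq> VH \<and> (\<forall>e\<in>EF. f ` e \<in> EH))"

text \<open>ex_s(n,F) for a k-graph F = (VF,EF); host graphs on n vertices are taken
  (w.l.o.g., up to isomorphism) on the vertex set {0..<n}.\<close>
definition ex_codeg :: "nat \<Rightarrow> nat \<Rightarrow> nat \<Rightarrow> 'w set \<Rightarrow> 'w set set \<Rightarrow> nat" where
  "ex_codeg k s n VF EF = (GREATEST m. \<exists>E :: nat set set.
      k_graph k {..<n} E \<and> \<not> contains VF EF {..<n} E \<and> min_codeg_ge s {..<n} E m)"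

class finite_field = field + finite

type_synonym 'f vec3 = "'f \<times> 'f \<times> 'f"

definition vsmult :: "'f::field \<Rightarrow> 'f vec3 \<Rightarrow> 'f vec3" where
  "vsmult c v = (case v of (x,y,z) \<Rightarrow> (c*x, c*y, c*z))"

definition vadd :: "'f::field vec3 \<Rightarrow> 'f vec3 \<Rightarrow> 'f vec3" where
  "vadd u v = (case u of (x,y,z) \<Rightarrow> case v of (x',y',z') \<Rightarrow> (x+x', y+y', z+z'))"

definition vzero :: "'f::field vec3" where "vzero = (0,0,0)"

definition span1 :: "'f::field vec3 \<Rightarrow> 'f vec3 set" where
  "span1 v = {vsmult c v | c. True}"

definition span2 :: "'f::field vec3 \<Rightarrow> 'f vec3 \<Rightarrow> 'f vec3 set" where
  "span2 u v = {vadd (vsmult a u) (vsmult b v) | a b. True}"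

definition PG2_points :: "('f::field vec3) set set" where
  "PG2_points = {span1 v | v. v \<noteq> vzero}"

definition subspaces2 :: "('f::field vec3) set set" where
  "subspaces2 = {span2 u v | u v. v \<noteq> vzero \<and> u \<notin> span1 v}"

definition PG2_edges :: "('f::field vec3) set set set" where
  "PG2_edges = {{P \<in> PG2_points. P \<subseteq> W} | W. W \<in> subspaces2}"

end

theory Submission
  imports Defs "HOL-Library.FuncSet"
begin

text \<open>
  \<^emph>\<open>Lower bounds.\<close> Split the vertices into halves \<open>A\<close>, \<open>B\<close> and take all \<open>(q + 1)\<close>-sets meeting \<open>A\<close> in an
  odd number of points. In a copy of the plane, counting along the lines through a point \<open>p\<close> shows
  that the trace of \<open>A\<close> has odd size if \<open>p\<close> lies in it and even size otherwise, which is absurd. For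
  \<open>q = 3\<close> and \<open>n = 2 h\<close> one takes sizes \<open>h + 1\<close>, \<open>h - 1\<close>, fixes two points \<open>C\<close> in \<open>A\<close>, and adds the
  4-sets with two points in \<open>A\<close>, exactly one of them in \<open>C\<close>.

  \<^emph>\<open>Upper bounds.\<close> Let all codegrees be at least \<open>n / 2\<close> and let the plane be absent. A random sample of
  constant size inherits the codegrees, and a positive proportion of the samples has the same
  isomorphism type \<open>J\<close>, so a blow-up of \<open>J\<close> occurs. Choose a \<open>q\<close>-set in each part. The parts whose
  \<open>q\<close>-sets are joined to a vertex \<open>p\<close> are independent in \<open>J\<close>, since \<open>p\<close> together with \<open>q + 1\<close> such parts
  carrying all transversals would form a plane. On average half of the parts are joined to \<open>p\<close>,
  while independent sets have little more than half of the parts; this forces two equal families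
  \<open>V1\<close>, \<open>V2\<close> of parts such that all \<open>q\<close>-subsets of one are joined to all members of the other. Now each
  vertex is joined to at most half of the chosen \<open>q\<close>-sets, so all codegrees involved are exactly
  \<open>n / 2\<close> and every vertex is joined to precisely \<open>V1\<close> or precisely \<open>V2\<close>.

  For \<open>q = 3\<close> the resulting bipartition \<open>A\<close>, \<open>B\<close> has no edge inside a class (a line plus an affine plane),
  so all odd 4-sets are edges and every triple meeting both classes lies in edges with two points on
  each side. Three of these placed as the diagonals of a complete quadrilateral give the plane.
\<close>

subsection \<open>The projective plane over a finite field\<close>

text \<open>The bound \<open>n / 2\<close> is sharp, so the sample cannot keep it: with
  \<open>m = (2 * u + 1) * l\<close> sampled vertices one only gets codegrees of at least
  \<open>(m - l) / 2\<close> in \<open>J\<close>, and all information read off from \<open>J\<close>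
  carries an error of order \<open>l\<close>. Exactness is recovered in the host, not in
  \<open>J\<close>. There the two families have the same size \<open>s\<close>: a vertex joined to
  at most \<open>s\<close> of the \<open>2 * s\<close> chosen \<open>q\<close>-sets can at best meet
  the average forced by codegrees of \<open>n / 2\<close>, so no slack remains. The families only
  need \<open>s = 2 * q\<close> members, while the error is a small fraction of \<open>m\<close>;
  hence \<open>s\<close> is fixed first, then \<open>u\<close>, then \<open>l\<close>, and the host
  size last. A blow-up is needed instead of a single copy of \<open>J\<close> because the
  \<open>q\<close> points other than \<open>p\<close> on a line through \<open>p\<close> are all
  placed in one part, while a line avoiding \<open>p\<close> becomes a transversal. For
  \<open>q = 3\<close> the parts get 9 vertices, enough for an affine plane. After the coordinates
  have been set up, only the incidence axioms of a plane are used.\<close>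

definition cross :: "'f::field vec3 \<Rightarrow> 'f vec3 \<Rightarrow> 'f vec3" where
  "cross u v = (case u of (a,b,c) \<Rightarrow> case v of (d,e,f) \<Rightarrow> (b*f - c*e, c*d - a*f, a*e - b*d))"

definition dot :: "'f::field vec3 \<Rightarrow> 'f vec3 \<Rightarrow> 'f" where
  "dot u v = (case u of (a,b,c) \<Rightarrow> case v of (d,e,f) \<Rightarrow> a*d + b*e + c*f)"

lemmas vec_defs = cross_def dot_def vsmult_def vadd_def vzero_def

lemma cross_zero_imp_span1:
  assumes "cross a b = vzero" "b \<noteq> vzero"
  shows "a \<in> span1 b"
proof -
  obtain x y z where a: "a = (x,y,z)" by (cases a) auto
  obtain d e f where b: "b = (d,e,f)" by (cases b) auto
  have eqs: "y*f = z*e" "z*d = x*f" "x*e = y*d"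
    using assms(1) by (auto simp: a b vec_defs)
  have "\<exists>c. a = vsmult c b"
  proof (cases "d = 0")
    case False
    then show ?thesis using eqs by (intro exI[of _ "x/d"]) (auto simp: a b vec_defs field_simps)
  next
    case d: True
    show ?thesis
    proof (cases "e = 0")
      case False
      then show ?thesis using eqs by (intro exI[of _ "y/e"]) (auto simp: a b vec_defs field_simps d)
    next
      case True
      with d assms(2) have "f \<noteq> 0" by (auto simp: b vec_defs)
      then show ?thesis using eqs d True
        by (intro exI[of _ "z/f"]) (auto simp: a b vec_defs field_simps)
    qed
  qed
  then show ?thesis by (auto simp: span1_def)
qed

lemma cross_self_smult: "cross (vsmult c v) v = vzero"
  by (auto simp: vec_defs split: prod.splits)

lemma cross_smult_right: "cross u (vsmult c v) = vsmult c (cross u v)"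
  by (cases u; cases v; simp add: vec_defs algebra_simps)

lemma cross_nonzero:
  assumes "v \<noteq> vzero" "u \<notin> span1 v" shows "cross u v \<noteq> vzero"
  using assms cross_zero_imp_span1 by blast

lemma orthogonal_both_imp_span1:
  assumes "dot n u = 0" "dot n v = 0" "cross u v \<noteq> vzero"
  shows "n \<in> span1 (cross u v)"
proof -
  obtain x y z where a: "n = (x,y,z)" by (cases n) auto
  obtain d e f where b: "u = (d,e,f)" by (cases u) auto
  obtain g h i where c: "v = (g,h,i)" by (cases v) auto
  have 1: "x*d + y*e + z*f = 0" "x*g+y*h+z*i = 0" using assms by (auto simp: a b c dot_def)
  \<comment> \<open>This is the triple product expansion n x (u x v) = (n . v) u - (n . u) v,
    coordinate by coordinate.\<close>
  have "y * (d*h - e*g) - z * (f*g - d*i) = d * (x*g+y*h+z*i) - g * (x*d + y*e + z*f)"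
    "z * (e*i - f*h) - x * (d*h - e*g) = e * (x*g+y*h+z*i) - h * (x*d + y*e + z*f)"
    "x * (f*g - d*i) - y * (e*i - f*h) = f * (x*g+y*h+z*i) - i * (x*d + y*e + z*f)"
    by (simp_all add: algebra_simps)
  then have "cross n (cross u v) = vzero" by (simp add: a b c vec_defs 1)
  then show ?thesis using assms(3) cross_zero_imp_span1 by blast
qed

lemma dot_commute: "dot u v = dot v u"
  by (auto simp: dot_def algebra_simps split: prod.splits)

lemma dot_cross [simp]: "dot (cross u v) u = 0" "dot (cross u v) v = 0"
  by (cases u; cases v; simp add: vec_defs algebra_simps)+

lemma dot_smult: "dot n (vsmult c v) = c * dot n v" "dot (vsmult c n) v = c * dot n v"
  by (auto simp: vec_defs algebra_simps split: prod.splits)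

lemma dot_vadd: "dot n (vadd u v) = dot n u + dot n v"
  by (auto simp: vec_defs algebra_simps split: prod.splits)

lemma vsmult_vsmult [simp]: "vsmult c (vsmult d v) = vsmult (c*d) v"
  by (auto simp: vec_defs algebra_simps split: prod.splits)

lemma vsmult_one [simp]: "vsmult 1 v = v"
  by (auto simp: vec_defs split: prod.splits)

lemma vsmult_eq_vzero: "vsmult c v = vzero \<longleftrightarrow> c = 0 \<or> v = vzero"
  by (auto simp: vec_defs split: prod.splits)

lemma in_span1_self: "v \<in> span1 v"
  unfolding span1_def by (auto intro!: exI[of _ 1])

lemma span1_eqI:
  assumes "w \<in> span1 v" "w \<noteq> vzero" shows "span1 w = span1 v"
proof -
  obtain c where c: "w = vsmult c v" using assms by (auto simp: span1_def)
  with assms have "c \<noteq> 0" by (auto simp: vsmult_eq_vzero)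
  then have "vsmult d v = vsmult (d / c) w" "vsmult d w = vsmult (d * c) v" for d by (simp_all add: c)
  then show ?thesis unfolding span1_def by blast
qed

text \<open>For the harder inclusion, let \<open>x\<close> be orthogonal to
  \<open>cross u v\<close>. Then \<open>cross x v\<close> and \<open>cross u x\<close> are multiples
  of \<open>cross u v\<close>, and the two factors are the coordinates of \<open>x\<close>, as in
  Cramer's rule. The remainder \<open>y\<close> has zero cross product with both \<open>u\<close>
  and \<open>v\<close>, hence vanishes.\<close>

lemma span2_eq_orthogonal:
  assumes "v \<noteq> vzero" "u \<notin> span1 v"
  shows "span2 u v = {x. dot (cross u v) x = 0}"
proof (intro equalityI subsetI)
  fix x assume "x \<in> span2 u v"
  then show "x \<in> {x. dot (cross u v) x = 0}"
    unfolding span2_def by (force simp: dot_smult dot_vadd)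
next
  fix x assume "x \<in> {x. dot (cross u v) x = 0}"
  then have x: "dot x (cross u v) = 0" by (simp add: dot_commute)
  let ?n = "cross u v"
  have n: "?n \<noteq> vzero" using assms by (rule cross_nonzero)
  have par: "cross a b \<in> span1 ?n" if "dot ?n a = 0" "dot ?n b = 0" for a b
  proof (cases "cross a b = vzero")
    case True
    then have "cross a b = vsmult 0 ?n" using vsmult_eq_vzero[of 0 ?n] by simp
    then show ?thesis unfolding span1_def by blast
  next
    case False
    have "?n \<in> span1 (cross a b)" by (rule orthogonal_both_imp_span1[OF that False])
    then have "span1 ?n = span1 (cross a b)" using n by (rule span1_eqI)
    then show ?thesis using in_span1_self by blast
  qed
  have "dot ?n x = 0" using x by (simp add: dot_commute)
  then have "cross x v \<in> span1 ?n" "cross u x \<in> span1 ?n" using par by auto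
  then obtain \<alpha> \<beta> where ab: "cross x v = vsmult \<alpha> ?n" "cross u x = vsmult \<beta> ?n"
    unfolding span1_def by blast
  define w where "w = vadd (vsmult \<alpha> u) (vsmult \<beta> v)"
  define y where "y = vadd x (vsmult (-1) w)"
  have c1: "cross y v = vadd (cross x v) (vsmult (-\<alpha>) ?n)"
    unfolding y_def w_def by (cases u; cases v; cases x; simp add: vec_defs algebra_simps)
  have c2: "cross u y = vadd (cross u x) (vsmult (-\<beta>) ?n)"
    unfolding y_def w_def by (cases u; cases v; cases x; simp add: vec_defs algebra_simps)
  have "vadd (vsmult c z) (vsmult (-c) z) = vzero" for c and z :: "'a vec3"
    by (cases z; simp add: vec_defs)
  then have "cross y v = vzero" "cross u y = vzero" unfolding c1 c2 ab by blast+
  then obtain \<gamma> where g: "y = vsmult \<gamma> v"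
    using cross_zero_imp_span1[of y v] assms(1) unfolding span1_def by blast
  have "cross u y = vsmult \<gamma> ?n" by (simp add: g cross_smult_right)
  then have "\<gamma> = 0" using \<open>cross u y = vzero\<close> n vsmult_eq_vzero by metis
  then have "y = vzero" by (simp add: g vsmult_eq_vzero)
  then have "x = w" unfolding y_def by (cases x; cases w; simp add: vec_defs)
  then show "x \<in> span2 u v" unfolding span2_def w_def by blast
qed

section \<open>Points and lines described by normal vectors\<close>

lemma span1_subset_orthogonal_iff:
  "span1 v \<subseteq> {x. dot n x = 0} \<longleftrightarrow> dot n v = 0"
proof
  assume "dot n v = 0"
  then have "dot n (vsmult c v) = 0" for c by (simp add: dot_smult)
  then show "span1 v \<subseteq> {x. dot n x = 0}" unfolding span1_def by blast
qed (use in_span1_self[of v] in blast)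

lemma points_in_span2:
  assumes "v \<noteq> vzero" "u \<notin> span1 v"
  shows "{P \<in> PG2_points. P \<subseteq> span2 u v} = {span1 w | w. w \<noteq> vzero \<and> dot (cross u v) w = 0}"
proof -
  have "{P \<in> PG2_points. P \<subseteq> span2 u v} = {span1 w | w. w \<noteq> vzero \<and> span1 w \<subseteq> span2 u v}"
    unfolding PG2_points_def by blast
  then show ?thesis by (simp only: span2_eq_orthogonal[OF assms] span1_subset_orthogonal_iff)
qed

lemma PG2_edge_normal:
  assumes "l \<in> PG2_edges"
  obtains n where "n \<noteq> vzero" "l = {span1 v | v. v \<noteq> vzero \<and> dot n v = 0}"
proof -
  obtain u v where uv: "v \<noteq> vzero" "u \<notin> span1 v" "l = {P \<in> PG2_points. P \<subseteq> span2 u v}"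
    using assms unfolding PG2_edges_def subspaces2_def by blast
  show thesis
    by (rule that[of "cross u v"])
       (use uv cross_nonzero[OF uv(1,2)] points_in_span2[OF uv(1,2)] in simp_all)
qed

lemma PG2_edge_through:
  assumes "u \<noteq> vzero" "v \<noteq> vzero" "span1 u \<noteq> span1 v"
  shows "{span1 w | w. w \<noteq> vzero \<and> dot (cross u v) w = 0} \<in> PG2_edges"
    and "cross u v \<noteq> vzero"
proof -
  have u: "u \<notin> span1 v" using assms span1_eqI by blast
  show "cross u v \<noteq> vzero" using assms(2) u by (rule cross_nonzero)
  have "{P \<in> PG2_points. P \<subseteq> span2 u v} \<in> PG2_edges"
    using u assms(2) unfolding PG2_edges_def subspaces2_def by blast
  moreover have "{P \<in> PG2_points. P \<subseteq> span2 u v} = {span1 w | w. w \<noteq> vzero \<and> dot (cross u v) w = 0}"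
    using assms(2) u by (rule points_in_span2)
  ultimately show "{span1 w | w. w \<noteq> vzero \<and> dot (cross u v) w = 0} \<in> PG2_edges" by simp
qed

lemma span1_eq_imp_dot:
  assumes "span1 u = span1 v" "dot n v = 0" shows "dot n u = 0"
  using assms span1_subset_orthogonal_iff[of u n] span1_subset_orthogonal_iff[of v n] by simp

lemma span1_in_orthogonalD:
  assumes "span1 u \<in> {span1 v | v. v \<noteq> vzero \<and> dot n v = 0}" shows "dot n u = 0"
proof -
  obtain v where "span1 u = span1 v" "dot n v = 0" using assms by blast
  then show ?thesis by (rule span1_eq_imp_dot)
qed

lemma span1_in_orthogonalI:
  "u \<noteq> vzero \<Longrightarrow> dot n u = 0 \<Longrightarrow> span1 u \<in> {span1 v | v. v \<noteq> vzero \<and> dot n v = 0}"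
  by blast

text \<open>The points of the line are \<open>span1 v\<close> and the spans of
  \<open>vadd u (vsmult c v)\<close>, one for each field element \<open>c\<close>. They are distinct
  because their pairwise cross products are nonzero multiples of \<open>cross u v\<close>.\<close>

lemma card_PG2_edge:
  fixes l :: "'f::finite_field vec3 set set"
  assumes "l \<in> PG2_edges"
  shows "card l = card (UNIV :: 'f set) + 1"
proof -
  obtain u v :: "'f vec3" where uv: "v \<noteq> vzero" "u \<notin> span1 v" "l = {P \<in> PG2_points. P \<subseteq> span2 u v}"
    using assms unfolding PG2_edges_def subspaces2_def by blast
  let ?g = "\<lambda>c. vadd u (vsmult c v)"
  have n: "cross u v \<noteq> vzero" using uv cross_nonzero by blast
  have crs: "cross (?g c) (?g d) = vsmult (d - c) (cross u v)" for c d
    by (cases u; cases v; simp add: vec_defs algebra_simps)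
  have crs2: "cross (?g c) v = cross u v" for c
    by (cases u; cases v; simp add: vec_defs algebra_simps)
  have gnz: "?g c \<noteq> vzero" for c
  proof
    assume *: "?g c = vzero"
    have "cross vzero v = vzero" by (auto simp: vec_defs split: prod.splits)
    then show False using crs2[of c] n by (simp add: *)
  qed
  have par: "cross a b = vzero" if ab: "span1 a = span1 b" for a b :: "'f vec3"
  proof -
    have "a \<in> span1 b" using in_span1_self[of a] by (simp add: ab)
    then show ?thesis using cross_self_smult unfolding span1_def by blast
  qed
  have that_dot: "dot (cross u v) (?g c) = 0" "dot (cross u v) v = 0" for c
    by (simp_all add: dot_vadd dot_smult)
  have inj: "inj (\<lambda>c. span1 (?g c))"
  proof (rule injI)
    fix c d assume "span1 (?g c) = span1 (?g d)"
    then have "cross (?g c) (?g d) = vzero" by (rule par)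
    then have "vsmult (d - c) (cross u v) = vzero" by (simp only: crs)
    then show "c = d" using n by (simp add: vsmult_eq_vzero)
  qed
  have nin: "span1 v \<notin> range (\<lambda>c. span1 (?g c))"
  proof
    assume "span1 v \<in> range (\<lambda>c. span1 (?g c))"
    then obtain c where "span1 (?g c) = span1 v" by blast
    then have "cross (?g c) v = vzero" by (rule par)
    then show False using n by (simp only: crs2)
  qed
  have "l = insert (span1 v) (range (\<lambda>c. span1 (?g c)))"
  proof (intro equalityI subsetI)
    fix P assume "P \<in> l"
    then obtain w where w: "w \<noteq> vzero" "P = span1 w" "P \<subseteq> span2 u v"
      by (auto simp: uv PG2_points_def)
    then have "w \<in> span2 u v" using in_span1_self by blast
    then obtain a b where ab: "w = vadd (vsmult a u) (vsmult b v)" by (auto simp: span2_def)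
    show "P \<in> insert (span1 v) (range (\<lambda>c. span1 (?g c)))"
    proof (cases "a = 0")
      case True
      then have "w = vsmult b v" by (auto simp: ab vec_defs split: prod.splits)
      then have "w \<in> span1 v" by (auto simp: span1_def)
      then show ?thesis using w span1_eqI by blast
    next
      case False
      then have "w = vsmult a (?g (b/a))" by (auto simp: ab vec_defs algebra_simps split: prod.splits)
      then have "w \<in> span1 (?g (b/a))" by (auto simp: span1_def)
      then show ?thesis using w span1_eqI by blast
    qed
  next
    fix P assume "P \<in> insert (span1 v) (range (\<lambda>c. span1 (?g c)))"
    then obtain w where w: "w \<noteq> vzero" "P = span1 w" "dot (cross u v) w = 0"
      using gnz uv(1) that_dot by blast
    then show "P \<in> l" unfolding uv(3) points_in_span2[OF uv(1,2)] by blast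
  qed
  moreover have "card (range (\<lambda>c. span1 (?g c))) = card (UNIV :: 'f set)"
    using inj by (rule card_image)
  ultimately show ?thesis using nin by simp
qed

text \<open>The field disappears behind this interface; later arguments know \<open>q\<close> only
  as one less than the size of a line. The axiom \<open>triangle\<close> excludes the degenerate
  case in which all points lie on one line.\<close>

locale projective_plane =
  fixes P :: "'p set" and L :: "'p set set" and q :: nat
  assumes finite_points: "finite P"
    and line_subset: "l \<in> L \<Longrightarrow> l \<subseteq> P"
    and card_line: "l \<in> L \<Longrightarrow> card l = q + 1"
    and join: "x \<in> P \<Longrightarrow> y \<in> P \<Longrightarrow> x \<noteq> y \<Longrightarrow> \<exists>!l. l \<in> L \<and> x \<in> l \<and> y \<in> l"
    and meet: "l \<in> L \<Longrightarrow> l' \<in> L \<Longrightarrow> l \<noteq> l' \<Longrightarrow> \<exists>x. l \<inter> l' = {x}"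
    and triangle: "\<exists>x\<in>P. \<exists>y\<in>P. \<exists>z\<in>P. x \<noteq> y \<and> x \<noteq> z \<and> y \<noteq> z \<and> (\<forall>l\<in>L. \<not> {x,y,z} \<subseteq> l)"

text \<open>Duality by cross products: the line joining two points has their cross product as normal
  vector, and two lines meet in the span of the cross product of their normals. The coordinate
  vectors form the triangle.\<close>

lemma projective_plane_PG2:
  "projective_plane (PG2_points :: 'f::finite_field vec3 set set) PG2_edges (card (UNIV :: 'f set))"
proof
  show "finite (PG2_points :: 'f vec3 set set)" by simp
next
  fix l :: "'f vec3 set set" assume "l \<in> PG2_edges"
  then show "l \<subseteq> PG2_points" "card l = card (UNIV :: 'f set) + 1"
    by (auto simp: PG2_edges_def card_PG2_edge)
next
  fix x y :: "'f vec3 set" assume "x \<in> PG2_points" "y \<in> PG2_points" "x \<noteq> y"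
  then obtain u v where uv: "u \<noteq> vzero" "v \<noteq> vzero" "x = span1 u" "y = span1 v" "span1 u \<noteq> span1 v"
    unfolding PG2_points_def by blast
  note e = PG2_edge_through[OF uv(1,2,5)]
  let ?l = "{span1 w | w. w \<noteq> vzero \<and> dot (cross u v) w = 0}"
  show "\<exists>!l. l \<in> PG2_edges \<and> x \<in> l \<and> y \<in> l"
  proof (rule ex1I[of _ ?l])
    show "?l \<in> PG2_edges \<and> x \<in> ?l \<and> y \<in> ?l"
    proof (intro conjI)
      show "?l \<in> PG2_edges" by (rule e(1))
      show "x \<in> ?l" unfolding uv(3) by (rule span1_in_orthogonalI[OF uv(1)]) simp
      show "y \<in> ?l" unfolding uv(4) by (rule span1_in_orthogonalI[OF uv(2)]) simp
    qed
  next
    fix l assume l: "l \<in> PG2_edges \<and> x \<in> l \<and> y \<in> l"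
    then obtain n where n: "n \<noteq> vzero" "l = {span1 v | v. v \<noteq> vzero \<and> dot n v = 0}"
      using PG2_edge_normal by blast
    have on_l: "dot n v = 0" if "span1 v \<in> l" for v
      using that unfolding n(2) by (rule span1_in_orthogonalD)
    have "span1 u \<in> l" "span1 v \<in> l" using l uv by simp_all
    then have "dot n u = 0" "dot n v = 0" by (simp_all only: on_l)
    then have "n \<in> span1 (cross u v)" using e(2) orthogonal_both_imp_span1 by blast
    then obtain c where c: "n = vsmult c (cross u v)" by (auto simp: span1_def)
    then have "c \<noteq> 0" using n by (auto simp: vsmult_eq_vzero)
    then show "l = ?l" by (auto simp: n(2) c dot_smult)
  qed
next
  fix l l' :: "'f vec3 set set" assume ll: "l \<in> PG2_edges" "l' \<in> PG2_edges" "l \<noteq> l'"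
  obtain n where n: "n \<noteq> vzero" "l = {span1 v | v. v \<noteq> vzero \<and> dot n v = 0}"
    using PG2_edge_normal ll by blast
  obtain n' where n': "n' \<noteq> vzero" "l' = {span1 v | v. v \<noteq> vzero \<and> dot n' v = 0}"
    using PG2_edge_normal ll by blast
  have "n \<notin> span1 n'"
  proof
    assume "n \<in> span1 n'"
    then obtain c where c: "n = vsmult c n'" by (auto simp: span1_def)
    then have "c \<noteq> 0" using n by (auto simp: vsmult_eq_vzero)
    then show False using ll(3) by (auto simp: n(2) n'(2) c dot_smult)
  qed
  then have x: "cross n n' \<noteq> vzero" using n' cross_nonzero by blast
  have "l \<inter> l' = {span1 (cross n n')}"
  proof (intro equalityI subsetI)
    fix p assume "p \<in> l \<inter> l'"
    then obtain v where v: "v \<noteq> vzero" "p = span1 v" "dot n v = 0" "span1 v \<in> l'"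
      unfolding n(2) by blast
    from v(4) have "dot n' v = 0" unfolding n'(2) by (rule span1_in_orthogonalD)
    with v have "v \<in> span1 (cross n n')"
      using x by (intro orthogonal_both_imp_span1) (auto simp: dot_commute)
    then show "p \<in> {span1 (cross n n')}" using v span1_eqI by blast
  next
    fix p assume "p \<in> {span1 (cross n n')}"
    then show "p \<in> l \<inter> l'"
      using x dot_cross[of n n'] unfolding n(2) n'(2) dot_commute[of "cross n n'"] by blast
  qed
  then show "\<exists>x. l \<inter> l' = {x}" by blast
next
  let ?x = "(1,0,0) :: 'f vec3" and ?y = "(0,1,0) :: 'f vec3" and ?z = "(0,0,1) :: 'f vec3"
  have nz: "?x \<noteq> vzero" "?y \<noteq> vzero" "?z \<noteq> vzero" by (auto simp: vec_defs)
  have d: "span1 ?x \<noteq> span1 ?y" "span1 ?x \<noteq> span1 ?z" "span1 ?y \<noteq> span1 ?z"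
    using span1_subset_orthogonal_iff[of ?x ?y] span1_subset_orthogonal_iff[of ?y ?y]
      span1_subset_orthogonal_iff[of ?x ?z] span1_subset_orthogonal_iff[of ?z ?z]
      span1_subset_orthogonal_iff[of ?y ?z] by (auto simp: dot_def)
  have "\<not> {span1 ?x, span1 ?y, span1 ?z} \<subseteq> l" if le: "l \<in> PG2_edges" for l
  proof
    assume sub: "{span1 ?x, span1 ?y, span1 ?z} \<subseteq> l"
    obtain n where n: "n \<noteq> vzero" "l = {span1 v | v. v \<noteq> vzero \<and> dot n v = 0}"
      using PG2_edge_normal le by blast
    have on_l: "dot n v = 0" if "span1 v \<in> l" for v
      using that unfolding n(2) by (rule span1_in_orthogonalD)
    have "span1 ?x \<in> l" "span1 ?y \<in> l" "span1 ?z \<in> l" using sub by simp_all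
    then have "dot n ?x = 0" "dot n ?y = 0" "dot n ?z = 0" by (simp_all only: on_l)
    then show False using n(1) by (cases n; simp add: vec_defs)
  qed
  then have "\<forall>l\<in>PG2_edges. \<not> {span1 ?x, span1 ?y, span1 ?z} \<subseteq> l" by simp
  moreover have pt: "span1 v \<in> PG2_points" if "v \<noteq> vzero" for v :: "'f vec3"
    unfolding PG2_points_def using that by blast
  ultimately show "\<exists>x\<in>PG2_points. \<exists>y\<in>PG2_points. \<exists>z\<in>(PG2_points :: 'f vec3 set set).
      x \<noteq> y \<and> x \<noteq> z \<and> y \<noteq> z \<and> (\<forall>l\<in>PG2_edges. \<not> {x,y,z} \<subseteq> l)"
    by (rule_tac bexI[OF bexI[OF bexI[OF _ pt[OF nz(3)]] pt[OF nz(2)]] pt[OF nz(1)]])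
       (intro conjI d)
qed

section \<open>Counting and embedding in an abstract projective plane\<close>

context projective_plane
begin

lemma finite_line: "l \<in> L \<Longrightarrow> finite l"
  using finite_points line_subset finite_subset by blast

lemma finite_lines: "finite L"
proof -
  have "L \<subseteq> Pow P" using line_subset by blast
  then show ?thesis using finite_points finite_subset by blast
qed

lemma exists_join:
  assumes "x \<in> P" "y \<in> P" "x \<noteq> y" obtains l where "l \<in> L" "x \<in> l" "y \<in> l"
  using ex1_implies_ex[OF join[OF assms]] by blast

lemma lines_eqI:
  assumes "l \<in> L" "l' \<in> L" "x \<in> l" "y \<in> l" "x \<in> l'" "y \<in> l'" "x \<noteq> y"
  shows "l = l'"
proof -
  have "x \<in> P" "y \<in> P" using assms line_subset by blast+
  then have "\<exists>!l. l \<in> L \<and> x \<in> l \<and> y \<in> l" using assms(7) by (rule join)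
  then show ?thesis using assms(1-6) by (elim ex1E) metis
qed

text \<open>The three sides of a triangle have no common point, so one of them misses
  \<open>p\<close>.\<close>

lemma exists_line_avoiding:
  assumes "p \<in> P" obtains l where "l \<in> L" "p \<notin> l"
proof -
  obtain x y z where xyz: "x \<in> P" "y \<in> P" "z \<in> P" "x \<noteq> y" "x \<noteq> z" "y \<noteq> z" "\<forall>l\<in>L. \<not> {x,y,z} \<subseteq> l"
    using triangle by blast
  obtain a where a: "a \<in> L" "x \<in> a" "y \<in> a" using exists_join xyz(1,2,4) by blast
  obtain b where b: "b \<in> L" "x \<in> b" "z \<in> b" using exists_join xyz(1,3,5) by blast
  obtain c where c: "c \<in> L" "y \<in> c" "z \<in> c" using exists_join xyz(2,3,6) by blast
  have ne: "a \<noteq> b" using xyz(7) a b by auto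
  have "\<not> (p \<in> a \<and> p \<in> b \<and> p \<in> c)"
  proof
    assume *: "p \<in> a \<and> p \<in> b \<and> p \<in> c"
    then have "p = x" using lines_eqI[of a b p x] ne a b by argo
    then show False using * xyz(7) c by simp
  qed
  then show thesis using that a b c by blast
qed

definition pencil :: "'p \<Rightarrow> 'p set set" where
  "pencil p = {l \<in> L. p \<in> l}"

lemma finite_pencil: "finite (pencil p)"
  unfolding pencil_def using finite_lines by simp

text \<open>Fix a line \<open>m\<close> off \<open>p\<close>. Sending each line through
  \<open>p\<close> to its intersection with \<open>m\<close> is a bijection onto the
  \<open>q + 1\<close> points of \<open>m\<close>.\<close>

lemma card_pencil:
  assumes p: "p \<in> P" shows "card (pencil p) = q + 1"
proof -
  obtain m where m: "m \<in> L" "p \<notin> m" using exists_line_avoiding p by blast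
  have ex: "\<exists>x. l \<inter> m = {x}" if "l \<in> pencil p" for l
    using that m by (intro meet) (auto simp: pencil_def)
  let ?g = "\<lambda>l. the_elem (l \<inter> m)"
  have g: "?g l \<in> l" "?g l \<in> m" "\<And>x. x \<in> l \<Longrightarrow> x \<in> m \<Longrightarrow> x = ?g l" if "l \<in> pencil p" for l
  proof -
    obtain x where "l \<inter> m = {x}" using ex[OF \<open>l \<in> pencil p\<close>] by (rule exE)
    then show "?g l \<in> l" "?g l \<in> m" "\<And>x. x \<in> l \<Longrightarrow> x \<in> m \<Longrightarrow> x = ?g l" by auto
  qed
  have "bij_betw ?g (pencil p) m"
  proof (rule bij_betw_imageI)
    show "inj_on ?g (pencil p)"
    proof (rule inj_onI)
      fix l l' assume l: "l \<in> pencil p" "l' \<in> pencil p" "?g l = ?g l'"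
      have x: "?g l \<in> l" "?g l \<in> m" by (rule g(1)[OF l(1)], rule g(2)[OF l(1)])
      have x': "?g l \<in> l'" unfolding l(3) by (rule g(1)[OF l(2)])
      have "p \<noteq> z" if "z \<in> m" for z using that m(2) by blast
      then have "p \<noteq> ?g l" using x(2) by this
      moreover have "l \<in> L" "p \<in> l" "l' \<in> L" "p \<in> l'" using l by (auto simp: pencil_def)
      ultimately show "l = l'" using lines_eqI[of l l' p "?g l"] x x' by blast
    qed
  next
    have "m \<subseteq> ?g ` pencil p"
    proof
      fix x assume x: "x \<in> m"
      then obtain l where l: "l \<in> L" "x \<in> l" "p \<in> l"
        using exists_join[of x p] p m line_subset by blast
      then have "l \<in> pencil p" by (simp add: pencil_def)
      moreover have "x = ?g l" using g(3)[OF \<open>l \<in> pencil p\<close>] x l by blast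
      ultimately show "x \<in> ?g ` pencil p" by blast
    qed
    then show "?g ` pencil p = m" using g(2) by blast
  qed
  then show ?thesis using card_line[OF m(1)] by (simp add: bij_betw_same_card)
qed

lemma pencil_cover:
  assumes "p \<in> P" "x \<in> P" "x \<noteq> p" obtains l where "l \<in> pencil p" "x \<in> l"
  using assms exists_join[of x p] unfolding pencil_def by blast

lemma sum_pencil:
  assumes "A \<subseteq> P" "p \<in> P"
  shows "(\<Sum>l\<in>pencil p. card (l \<inter> A - {p})) = card (A - {p})"
proof -
  have "card (\<Union>l\<in>pencil p. l \<inter> A - {p}) = (\<Sum>l\<in>pencil p. card (l \<inter> A - {p}))"
  proof (rule card_UN_disjoint)
    show "finite (pencil p)" by (rule finite_pencil)
    show "\<forall>l\<in>pencil p. finite (l \<inter> A - {p})" using finite_line by (auto simp: pencil_def)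
    show "\<forall>l\<in>pencil p. \<forall>l'\<in>pencil p. l \<noteq> l' \<longrightarrow> (l \<inter> A - {p}) \<inter> (l' \<inter> A - {p}) = {}"
    proof (intro ballI impI)
      fix l l' assume l: "l \<in> pencil p" "l' \<in> pencil p" "l \<noteq> l'"
      show "(l \<inter> A - {p}) \<inter> (l' \<inter> A - {p}) = {}"
        using lines_eqI[of l l' p] l by (auto simp: pencil_def)
    qed
  qed
  moreover have "(\<Union>l\<in>pencil p. l \<inter> A - {p}) = A - {p}"
  proof (intro equalityI subsetI)
    fix x assume x: "x \<in> A - {p}"
    then obtain l where "l \<in> pencil p" "x \<in> l" using pencil_cover[OF assms(2), of x] assms(1) by blast
    then show "x \<in> (\<Union>l\<in>pencil p. l \<inter> A - {p})" using x by blast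
  qed blast
  ultimately show ?thesis by simp
qed

lemma card_points: "card P = q * (q + 1) + 1"
proof -
  obtain p where p: "p \<in> P" using triangle by blast
  have "card (l \<inter> P - {p}) = q" if "l \<in> pencil p" for l
  proof -
    have "l \<inter> P = l" using that line_subset by (auto simp: pencil_def)
    then show ?thesis using that card_line finite_line by (auto simp: pencil_def)
  qed
  then have "(q + 1) * q = card (P - {p})" using sum_pencil[of P p] p card_pencil[OF p] by simp
  then show ?thesis using card.remove[OF finite_points p] by (simp add: mult.commute)
qed

lemma card_lines: "card L = q * (q + 1) + 1"
proof -
  have "\<forall>l\<in>L. card {p\<in>P. p \<in> l} = q + 1"
  proof
    fix l assume l: "l \<in> L"
    then have "{p\<in>P. p \<in> l} = l" using line_subset by blast
    then show "card {p\<in>P. p \<in> l} = q + 1" using card_line[OF l] by simp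
  qed
  then have "(\<Sum>p\<in>P. card {l\<in>L. p \<in> l}) = (\<Sum>l\<in>L. q + 1)"
    by (rule sum_multicount_gen[OF finite_points finite_lines])
  then have "card P * (q + 1) = card L * (q + 1)"
    using card_pencil by (simp add: pencil_def)
  then have "card P = card L" using mult_cancel2[of "card P" "q + 1" "card L"] by linarith
  then show ?thesis using card_points by simp
qed

text \<open>Each pair in \<open>A \<times> B\<close> lies on exactly one line. Applied to a set and
  its complement, this drives the parity count in \<open>perturbed_odd_graph_free\<close>.\<close>

lemma sum_line_products:
  assumes "A \<subseteq> P" "B \<subseteq> P" "A \<inter> B = {}"
  shows "(\<Sum>l\<in>L. card (l \<inter> A) * card (l \<inter> B)) = card A * card B"
proof -
  have "card (\<Union>l\<in>L. (l \<inter> A) \<times> (l \<inter> B)) = (\<Sum>l\<in>L. card ((l \<inter> A) \<times> (l \<inter> B)))"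
  proof (rule card_UN_disjoint)
    show "\<forall>l\<in>L. finite ((l \<inter> A) \<times> (l \<inter> B))" using finite_line by auto
    show "\<forall>l\<in>L. \<forall>l'\<in>L. l \<noteq> l' \<longrightarrow> ((l \<inter> A) \<times> (l \<inter> B)) \<inter> ((l' \<inter> A) \<times> (l' \<inter> B)) = {}"
    proof (intro ballI impI)
      fix l l' assume l: "l \<in> L" "l' \<in> L" "l \<noteq> l'"
      show "((l \<inter> A) \<times> (l \<inter> B)) \<inter> ((l' \<inter> A) \<times> (l' \<inter> B)) = {}"
      proof (rule equals0I)
        fix z assume z: "z \<in> ((l \<inter> A) \<times> (l \<inter> B)) \<inter> ((l' \<inter> A) \<times> (l' \<inter> B))"
        then have "fst z \<noteq> snd z" using assms(3) by auto
        then show False using z lines_eqI[of l l' "fst z" "snd z"] l by auto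
      qed
    qed
  qed (rule finite_lines)
  moreover have "(\<Union>l\<in>L. (l \<inter> A) \<times> (l \<inter> B)) = A \<times> B"
  proof (intro equalityI subsetI)
    fix z assume "z \<in> A \<times> B"
    then obtain a b where z: "z = (a,b)" "a \<in> A" "b \<in> B" by blast
    then obtain l where "l \<in> L" "a \<in> l" "b \<in> l" using exists_join[of a b] assms by blast
    then show "z \<in> (\<Union>l\<in>L. (l \<inter> A) \<times> (l \<inter> B))" using z by blast
  qed blast
  ultimately show ?thesis by (simp add: card_cartesian_product)
qed

text \<open>A point \<open>x0\<close> of the plane is placed at \<open>p\<close>, and the
  \<open>q\<close> other points of each of the \<open>q + 1\<close> lines through \<open>x0\<close>
  are placed in one group. A line through \<open>x0\<close> then becomes
  \<open>insert p (R i)\<close>; any other line meets every line of the pencil once and becomes a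
  transversal of the groups.\<close>

lemma contains_if_groups:
  assumes p: "p \<in> V" and K: "finite K" "card K = q + 1"
    and R: "\<And>i. i \<in> K \<Longrightarrow> R i \<subseteq> V" "\<And>i. i \<in> K \<Longrightarrow> card (R i) = q" "\<And>i. i \<in> K \<Longrightarrow> finite (R i)"
      "\<And>i j. i \<in> K \<Longrightarrow> j \<in> K \<Longrightarrow> i \<noteq> j \<Longrightarrow> R i \<inter> R j = {}"
    and pR: "\<And>i. i \<in> K \<Longrightarrow> p \<notin> R i" "\<And>i. i \<in> K \<Longrightarrow> insert p (R i) \<in> E"
    and trans: "\<And>g. (\<And>i. i \<in> K \<Longrightarrow> g i \<in> R i) \<Longrightarrow> g ` K \<in> E"
  shows "contains P L V E"
proof -
  obtain x0 where x0: "x0 \<in> P" using triangle by blast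
  obtain \<phi> where \<phi>: "bij_betw \<phi> (pencil x0) K"
    using finite_same_card_bij[OF finite_pencil K(1)] card_pencil[OF x0] K(2) by metis
  have "\<forall>l\<in>pencil x0. \<exists>\<psi>. bij_betw \<psi> (l - {x0}) (R (\<phi> l))"
  proof
    fix l assume l: "l \<in> pencil x0"
    then have "\<phi> l \<in> K" using \<phi> by (auto simp: bij_betw_def)
    moreover have "finite (l - {x0})" "card (l - {x0}) = q"
      using l finite_line card_line by (auto simp: pencil_def)
    ultimately show "\<exists>\<psi>. bij_betw \<psi> (l - {x0}) (R (\<phi> l))"
      using finite_same_card_bij[of "l - {x0}" "R (\<phi> l)"] R by simp
  qed
  then obtain \<psi> where \<psi>: "\<And>l. l \<in> pencil x0 \<Longrightarrow> bij_betw (\<psi> l) (l - {x0}) (R (\<phi> l))" by metis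
  have "\<forall>x\<in>P-{x0}. \<exists>l. l \<in> pencil x0 \<and> x \<in> l" using pencil_cover[OF x0] by blast
  then obtain ln where ln: "\<And>x. x \<in> P - {x0} \<Longrightarrow> ln x \<in> pencil x0 \<and> x \<in> ln x" by metis
  have ln_eq: "ln x = l" if "x \<in> P - {x0}" "l \<in> pencil x0" "x \<in> l" for x l
    using ln[OF that(1)] that lines_eqI[of "ln x" l x x0] by (auto simp: pencil_def)
  define f where "f x = (if x = x0 then p else \<psi> (ln x) x)" for x
  have fl: "f ` (l - {x0}) = R (\<phi> l)" if l: "l \<in> pencil x0" for l
  proof -
    have "f x = \<psi> l x" if "x \<in> l - {x0}" for x
      using that ln_eq[of x l] l line_subset by (auto simp: f_def pencil_def)
    then have "f ` (l - {x0}) = \<psi> l ` (l - {x0})" by (intro image_cong) auto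
    then show ?thesis using \<psi>[OF l] by (simp add: bij_betw_def)
  qed
  have \<phi>K: "\<phi> l \<in> K" if "l \<in> pencil x0" for l using \<phi> that by (auto simp: bij_betw_def)
  have fR: "f x \<in> R (\<phi> (ln x))" if "x \<in> P - {x0}" for x
    using fl ln[OF that] that by blast
  have inj: "inj_on f P"
  proof (rule inj_onI)
    fix x y assume xy: "x \<in> P" "y \<in> P" "f x = f y"
    show "x = y"
    proof (cases "x = x0 \<or> y = x0")
      case True
      have ne: "f z \<noteq> p" if "z \<in> P - {x0}" for z
        using fR[OF that] pR(1)[OF \<phi>K] ln[OF that] by auto
      show ?thesis using True xy ne[of x] ne[of y] by (auto simp: f_def split: if_splits)
    next
      case False
      then have x: "x \<in> P - {x0}" and y: "y \<in> P - {x0}" using xy by auto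
      have "\<phi> (ln x) = \<phi> (ln y)"
        using fR[OF x] fR[OF y] R(4)[of "\<phi> (ln x)" "\<phi> (ln y)"] \<phi>K ln[OF x] ln[OF y] xy(3) by auto
      then have eq: "ln x = ln y" using \<phi> ln[OF x] ln[OF y] by (auto simp: bij_betw_def inj_on_def)
      then have "\<psi> (ln x) x = \<psi> (ln x) y" using xy(3) False by (auto simp: f_def)
      moreover have "inj_on (\<psi> (ln x)) (ln x - {x0})" using \<psi> ln[OF x] by (auto simp: bij_betw_def)
      ultimately show ?thesis using ln[OF x] ln[OF y] eq x y by (auto simp: inj_on_def)
    qed
  qed
  have "f ` P \<subseteq> V"
  proof
    fix z assume "z \<in> f ` P"
    then obtain x where x: "x \<in> P" "z = f x" by blast
    then show "z \<in> V" using p fR[of x] R(1) \<phi>K ln[of x] by (cases "x = x0") (auto simp: f_def)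
  qed
  moreover have "f ` l \<in> E" if l: "l \<in> L" for l
  proof (cases "x0 \<in> l")
    case True
    then have "l \<in> pencil x0" using l by (simp add: pencil_def)
    moreover have "f ` l = insert p (f ` (l - {x0}))" using True by (auto simp: f_def)
    ultimately show ?thesis using fl pR(2) \<phi>K by simp
  next
    case False
    \<comment> \<open>\<open>lin i\<close> is the line through \<open>x0\<close> whose remaining
      points are placed in \<open>R i\<close>.\<close>
    define lin where "lin i = inv_into (pencil x0) \<phi> i" for i
    have lin: "lin i \<in> pencil x0" "\<phi> (lin i) = i" if "i \<in> K" for i
      using that \<phi> unfolding lin_def bij_betw_def by (auto simp: inv_into_into f_inv_into_f)
    have "\<exists>y. l \<inter> lin i = {y}" if "i \<in> K" for i
      using lin(1)[OF that] l False by (intro meet) (auto simp: pencil_def)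
    then obtain y where y: "\<And>i. i \<in> K \<Longrightarrow> l \<inter> lin i = {y i}" by metis
    have yin: "y i \<in> lin i - {x0}" if "i \<in> K" for i using y[OF that] False by blast
    have "f (y i) \<in> R i" if "i \<in> K" for i
      using fl[OF lin(1)[OF that]] lin(2)[OF that] imageI[OF yin[OF that], of f] by simp
    then have "(\<lambda>i. f (y i)) ` K \<in> E" by (rule trans)
    moreover have "l = y ` K"
    proof (intro equalityI subsetI)
      fix x assume x: "x \<in> l"
      then have xp: "x \<in> P - {x0}" using l False line_subset by blast
      let ?i = "\<phi> (ln x)"
      have "lin ?i = ln x" using \<phi> ln[OF xp] by (auto simp: lin_def bij_betw_def)
      then have "x = y ?i" using y[of ?i] \<phi>K ln[OF xp] x by blast
      then show "x \<in> y ` K" using \<phi>K ln[OF xp] by blast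
    next
      fix x assume "x \<in> y ` K" then show "x \<in> l" using y by blast
    qed
    then have "f ` l = (\<lambda>i. f (y i)) ` K" by (simp add: image_image)
    ultimately show ?thesis by simp
  qed
  ultimately show ?thesis using inj unfolding contains_def by blast
qed

text \<open>One line is placed on the edge \<open>e\<close>, and the \<open>q * q\<close> points off
  it go anywhere into \<open>Y\<close>. Every other line has one point on the first line and
  \<open>q\<close> points off it, so its image is covered by \<open>join_Y\<close> whatever the
  placement is.\<close>

lemma contains_if_affine:
  assumes e: "e \<subseteq> V" "card e = q + 1" "e \<in> E"
    and Y: "Y \<subseteq> V - e" "q * q \<le> card Y" "finite Y"
    and join_Y: "\<And>a T. a \<in> e \<Longrightarrow> T \<subseteq> Y \<Longrightarrow> card T = q \<Longrightarrow> insert a T \<in> E"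
  shows "contains P L V E"
proof -
  obtain p where p: "p \<in> P" using triangle by blast
  then obtain l0 where l0: "l0 \<in> L" using exists_line_avoiding by blast
  have fe: "finite e" using e(2) by (simp add: card_ge_0_finite)
  obtain g where g: "bij_betw g l0 e"
    using finite_same_card_bij[OF finite_line[OF l0] fe] card_line[OF l0] e(2) by auto
  have "card (P - l0) = q * q"
    using card_Diff_subset[OF finite_line[OF l0] line_subset[OF l0]] card_points card_line[OF l0] by simp
  then obtain h where h: "inj_on h (P - l0)" "h ` (P - l0) \<subseteq> Y"
    using card_le_inj[of "P - l0" Y] finite_points Y by auto
  define f where "f x = (if x \<in> l0 then g x else h x)" for x
  have "inj_on f P"
  proof (rule inj_onI)
    fix x y assume xy: "x \<in> P" "y \<in> P" "f x = f y"
    have sep: "g u \<noteq> h v" if "u \<in> l0" "v \<in> P - l0" for u v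
    proof -
      have "g u \<in> e" using bij_betwE[OF g] that(1) by blast
      moreover have "h v \<in> V - e" using that(2) h(2) Y(1) by blast
      ultimately show ?thesis by auto
    qed
    have "x \<in> l0 \<longleftrightarrow> y \<in> l0"
      using xy sep[of x y] sep[of y x] by (auto simp: f_def split: if_splits)
    then show "x = y"
      using xy g h(1) by (cases "x \<in> l0") (auto simp: f_def bij_betw_def inj_on_def)
  qed
  moreover have "f ` P \<subseteq> V"
    using bij_betwE[OF g] h(2) Y(1) e(1) by (auto simp: f_def)
  moreover have "f ` l \<in> E" if l: "l \<in> L" for l
  proof (cases "l = l0")
    case True
    then have "f ` l = g ` l0" by (auto simp: f_def)
    then show ?thesis using g e by (simp add: bij_betw_def)
  next
    case False
    then obtain x where x: "l \<inter> l0 = {x}" using meet l l0 by blast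
    have lx: "l - {x} \<subseteq> P - l0" using x line_subset[OF l] by blast
    have "f ` l = insert (g x) (f ` (l - {x}))" using x by (auto simp: f_def)
    also have "f ` (l - {x}) = h ` (l - {x})" using lx by (intro image_cong) (auto simp: f_def)
    finally have fl: "f ` l = insert (g x) (h ` (l - {x}))" .
    have xl: "x \<in> l" "x \<in> l0" using x by blast+
    have "card (h ` (l - {x})) = q"
      using card_image[OF inj_on_subset[OF h(1) lx]] card_line[OF l] xl by simp
    moreover have "h ` (l - {x}) \<subseteq> Y" using lx h(2) by blast
    moreover have "g x \<in> e" using bij_betwE[OF g] xl by blast
    ultimately show ?thesis unfolding fl by (intro join_Y)
  qed
  ultimately show ?thesis unfolding contains_def by blast
qed

end

subsection \<open>Complete partite subsystems of dense tuple systems\<close>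

lemma Suc_tuples_card:
  fixes T :: "(nat \<Rightarrow> 'v) set"
  assumes V: "finite V" and T: "T \<subseteq> PiE {..<Suc m} (\<lambda>_. V)"
  shows "card T = (\<Sum>x\<in>V. card {g \<in> PiE {..<m} (\<lambda>_. V). g(m := x) \<in> T})"
proof -
  let ?X = "\<lambda>x. {g \<in> PiE {..<m} (\<lambda>_. V). g(m := x) \<in> T}"
  have fin: "finite (?X x)" for x using V by (simp add: finite_PiE)
  have inj: "inj_on (\<lambda>(x,g). g(m := x)) (Sigma V ?X)"
  proof (rule inj_onI, clarify)
    fix x g x' g' assume *: "g \<in> PiE {..<m} (\<lambda>_. V)" "g' \<in> PiE {..<m} (\<lambda>_. V)" "g(m := x) = g'(m := x')"
    have "x = x'" using fun_cong[OF *(3), of m] by simp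
    moreover have "g i = g' i" for i
      using fun_cong[OF *(3), of i] *(1,2) by (cases "i = m") (auto simp: PiE_def extensional_def)
    ultimately show "x = x' \<and> g = g'" by auto
  qed
  have "T = (\<lambda>(x,g). g(m := x)) ` (Sigma V ?X)"
  proof (intro equalityI subsetI)
    fix f assume f: "f \<in> T"
    then have "f \<in> PiE (insert m {..<m}) (\<lambda>_. V)" using T by (auto simp: lessThan_Suc)
    then obtain x g where "x \<in> V" "g \<in> PiE {..<m} (\<lambda>_. V)" "f = g(m := x)"
      unfolding PiE_insert_eq by auto
    then show "f \<in> (\<lambda>(x,g). g(m := x)) ` (Sigma V ?X)" using f by force
  qed auto
  then have "card T = card (Sigma V ?X)" using card_image[OF inj] by simp
  also have "\<dots> = (\<Sum>x\<in>V. card (?X x))" using V fin by (simp add: card_SigmaI)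
  finally show ?thesis .
qed

text \<open>The theorem of Erdos on complete partite subsystems, for ordered tuples. In the
  induction step one picks \<open>r\<close> last coordinates with dense links, notes that many
  shorter tuples lie in at least \<open>t\<close> of these links, and selects by pigeonhole a dense
  set of shorter tuples lying in the same links.\<close>

lemma complete_partite_in_dense_tuples:
  fixes c :: real
  assumes "c > 0"
  shows "\<exists>N. \<forall>(V :: 'v set) T. finite V \<longrightarrow> N \<le> card V \<longrightarrow> T \<subseteq> PiE {..<m} (\<lambda>_. V) \<longrightarrow>
    c * real (card V) ^ m \<le> real (card T) \<longrightarrow>
    (\<exists>Q. (\<forall>i<m. Q i \<subseteq> V \<and> card (Q i) = t) \<and> PiE {..<m} Q \<subseteq> T)"
  using assms
proof (induction m arbitrary: c)
  case 0
  have "T = PiE {..<0} Q" if "T \<subseteq> PiE {..<0} (\<lambda>_. V)" "c * real (card V) ^ 0 \<le> real (card T)"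
    for V :: "'v set" and T and Q :: "nat \<Rightarrow> 'v set"
  proof -
    have "card T \<noteq> 0" using that(2) 0 by auto
    then have "T \<noteq> {}" by auto
    then show ?thesis using that(1) by auto
  qed
  then show ?case by (intro exI[of _ 0]) blast
next
  case (Suc m)
  \<comment> \<open>With \<open>real t / real r\<close> at most \<open>c / 4\<close>, tuples lying
    in fewer than \<open>t\<close> of the \<open>r\<close> links account for at most half of the
    average density \<open>c / 2\<close>.\<close>
  define r where "r = nat \<lceil>4 * real t / c\<rceil> + 1"
  have r: "real t / real r \<le> c / 4" "r > 0"
  proof -
    have "4 * real t / c \<le> real r" unfolding r_def by linarith
    moreover have "real r > 0" by (simp add: r_def)
    ultimately show "real t / real r \<le> c / 4" using Suc.prems by (simp add: field_simps)
  qed (simp add: r_def)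
  \<comment> \<open>The density \<open>c / 4\<close> left after discarding is divided among the
    \<open>2 ^ r\<close> subsets of \<open>R\<close> in the pigeonhole step.\<close>
  define c' where "c' = c / 4 / 2 ^ r"
  have "c' > 0" using Suc.prems by (simp add: c'_def)
  obtain N where N: "\<forall>(V :: 'v set) T. finite V \<longrightarrow> N \<le> card V \<longrightarrow> T \<subseteq> PiE {..<m} (\<lambda>_. V) \<longrightarrow>
    c' * real (card V) ^ m \<le> real (card T) \<longrightarrow>
    (\<exists>Q. (\<forall>i<m. Q i \<subseteq> V \<and> card (Q i) = t) \<and> PiE {..<m} Q \<subseteq> T)"
    using Suc.IH[OF \<open>c' > 0\<close>] by (rule exE)
  \<comment> \<open>\<open>N\<close> serves the induction hypothesis, the second summand yields
    \<open>r\<close> vertices with dense links, and the 1 makes \<open>V\<close> nonempty.\<close>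
  define N' where "N' = N + nat \<lceil>2 * real r / c\<rceil> + 1"
  show ?case
  proof (intro exI[of _ N'] allI impI)
    fix V :: "'v set" and T
    assume V: "finite V" "N' \<le> card V" and T: "T \<subseteq> PiE {..<Suc m} (\<lambda>_. V)"
      and dens: "c * real (card V) ^ Suc m \<le> real (card T)"
    define n where "n = real (card V)"
    have n: "n > 0" "2 * real r / c \<le> n" using V(2) unfolding n_def N'_def by linarith+
    let ?G = "PiE {..<m} (\<lambda>_. V)"
    have finG: "finite ?G" using V by (simp add: finite_PiE)
    have cardG: "real (card ?G) = n ^ m" by (simp add: card_PiE n_def)
    define X where "X x = {g \<in> ?G. g(m := x) \<in> T}" for x
    have finX: "finite (X x)" and subX: "X x \<subseteq> ?G" for x using finG by (auto simp: X_def)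
    have Xle: "real (card (X x)) \<le> n ^ m" for x
      using card_mono[OF finG subX] cardG by (metis of_nat_le_iff)
    have sumX: "real (card T) = (\<Sum>x\<in>V. real (card (X x)))"
      using Suc_tuples_card[OF V(1) T] by (simp add: X_def)
    define W where "W = {x \<in> V. c / 2 * n ^ m \<le> real (card (X x))}"
    have "c * n ^ Suc m \<le> (\<Sum>x\<in>V. real (card (X x)))" using dens sumX by (simp add: n_def)
    also have "\<dots> \<le> (\<Sum>x\<in>V. (if x \<in> W then n ^ m else 0) + c / 2 * n ^ m)"
      using Xle Suc.prems n(1) by (intro sum_mono) (auto simp: W_def add_increasing2)
    also have "\<dots> = real (card W) * n ^ m + n * (c / 2 * n ^ m)"
    proof -
      have "W \<subseteq> V" by (auto simp: W_def)
      then have "(\<Sum>x\<in>V. if x \<in> W then n ^ m else 0) = real (card W) * n ^ m"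
        using V(1) by (simp add: sum.If_cases Int_absorb1)
      then show ?thesis by (simp add: sum.distrib n_def)
    qed
    finally have "n ^ m * (c / 2 * n) \<le> n ^ m * real (card W)" by (simp add: field_simps)
    then have "c / 2 * n \<le> real (card W)" using n(1) by simp
    moreover have "real r \<le> c / 2 * n" using n(2) Suc.prems by (simp add: field_simps)
    ultimately have "r \<le> card W" by linarith
    then obtain R where R: "R \<subseteq> W" "card R = r" "finite R" by (rule obtain_subset_with_card_n)
    define cnt where "cnt g = {x \<in> R. g \<in> X x}" for g
    define G' where "G' = {g \<in> ?G. t \<le> card (cnt g)}"
    have finG': "finite G'" using finG by (simp add: G'_def)
    have "real r * (c / 2 * n ^ m) \<le> (\<Sum>x\<in>R. real (card (X x)))"
      using sum_mono[of R "\<lambda>_. c / 2 * n ^ m" "\<lambda>x. real (card (X x))"] R by (auto simp: W_def)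
    also have "\<dots> = (\<Sum>g\<in>?G. real (card (cnt g)))"
    proof -
      have "{g \<in> ?G. g \<in> X x} = X x" for x using subX by blast
      then have "(\<Sum>g\<in>?G. card {x\<in>R. g \<in> X x}) = (\<Sum>x\<in>R. card (X x))"
        by (intro sum_multicount_gen finG R) auto
      then have "real (\<Sum>g\<in>?G. card {x\<in>R. g \<in> X x}) = real (\<Sum>x\<in>R. card (X x))" by simp
      then show ?thesis by (simp add: cnt_def)
    qed
    also have "\<dots> \<le> (\<Sum>g\<in>?G. (if g \<in> G' then real r else 0) + real t)"
    proof (rule sum_mono)
      fix g assume g: "g \<in> ?G"
      have "card (cnt g) \<le> r" using card_mono[OF R(3), of "cnt g"] R(2) by (auto simp: cnt_def)
      then show "real (card (cnt g)) \<le> (if g \<in> G' then real r else 0) + real t"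
        using g by (auto simp: G'_def)
    qed
    also have "\<dots> = real (card G') * real r + n ^ m * real t"
    proof -
      have "G' \<subseteq> ?G" by (auto simp: G'_def)
      then have "(\<Sum>g\<in>?G. if g \<in> G' then real r else 0) = real (card G') * real r"
        using finG by (simp add: sum.If_cases Int_absorb1)
      then show ?thesis using cardG by (simp add: sum.distrib)
    qed
    finally have "c / 2 * n ^ m - n ^ m * (real t / real r) \<le> real (card G')"
      using r(2) by (simp add: field_simps)
    moreover have "n ^ m * (real t / real r) \<le> n ^ m * (c / 4)"
      using r(1) n(1) by (intro mult_left_mono) auto
    moreover have "n ^ m * (c / 4) = c / 4 * n ^ m" "c / 2 * n ^ m = 2 * (c / 4 * n ^ m)" by simp_all
    ultimately have G'big: "c / 4 * n ^ m \<le> real (card G')" by linarith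
    \<comment> \<open>The pigeonhole runs over the full set of links containing \<open>g\<close>,
      not over its \<open>t\<close>-subsets; the common value \<open>Z\<close> has at least
      \<open>t\<close> elements since some tuple attains it.\<close>
    have "cnt \<in> G' \<rightarrow> Pow R" by (auto simp: cnt_def)
    then obtain Z where Z: "Z \<in> Pow R" "card G' \<le> card (cnt -` {Z} \<inter> G') * card (Pow R)"
      using pigeonhole_card[of cnt G' "Pow R"] finG' R(3) by blast
    define G'' where "G'' = cnt -` {Z} \<inter> G'"
    have "real (card G') \<le> real (card G'') * 2 ^ r"
      using of_nat_mono[OF Z(2), where 'a = real] R unfolding G''_def by (simp add: card_Pow)
    then have big: "c' * n ^ m \<le> real (card G'')" using G'big by (simp add: c'_def field_simps)
    then have "0 < real (card G'')" using \<open>c' > 0\<close> n(1) by (smt (verit) mult_pos_pos zero_less_power)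
    then have "G'' \<noteq> {}" by auto
    then obtain g0 where "g0 \<in> G''" by blast
    then have "t \<le> card Z" by (auto simp: G''_def G'_def)
    then obtain Y where Y: "Y \<subseteq> Z" "card Y = t" by (rule obtain_subset_with_card_n)
    have "G'' \<subseteq> ?G" by (auto simp: G''_def G'_def)
    moreover have "N \<le> card V" using V(2) by (simp add: N'_def)
    ultimately have "\<exists>Q. (\<forall>i<m. Q i \<subseteq> V \<and> card (Q i) = t) \<and> PiE {..<m} Q \<subseteq> G''"
      using N[THEN spec, THEN spec, of V G''] V(1) big unfolding n_def by simp
    then obtain Q where Q: "\<forall>i<m. Q i \<subseteq> V \<and> card (Q i) = t" "PiE {..<m} Q \<subseteq> G''"
      by (elim exE conjE)
    have YV: "Y \<subseteq> V" using Y(1) Z(1) R(1) by (auto simp: W_def)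
    show "\<exists>Q. (\<forall>i<Suc m. Q i \<subseteq> V \<and> card (Q i) = t) \<and> PiE {..<Suc m} Q \<subseteq> T"
    proof (intro exI[of _ "Q(m := Y)"] conjI allI impI)
      fix i assume "i < Suc m"
      then show "(Q(m := Y)) i \<subseteq> V" "card ((Q(m := Y)) i) = t"
        using Q(1) YV Y(2) by (auto simp: less_Suc_eq)
    next
      show "PiE {..<Suc m} (Q(m := Y)) \<subseteq> T"
      proof
        fix f assume "f \<in> PiE {..<Suc m} (Q(m := Y))"
        then have "f \<in> PiE (insert m {..<m}) (Q(m := Y))" by (simp add: lessThan_Suc)
        then obtain y g where yg: "y \<in> Y" "g \<in> PiE {..<m} (Q(m := Y))" "f = g(m := y)"
          unfolding PiE_insert_eq by auto
        have "PiE {..<m} (Q(m := Y)) = PiE {..<m} Q" by (rule PiE_cong) auto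
        with yg(2) have "g \<in> PiE {..<m} Q" by (simp only:)
        with Q(2) have "g \<in> G''" by (rule subsetD)
        then have "y \<in> cnt g" using yg(1) Y(1) by (auto simp: G''_def)
        then show "f \<in> T" by (simp add: cnt_def X_def yg(3))
      qed
    qed
  qed
qed

subsection \<open>Random samples\<close>

text \<open>This replaces conditional independence: once the coordinates in \<open>I\<close> are
  fixed, those in \<open>K\<close> are chosen freely, so they can be summed out one at a time, each
  contributing a factor of at most \<open>C\<close>.\<close>

lemma sum_tuples_prod_le:
  fixes w :: "'v set \<Rightarrow> 'v \<Rightarrow> real" and C :: real
  assumes fin: "finite I" "finite K" "finite V" and disj: "I \<inter> K = {}"
    and w: "\<And>S v. 0 \<le> w S v" "\<And>S. S \<subseteq> V \<Longrightarrow> (\<Sum>v\<in>V. w S v) \<le> C"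
  shows "(\<Sum>f\<in>PiE (I \<union> K) (\<lambda>_. V). \<Prod>j\<in>K. w (f ` I) (f j)) \<le> real (card V) ^ card I * C ^ card K"
  using fin(2) disj
proof (induction K rule: finite_induct)
  case empty
  then show ?case using fin by (simp add: card_PiE)
next
  case (insert k K)
  let ?P = "PiE (I \<union> K) (\<lambda>_. V)"
  let ?F = "\<lambda>f. \<Prod>j\<in>K. w (f ` I) (f j)"
  have C: "0 \<le> C" using w(1) w(2)[of "{}"] sum_nonneg[of V "w {}"] by force
  have k: "k \<notin> I \<union> K" "k \<notin> I" using insert by auto
  have upd: "(g(k := y)) ` I = g ` I" for g y using k by auto
  have "(\<Sum>f\<in>PiE (I \<union> insert k K) (\<lambda>_. V). \<Prod>j\<in>insert k K. w (f ` I) (f j))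
      = (\<Sum>f\<in>(\<lambda>(y, g). g(k := y)) ` (V \<times> ?P). \<Prod>j\<in>insert k K. w (f ` I) (f j))"
    by (simp add: PiE_insert_eq)
  also have "\<dots> = (\<Sum>(y,g)\<in>V \<times> ?P. \<Prod>j\<in>insert k K. w ((g(k := y)) ` I) ((g(k := y)) j))"
    using inj_combinator[OF k(1), of "\<lambda>_. V"] by (simp add: sum.reindex case_prod_unfold)
  also have "\<dots> = (\<Sum>(y,g)\<in>V \<times> ?P. w (g ` I) y * ?F g)"
  proof (intro sum.cong refl, clarify)
    fix y g
    have "(\<Prod>j\<in>K. w (g ` I) ((g(k := y)) j)) = ?F g" using insert(2) by (intro prod.cong) auto
    then show "(\<Prod>j\<in>insert k K. w ((g(k := y)) ` I) ((g(k := y)) j)) = w (g ` I) y * ?F g"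
      by (simp only: prod.insert[OF insert(1,2)] upd fun_upd_same)
  qed
  also have "\<dots> = (\<Sum>y\<in>V. \<Sum>g\<in>?P. w (g ` I) y * ?F g)" by (simp add: sum.cartesian_product)
  also have "\<dots> = (\<Sum>g\<in>?P. \<Sum>y\<in>V. w (g ` I) y * ?F g)" by (rule sum.swap)
  also have "\<dots> = (\<Sum>g\<in>?P. (\<Sum>y\<in>V. w (g ` I) y) * ?F g)" by (simp add: sum_distrib_right)
  also have "\<dots> \<le> (\<Sum>g\<in>?P. C * ?F g)"
  proof (intro sum_mono mult_right_mono prod_nonneg w)
    fix g assume "g \<in> ?P" then show "g ` I \<subseteq> V" by auto
  qed
  also have "\<dots> = C * (\<Sum>g\<in>?P. ?F g)" by (simp add: sum_distrib_left)
  also have "\<dots> \<le> C * (real (card V) ^ card I * C ^ card K)"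
    using insert C by (intro mult_left_mono) auto
  also have "\<dots> = real (card V) ^ card I * C ^ card (insert k K)" using insert by simp
  finally show ?case .
qed

text \<open>The numerical core of the Chernoff estimate in \<open>card_low_degree_tuples\<close>,
  with tilt \<open>z\<close>. The square of \<open>(1 + z) / 2\<close> is slightly larger than
  \<open>z\<close>, so an even exponent \<open>2 * u\<close> would give no decay. The one extra
  factor is at most \<open>exp (- 1 / (2 * real (u + 1)))\<close>, which pays twice for the excess
  of the \<open>u\<close> squares.\<close>

lemma half_power_le:
  fixes u :: nat
  assumes "u > 0"
  defines "z \<equiv> real u / real (u + 1)"
  shows "((1 + z) / 2) ^ (2 * u + 1) \<le> exp (- 1 / (4 * real (u + 1))) * z ^ u"
proof -
  let ?a = "(1 + z) / 2" and ?x = "1 / (4 * real u * real (u + 1))"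
  have a1: "?a = 1 - 1 / (2 * real (u + 1))" using assms by (simp add: z_def field_simps)
  have z0: "z \<ge> 0" by (simp add: z_def)
  have a2: "?a ^ 2 = z * (1 + ?x)"
  proof -
    have "((1 + t / (t + 1)) / 2)\<^sup>2 = t / (t + 1) * (1 + 1 / (4 * t * (t + 1)))" if "t > 0" for t :: real
    proof -
      have "1 + t / (t + 1) = (2 * t + 1) / (t + 1)" using that by (simp add: field_simps)
      moreover have "1 + 1 / (4 * t * (t + 1)) = (2 * t + 1)\<^sup>2 / (4 * t * (t + 1))"
      proof -
        have "(2 * t + 1)\<^sup>2 = 4 * t * (t + 1) + 1" by (simp add: power2_eq_square algebra_simps)
        moreover have nz: "4 * t * (t + 1) \<noteq> 0" using that by simp
        ultimately show ?thesis by (simp only: add_divide_distrib divide_self[OF nz])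
      qed
      ultimately show ?thesis using that by (simp add: power2_eq_square) (simp add: algebra_simps)
    qed
    from this[of "real u"] show ?thesis using assms by (simp add: z_def add.commute)
  qed
  have "(1 + ?x) ^ u \<le> exp ?x ^ u" by (intro power_mono) (auto simp: exp_ge_add_one_self)
  also have "\<dots> = exp (real u * ?x)" by (simp only: exp_of_nat_mult)
  also have "real u * ?x = 1 / (4 * real (u + 1))" using assms by simp
  finally have b: "(1 + ?x) ^ u \<le> exp (1 / (4 * real (u + 1)))" .
  have c: "?a \<le> exp (- 1 / (2 * real (u + 1)))"
    using exp_ge_add_one_self[of "- 1 / (2 * real (u + 1))"] unfolding a1 by simp
  have "?a ^ (2 * u + 1) = z ^ u * ((1 + ?x) ^ u * ?a)"
    by (simp only: power_add power_mult a2 power_mult_distrib power_one_right mult.assoc)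
  also have "\<dots> \<le> z ^ u * (exp (1 / (4 * real (u + 1))) * exp (- 1 / (2 * real (u + 1))))"
    using b c z0 by (intro mult_left_mono mult_mono) auto
  also have "\<dots> = z ^ u * exp (- 1 / (4 * real (u + 1)))"
  proof -
    have "1 / (4 * real (u + 1)) + - 1 / (2 * real (u + 1)) = - 1 / (4 * real (u + 1))"
    proof -
      have "1 / (4 * x) + - 1 / (2 * x) = - 1 / (4 * x)" if "x > 0" for x :: real
        using that by (simp add: divide_simps)
      from this[of "real (u + 1)"] show ?thesis by (simp del: of_nat_add of_nat_Suc)
    qed
    then show ?thesis by (simp only: exp_add[symmetric])
  qed
  finally show ?thesis by (simp add: mult.commute)
qed

lemma card_low_degree_tuples:
  fixes nb :: "'v set \<Rightarrow> 'v set" and u l q :: nat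
  assumes V: "finite V" and u: "u > 0" and m: "m = (2 * u + 1) * l"
    and I: "I \<subseteq> {..<m}" "card I = q"
    and nb: "\<And>S. S \<subseteq> V \<Longrightarrow> card S = q \<Longrightarrow> nb S \<subseteq> V \<and> card V \<le> 2 * card (nb S)"
  shows "real (card {f \<in> PiE {..<m} (\<lambda>_. V). card (f ` I) = q \<and> card {j \<in> {..<m} - I. f j \<in> nb (f ` I)} < u * l})
    \<le> real (card V) ^ m * 2 ^ q * exp (- 1 / (4 * real (u + 1))) ^ l"
proof -
  define z where "z = real u / real (u + 1)"
  have z: "0 < z" "z < 1" using u by (auto simp: z_def)
  let ?n = "real (card V)"
  define w where "w S v = (if card S = q then (if v \<in> nb S then z else 1) else 0)" for S v
  let ?K = "{..<m} - I"
  let ?bad = "{f \<in> PiE {..<m} (\<lambda>_. V). card (f ` I) = q \<and> card {j \<in> ?K. f j \<in> nb (f ` I)} < u * l}"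
  have finI: "finite I" using I finite_subset by blast
  have IK: "I \<union> ?K = {..<m}" using I by auto
  have w0: "0 \<le> w S v" for S v using z by (simp add: w_def)
  have wsum: "(\<Sum>v\<in>V. w S v) \<le> ?n * ((1 + z) / 2)" if S: "S \<subseteq> V" for S
  proof (cases "card S = q")
    case True
    have nbS: "nb S \<subseteq> V" "?n \<le> 2 * real (card (nb S))" using nb[OF S True] by linarith+
    have "(\<Sum>v\<in>V. w S v) = (\<Sum>v\<in>V. 1 - (if v \<in> nb S then 1 - z else 0))"
      by (intro sum.cong) (auto simp: w_def True)
    also have "\<dots> = ?n - real (card (nb S)) * (1 - z)"
      using V nbS(1) by (simp add: sum_subtractf sum.If_cases Int_absorb1)
    also have "\<dots> \<le> ?n - ?n / 2 * (1 - z)"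
      using nbS(2) z by (intro diff_left_mono mult_right_mono) auto
    also have "\<dots> = ?n * ((1 + z) / 2)" by (simp add: field_simps)
    finally show ?thesis .
  next
    case False
    then show ?thesis using z by (simp add: w_def)
  qed
  have fP: "finite (PiE {..<m} (\<lambda>_. V))" using V by (simp add: finite_PiE)
  have ge: "z ^ (u * l) \<le> (\<Prod>j\<in>?K. w (f ` I) (f j))" if "f \<in> ?bad" for f
  proof -
    have "(\<Prod>j\<in>?K. w (f ` I) (f j)) = (\<Prod>j\<in>?K. if f j \<in> nb (f ` I) then z else 1)"
      using that by (intro prod.cong) (auto simp: w_def)
    also have "\<dots> = z ^ card {j \<in> ?K. f j \<in> nb (f ` I)}"
      by (simp add: prod.If_cases Int_def)
    finally show ?thesis using that z by (auto intro!: power_decreasing)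
  qed
  have "real (card ?bad) * z ^ (u * l) = (\<Sum>f\<in>?bad. z ^ (u * l))" by simp
  also have "\<dots> \<le> (\<Sum>f\<in>?bad. \<Prod>j\<in>?K. w (f ` I) (f j))" by (rule sum_mono[OF ge])
  also have "\<dots> \<le> (\<Sum>f\<in>PiE (I \<union> ?K) (\<lambda>_. V). \<Prod>j\<in>?K. w (f ` I) (f j))"
    unfolding IK by (intro sum_mono2 fP prod_nonneg w0) auto
  also have "\<dots> \<le> ?n ^ card I * (?n * ((1 + z) / 2)) ^ card ?K"
    by (intro sum_tuples_prod_le finI V w0 wsum) auto
  also have "\<dots> = ?n ^ m * ((1 + z) / 2) ^ (m - q)"
  proof -
    have "card ?K = m - q" using I finI by (simp add: card_Diff_subset)
    moreover have "q \<le> m" using I card_mono[of "{..<m}" I] by simp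
    then have "?n ^ q * ?n ^ (m - q) = ?n ^ m" by (simp add: power_add[symmetric])
    ultimately show ?thesis by (simp only: I(2) power_mult_distrib mult.assoc[symmetric])
  qed
  \<comment> \<open>The \<open>q\<close> coordinates in \<open>I\<close> carry no weight. As
    \<open>(1 + z) / 2\<close> is at least one half, supplying the missing \<open>q\<close> factors
    costs at most \<open>2 ^ q\<close>.\<close>
  also have "\<dots> \<le> ?n ^ m * (2 ^ q * ((1 + z) / 2) ^ m)"
  proof (intro mult_left_mono)
    have "q \<le> m" using I card_mono[of "{..<m}" I] by simp
    then have "((1 + z) / 2) ^ m = ((1 + z) / 2) ^ (m - q) * ((1 + z) / 2) ^ q"
      by (simp add: power_add[symmetric])
    moreover have "1 \<le> 2 ^ q * ((1 + z) / 2) ^ q"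
      using z by (simp add: power_mult_distrib[symmetric] one_le_power)
    moreover have "0 \<le> ((1 + z) / 2) ^ (m - q)" using z by simp
    ultimately show "((1 + z) / 2) ^ (m - q) \<le> 2 ^ q * ((1 + z) / 2) ^ m"
      using mult_left_mono[of 1 "2 ^ q * ((1 + z) / 2) ^ q" "((1 + z) / 2) ^ (m - q)"]
      by (simp add: mult_ac)
  qed simp
  also have "\<dots> = ?n ^ m * 2 ^ q * (((1 + z) / 2) ^ (2 * u + 1)) ^ l"
    by (simp only: m power_mult mult.assoc)
  also have "\<dots> \<le> ?n ^ m * 2 ^ q * (exp (- 1 / (4 * real (u + 1))) * z ^ u) ^ l"
    using half_power_le[OF u] z by (intro mult_left_mono power_mono) (auto simp: z_def)
  also have "\<dots> = (?n ^ m * 2 ^ q * exp (- 1 / (4 * real (u + 1))) ^ l) * z ^ (u * l)"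
    by (simp add: power_mult_distrib power_mult)
  finally show ?thesis using z by simp
qed

lemma card_tuples_coincide:
  assumes "finite V" "i < m" "j < m" "i \<noteq> j"
  shows "card {f \<in> PiE {..<m} (\<lambda>_. V). f i = f j} \<le> card V ^ (m - 1)"
proof -
  let ?A = "{f \<in> PiE {..<m} (\<lambda>_. V). f i = f j}"
  let ?r = "\<lambda>f. restrict f ({..<m} - {j})"
  have "inj_on ?r ?A"
  proof (rule inj_onI)
    fix f g assume fg: "f \<in> ?A" "g \<in> ?A" "?r f = ?r g"
    have eq: "f x = g x" if "x < m" "x \<noteq> j" for x
      using fun_cong[OF fg(3), of x] that by simp
    have "f x = g x" for x
    proof (cases "x < m")
      case True
      show ?thesis
      proof (cases "x = j")
        case True
        then show ?thesis using fg(1,2) eq[of i] assms by simp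
      qed (use eq True in simp)
    next
      case False
      then show ?thesis using fg(1,2) by (auto simp: PiE_def extensional_def)
    qed
    then show "f = g" by auto
  qed
  moreover have "?r ` ?A \<subseteq> PiE ({..<m} - {j}) (\<lambda>_. V)"
    by (rule image_subsetI) (auto simp: PiE_def Pi_def)
  moreover have "finite (PiE ({..<m} - {j}) (\<lambda>_. V))" using assms by (simp add: finite_PiE)
  ultimately have "card ?A \<le> card (PiE ({..<m} - {j}) (\<lambda>_. V))" by (rule card_inj_on_le)
  then show ?thesis using assms by (simp add: card_PiE)
qed

text \<open>A power of \<open>l\<close> loses against an exponential in \<open>l\<close>. In the
  power, \<open>m ^ q\<close> bounds the number of index sets \<open>I\<close> and
  \<open>2 ^ q\<close> is the loss from \<open>card_low_degree_tuples\<close>.\<close>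

lemma exists_sample_size:
  fixes q u L :: nat
  shows "\<exists>l\<ge>L. 4 * ((2 * real ((2 * u + 1) * l)) ^ q * exp (- 1 / (4 * real (u + 1))) ^ l) \<le> 1"
proof -
  define k where "k = 1 / (4 * real (u + 1))"
  have k: "k > 0" by (simp add: k_def)
  define a where "a = 2 * real (2 * u + 1) / k"
  have "((\<lambda>x. x ^ q / exp x) \<longlongrightarrow> (0::real)) at_top" by (rule tendsto_power_div_exp_0)
  moreover have "filterlim (\<lambda>l. k * real l) at_top sequentially"
    using k by (intro filterlim_tendsto_pos_mult_at_top[OF tendsto_const] filterlim_real_sequentially)
  ultimately have "((\<lambda>l. (k * real l) ^ q / exp (k * real l)) \<longlongrightarrow> 0) sequentially"
    by (rule filterlim_compose)
  then have "((\<lambda>l. 4 * a ^ q * ((k * real l) ^ q / exp (k * real l))) \<longlongrightarrow> 4 * a ^ q * 0) sequentially"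
    by (intro tendsto_intros)
  then have "\<forall>\<^sub>F l in sequentially. 4 * a ^ q * ((k * real l) ^ q / exp (k * real l)) < 1"
    by (rule order_tendstoD) simp
  then obtain l0 where l0: "\<And>l. l \<ge> l0 \<Longrightarrow> 4 * a ^ q * ((k * real l) ^ q / exp (k * real l)) < 1"
    by (auto simp: eventually_sequentially)
  define l where "l = max l0 L"
  have "(2 * real ((2 * u + 1) * l)) ^ q = a ^ q * (k * real l) ^ q"
  proof -
    have "a * k = 2 * real (2 * u + 1)" using k by (simp add: a_def)
    then have "2 * real ((2 * u + 1) * l) = a * (k * real l)" by (simp only: of_nat_mult mult.assoc[symmetric])
    then show ?thesis by (simp only: power_mult_distrib)
  qed
  moreover have "exp (- 1 / (4 * real (u + 1))) ^ l = 1 / exp (k * real l)"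
  proof -
    have "exp (- 1 / (4 * real (u + 1))) ^ l = exp (- (k * real l))"
      by (simp add: k_def exp_of_nat_mult[symmetric])
    then show ?thesis by (simp only: exp_minus inverse_eq_divide)
  qed
  ultimately have "4 * ((2 * real ((2 * u + 1) * l)) ^ q * exp (- 1 / (4 * real (u + 1))) ^ l) \<le> 1"
    using l0[of l] by (simp add: l_def)
  then show ?thesis by (intro exI[of _ l]) (auto simp: l_def)
qed

text \<open>A union bound: at most a quarter of the tuples have low degree at some index set, and at
  most a quarter have a repeated entry.\<close>

lemma card_good_tuples:
  fixes nb :: "'v set \<Rightarrow> 'v set" and u l q :: nat
  assumes V: "finite V" and u: "u > 0" and m: "m = (2 * u + 1) * l"
    and nb: "\<And>S. S \<subseteq> V \<Longrightarrow> card S = q \<Longrightarrow> nb S \<subseteq> V \<and> card V \<le> 2 * card (nb S)"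
    and l: "4 * ((2 * real m) ^ q * exp (- 1 / (4 * real (u + 1))) ^ l) \<le> 1"
    and n: "4 * m * m \<le> card V" "0 < m"
  shows "real (card V) ^ m \<le> 2 * real (card {f \<in> PiE {..<m} (\<lambda>_. V). inj_on f {..<m} \<and>
     (\<forall>I. I \<subseteq> {..<m} \<longrightarrow> card I = q \<longrightarrow> u * l \<le> card {j \<in> {..<m} - I. f j \<in> nb (f ` I)})})"
proof -
  let ?P = "PiE {..<m} (\<lambda>_. V)" and ?n = "real (card V)"
  let ?good = "{f \<in> ?P. inj_on f {..<m} \<and>
     (\<forall>I. I \<subseteq> {..<m} \<longrightarrow> card I = q \<longrightarrow> u * l \<le> card {j \<in> {..<m} - I. f j \<in> nb (f ` I)})}"
  define bad where "bad I = {f \<in> ?P. card (f ` I) = q \<and> card {j \<in> {..<m} - I. f j \<in> nb (f ` I)} < u * l}" for I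
  define co where "co ij = {f \<in> ?P. f (fst ij) = f (snd ij)}" for ij :: "nat \<times> nat"
  define Is where "Is = {I. I \<subseteq> {..<m} \<and> card I = q}"
  define prs where "prs = {ij \<in> {..<m} \<times> {..<m}. fst ij \<noteq> snd ij}"
  have fP: "finite ?P" using V by (simp add: finite_PiE)
  have fIs: "finite Is" unfolding Is_def by (rule finite_subset[of _ "Pow {..<m}"]) auto
  have fprs: "finite prs" by (simp add: prs_def)
  have cover: "?P \<subseteq> ?good \<union> ((\<Union>I\<in>Is. bad I) \<union> (\<Union>ij\<in>prs. co ij))"
  proof
    fix f assume f: "f \<in> ?P"
    show "f \<in> ?good \<union> ((\<Union>I\<in>Is. bad I) \<union> (\<Union>ij\<in>prs. co ij))"
    proof (cases "inj_on f {..<m}")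
      case True
      have "f \<in> bad I" if "I \<in> Is" "card {j \<in> {..<m} - I. f j \<in> nb (f ` I)} < u * l" for I
        using that f card_image[OF inj_on_subset[OF True]] by (auto simp: bad_def Is_def)
      then have "f \<in> (\<Union>I\<in>Is. bad I) \<or> f \<in> ?good"
        using f True unfolding Is_def by (auto simp: not_less[symmetric])
      then show ?thesis by blast
    next
      case False
      then obtain i j where "i < m" "j < m" "i \<noteq> j" "f i = f j" by (auto simp: inj_on_def)
      then have "(i,j) \<in> prs" "f \<in> co (i,j)" using f by (auto simp: prs_def co_def)
      then show ?thesis by blast
    qed
  qed
  have "card ?P \<le> card (?good \<union> ((\<Union>I\<in>Is. bad I) \<union> (\<Union>ij\<in>prs. co ij)))"
    using fP fIs fprs by (intro card_mono cover) (auto simp: bad_def co_def)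
  also have "\<dots> \<le> card ?good + (card (\<Union>I\<in>Is. bad I) + card (\<Union>ij\<in>prs. co ij))"
    by (meson add_left_mono card_Un_le order_trans)
  finally have "real (card ?P) \<le> real (card ?good) + (real (card (\<Union>I\<in>Is. bad I)) + real (card (\<Union>ij\<in>prs. co ij)))"
    by linarith
  moreover have "real (card ?P) = ?n ^ m" by (simp add: card_PiE)
  moreover have "real (card (\<Union>I\<in>Is. bad I)) \<le> ?n ^ m / 4"
  proof -
    let ?e = "?n ^ m * 2 ^ q * exp (- 1 / (4 * real (u + 1))) ^ l"
    have "real (card (\<Union>I\<in>Is. bad I)) \<le> (\<Sum>I\<in>Is. real (card (bad I)))"
      using card_UN_le[OF fIs, of bad] by (simp flip: of_nat_sum)
    also have "\<dots> \<le> (\<Sum>I\<in>Is. ?e)"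
    proof (rule sum_mono)
      fix I assume "I \<in> Is"
      then show "real (card (bad I)) \<le> ?e"
        unfolding Is_def bad_def by (intro card_low_degree_tuples[OF V u m _ _ nb]) auto
    qed
    also have "\<dots> = real (card Is) * ?e" by simp
    also have "\<dots> \<le> real m ^ q * ?e"
    proof (intro mult_right_mono)
      have "card Is = m choose q" unfolding Is_def using n_subsets[of "{..<m}" q] by simp
      also have "\<dots> \<le> m ^ q" by (cases "q \<le> m") (auto simp: binomial_le_pow binomial_eq_0)
      finally show "real (card Is) \<le> real m ^ q" by (metis of_nat_le_iff of_nat_power)
    qed simp
    also have "\<dots> = ?n ^ m * ((2 * real m) ^ q * exp (- 1 / (4 * real (u + 1))) ^ l)"
      by (simp add: power_mult_distrib mult_ac)
    also have "\<dots> \<le> ?n ^ m * (1 / 4)" using l by (intro mult_left_mono) auto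
    finally show ?thesis by simp
  qed
  moreover have "real (card (\<Union>ij\<in>prs. co ij)) \<le> ?n ^ m / 4"
  proof -
    have "card (\<Union>ij\<in>prs. co ij) \<le> (\<Sum>ij\<in>prs. card (co ij))" by (rule card_UN_le[OF fprs])
    also have "\<dots> \<le> (\<Sum>ij\<in>prs. card V ^ (m - 1))"
      using card_tuples_coincide[OF V] by (intro sum_mono) (auto simp: prs_def co_def)
    also have "\<dots> \<le> m * m * card V ^ (m - 1)"
      using card_mono[of "{..<m} \<times> {..<m}" prs] by (simp add: prs_def)
    finally have "4 * card (\<Union>ij\<in>prs. co ij) \<le> 4 * m * m * card V ^ (m - 1)" by simp
    also have "\<dots> \<le> card V * card V ^ (m - 1)" using n by (intro mult_right_mono) auto
    also have "\<dots> = card V ^ m" using n(2) by (simp add: power_eq_if)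
    finally have "real (4 * card (\<Union>ij\<in>prs. co ij)) \<le> real (card V ^ m)" by (rule of_nat_mono)
    then show ?thesis by simp
  qed
  ultimately show ?thesis by linarith
qed

subsection \<open>Crossing families in a pattern\<close>

text \<open>Averaging over \<open>p\<close>: every \<open>j\<close> belongs to at least half of the
  sets \<open>I p\<close>, so the mean weight of a trace is at least half of the total. The weights
  are left free because the lemma is applied once uniformly and once with two different
  values.\<close>

lemma exists_heavy_trace:
  fixes w :: "'j \<Rightarrow> nat"
  assumes V: "finite V" "V \<noteq> {}" and K: "finite K"
    and half: "\<And>j. j \<in> K \<Longrightarrow> card V \<le> 2 * card {p \<in> V. j \<in> I p}"
  obtains p where "p \<in> V" "sum w K \<le> 2 * sum w (K \<inter> I p)"
proof -
  have "\<exists>p\<in>V. sum w K \<le> 2 * sum w (K \<inter> I p)"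
  proof (rule ccontr)
    assume "\<not> ?thesis"
    then have less: "2 * sum w (K \<inter> I p) < sum w K" if "p \<in> V" for p using that by auto
    have "(\<Sum>p\<in>V. sum w (K \<inter> I p)) = (\<Sum>p\<in>V. \<Sum>j\<in>K. if j \<in> I p then w j else 0)"
      using K by (simp add: sum.If_cases Int_def)
    also have "\<dots> = (\<Sum>j\<in>K. \<Sum>p\<in>V. if j \<in> I p then w j else 0)" by (rule sum.swap)
    also have "\<dots> = (\<Sum>j\<in>K. card {p \<in> V. j \<in> I p} * w j)"
      using V by (simp add: sum.If_cases Int_def)
    finally have eq: "(\<Sum>p\<in>V. sum w (K \<inter> I p)) = (\<Sum>j\<in>K. card {p \<in> V. j \<in> I p} * w j)" .
    have "card V * sum w K = (\<Sum>j\<in>K. card V * w j)" by (simp add: sum_distrib_left)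
    also have "\<dots> \<le> (\<Sum>j\<in>K. 2 * card {p \<in> V. j \<in> I p} * w j)"
      using half by (intro sum_mono mult_right_mono) auto
    also have "\<dots> = (\<Sum>p\<in>V. 2 * sum w (K \<inter> I p))"
      by (simp add: sum_distrib_left[symmetric] eq mult.assoc)
    also have "\<dots> < (\<Sum>p\<in>V. sum w K)" using less V by (intro sum_strict_mono) auto
    also have "\<dots> = card V * sum w K" by simp
    finally show False by simp
  qed
  then show thesis using that by blast
qed

lemma exists_disjoint_blocks:
  assumes "r * s \<le> card A" "finite A"
  shows "\<exists>\<alpha>. (\<forall>i<r. \<alpha> i \<subseteq> A \<and> card (\<alpha> i) = s) \<and> (\<forall>i<r. \<forall>k<r. i \<noteq> k \<longrightarrow> \<alpha> i \<inter> \<alpha> k = {})"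
  using assms
proof (induction r arbitrary: A)
  case 0
  then show ?case by simp
next
  case (Suc r)
  have "s \<le> card A" using Suc.prems(1) by simp
  then obtain T where T: "T \<subseteq> A" "card T = s" "finite T" by (rule obtain_subset_with_card_n)
  have "r * s \<le> card (A - T)" using Suc.prems T by (simp add: card_Diff_subset)
  from Suc.IH[OF this] obtain \<alpha> where a: "\<forall>i<r. \<alpha> i \<subseteq> A - T \<and> card (\<alpha> i) = s"
    "\<forall>i<r. \<forall>k<r. i \<noteq> k \<longrightarrow> \<alpha> i \<inter> \<alpha> k = {}" using Suc.prems(2) by auto
  let ?\<alpha> = "\<alpha>(r := T)"
  have "?\<alpha> i \<subseteq> A \<and> card (?\<alpha> i) = s" if "i < Suc r" for i
    using a(1) T that by (cases "i = r") (auto simp: less_Suc_eq)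
  moreover have "?\<alpha> i \<inter> ?\<alpha> k = {}" if "i < Suc r" "k < Suc r" "i \<noteq> k" for i k
  proof -
    have "i < r \<or> i = r" "k < r \<or> k = r" using that by auto
    then show ?thesis using a that(3) by (cases "i = r"; cases "k = r") auto
  qed
  ultimately show ?case by blast
qed

text \<open>Choosing a point of \<open>Z\<close> in every block that is hit gives an injection, by
  disjointness of the blocks.\<close>

lemma card_hit_blocks_le:
  assumes "finite Z" "\<And>i k. i < r \<Longrightarrow> k < r \<Longrightarrow> i \<noteq> k \<Longrightarrow> \<beta> i \<inter> \<beta> k = {}"
  shows "card {k. k < (r::nat) \<and> \<beta> k \<inter> Z \<noteq> {}} \<le> card Z"
proof -
  let ?K = "{k. k < r \<and> \<beta> k \<inter> Z \<noteq> {}}"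
  let ?g = "\<lambda>k. SOME z. z \<in> \<beta> k \<inter> Z"
  have g: "?g k \<in> \<beta> k \<inter> Z" if "k \<in> ?K" for k
  proof -
    have "\<exists>z. z \<in> \<beta> k \<inter> Z" using that by auto
    then show ?thesis by (rule someI_ex)
  qed
  have "inj_on ?g ?K"
  proof (rule inj_onI)
    fix i k assume ik: "i \<in> ?K" "k \<in> ?K" "?g i = ?g k"
    have "?g i \<in> \<beta> i \<inter> \<beta> k" using g[OF ik(1)] g[OF ik(2)] ik(3) by auto
    then show "i = k" using assms(2)[of i k] ik by (cases "i = k") auto
  qed
  moreover have "?g ` ?K \<subseteq> Z" using g by blast
  ultimately show ?thesis using assms(1) by (rule card_inj_on_le)
qed

text \<open>The two relations together exclude at most \<open>r * c1 + r * c2\<close> pairs, fewer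
  than \<open>r * r\<close>.\<close>

lemma exists_pair_avoiding_sparse:
  fixes r :: nat
  assumes R1: "\<And>i. i < r \<Longrightarrow> card {k. k < r \<and> R1 i k} \<le> c1"
    and R2: "\<And>k. k < r \<Longrightarrow> card {i. i < r \<and> R2 i k} \<le> c2" and c: "c1 + c2 < r"
  obtains i k where "i < r" "k < r" "\<not> R1 i k" "\<not> R2 i k"
proof -
  have "\<exists>i<r. \<exists>k<r. \<not> R1 i k \<and> \<not> R2 i k"
  proof (rule ccontr)
    assume "\<not> ?thesis"
    then have sub: "{..<r} \<times> {..<r} \<subseteq> (SIGMA i:{..<r}. {k. k < r \<and> R1 i k}) \<union>
        prod.swap ` (SIGMA k:{..<r}. {i. i < r \<and> R2 i k})"
    proof (intro subsetI)
      fix z assume z: "z \<in> {..<r} \<times> {..<r}"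
      then obtain i k where ik: "z = (i, k)" "i < r" "k < r" by auto
      show "z \<in> (SIGMA i:{..<r}. {k. k < r \<and> R1 i k}) \<union>
        prod.swap ` (SIGMA k:{..<r}. {i. i < r \<and> R2 i k})"
      proof (cases "R1 i k")
        case False
        then have "(k, i) \<in> (SIGMA k:{..<r}. {i. i < r \<and> R2 i k})"
          using \<open>\<not> (\<exists>i<r. \<exists>k<r. \<not> R1 i k \<and> \<not> R2 i k)\<close> ik by blast
        then have "prod.swap (k, i) \<in> prod.swap ` (SIGMA k:{..<r}. {i. i < r \<and> R2 i k})" by (rule imageI)
        then show ?thesis using ik by simp
      qed (use ik in auto)
    qed
    have "r * r = card ({..<r} \<times> {..<r})" by simp
    also have "\<dots> \<le> card ((SIGMA i:{..<r}. {k. k < r \<and> R1 i k}) \<union>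
        prod.swap ` (SIGMA k:{..<r}. {i. i < r \<and> R2 i k}))"
      by (intro card_mono sub) auto
    also have "\<dots> \<le> card (SIGMA i:{..<r}. {k. k < r \<and> R1 i k}) +
        card (prod.swap ` (SIGMA k:{..<r}. {i. i < r \<and> R2 i k}))" by (rule card_Un_le)
    also have "card (prod.swap ` (SIGMA k:{..<r}. {i. i < r \<and> R2 i k})) =
        card (SIGMA k:{..<r}. {i. i < r \<and> R2 i k})" by (intro card_image) (auto simp: inj_on_def)
    also have "card (SIGMA i:{..<r}. {k. k < r \<and> R1 i k}) \<le> r * c1"
      using sum_mono[of "{..<r}" "\<lambda>i. card {k. k < r \<and> R1 i k}" "\<lambda>_. c1"] R1 by (simp add: card_SigmaI)
    also have "card (SIGMA k:{..<r}. {i. i < r \<and> R2 i k}) \<le> r * c2"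
      using sum_mono[of "{..<r}" "\<lambda>k. card {i. i < r \<and> R2 i k}" "\<lambda>_. c2"] R2 by (simp add: card_SigmaI)
    finally have "r * r \<le> r * (c1 + c2)" by (simp add: algebra_simps)
    then show False using c by simp
  qed
  then show thesis using that by blast
qed

text \<open>Both sides are cut into \<open>r\<close> disjoint blocks of size \<open>s\<close>. A
  block has at most \<open>2 ^ s\<close> subsets of size \<open>q\<close>; each of them misses few
  vertices of the other side, and each missed vertex spoils at most one opposite block. Thus every
  block is incompatible with at most \<open>2 ^ s * c1\<close> or \<open>2 ^ s * c2\<close> opposite
  ones, and \<open>r\<close> exceeds the sum of these bounds by 1.\<close>

lemma exists_crossing_blocks:
  fixes A B :: "'i set" and D :: "'i set \<Rightarrow> 'i set" and s q c1 c2 :: nat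
  assumes fin: "finite A" "finite B"
    and missA: "\<And>S. S \<subseteq> A \<Longrightarrow> card S = q \<Longrightarrow> card (B - D S) \<le> c1"
    and missB: "\<And>S. S \<subseteq> B \<Longrightarrow> card S = q \<Longrightarrow> card (A - D S) \<le> c2"
    and sizes: "(2 ^ s * (c1 + c2) + 1) * s \<le> card A" "(2 ^ s * (c1 + c2) + 1) * s \<le> card B"
  obtains V1 V2 where "V1 \<subseteq> A" "V2 \<subseteq> B" "card V1 = s" "card V2 = s"
    "\<And>S. S \<subseteq> V1 \<Longrightarrow> card S = q \<Longrightarrow> V2 \<subseteq> D S" "\<And>S. S \<subseteq> V2 \<Longrightarrow> card S = q \<Longrightarrow> V1 \<subseteq> D S"
proof -
  define r where "r = 2 ^ s * (c1 + c2) + 1"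
  obtain \<alpha> where a: "\<And>i. i < r \<Longrightarrow> \<alpha> i \<subseteq> A" "\<And>i. i < r \<Longrightarrow> card (\<alpha> i) = s"
     "\<And>i k. i < r \<Longrightarrow> k < r \<Longrightarrow> i \<noteq> k \<Longrightarrow> \<alpha> i \<inter> \<alpha> k = {}"
    using exists_disjoint_blocks[OF sizes(1) fin(1)] unfolding r_def by metis
  obtain \<beta> where b: "\<And>i. i < r \<Longrightarrow> \<beta> i \<subseteq> B" "\<And>i. i < r \<Longrightarrow> card (\<beta> i) = s"
     "\<And>i k. i < r \<Longrightarrow> k < r \<Longrightarrow> i \<noteq> k \<Longrightarrow> \<beta> i \<inter> \<beta> k = {}"
    using exists_disjoint_blocks[OF sizes(2) fin(2)] unfolding r_def by metis
  have count: "card {k. k < r \<and> (\<exists>S\<subseteq>T. card S = q \<and> \<not> \<gamma> k \<subseteq> D S)} \<le> 2 ^ s * c"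
    if T: "finite T" "card T = s" and C: "finite C" "\<And>S. S \<subseteq> T \<Longrightarrow> card S = q \<Longrightarrow> card (C - D S) \<le> c"
      and g: "\<And>k. k < r \<Longrightarrow> \<gamma> k \<subseteq> C" "\<And>i k. i < r \<Longrightarrow> k < r \<Longrightarrow> i \<noteq> k \<Longrightarrow> \<gamma> i \<inter> \<gamma> k = {}"
    for T C c and \<gamma> :: "nat \<Rightarrow> 'i set"
  proof -
    let ?S = "{S. S \<subseteq> T \<and> card S = q}"
    have fS: "finite ?S" by (rule finite_subset[of _ "Pow T"]) (use T in auto)
    have cS: "card ?S \<le> 2 ^ s" using card_mono[of "Pow T" ?S] T by (auto simp: card_Pow)
    have "{k. k < r \<and> (\<exists>S\<subseteq>T. card S = q \<and> \<not> \<gamma> k \<subseteq> D S)} \<subseteq> (\<Union>S\<in>?S. {k. k < r \<and> \<gamma> k \<inter> (C - D S) \<noteq> {}})"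
      using g(1) by blast
    then have "card {k. k < r \<and> (\<exists>S\<subseteq>T. card S = q \<and> \<not> \<gamma> k \<subseteq> D S)} \<le> card (\<Union>S\<in>?S. {k. k < r \<and> \<gamma> k \<inter> (C - D S) \<noteq> {}})"
      using fS by (intro card_mono) auto
    also have "\<dots> \<le> (\<Sum>S\<in>?S. card {k. k < r \<and> \<gamma> k \<inter> (C - D S) \<noteq> {}})" by (rule card_UN_le[OF fS])
    also have "\<dots> \<le> (\<Sum>S\<in>?S. c)"
    proof (rule sum_mono)
      fix S assume S: "S \<in> ?S"
      have "card {k. k < r \<and> \<gamma> k \<inter> (C - D S) \<noteq> {}} \<le> card (C - D S)"
        using C(1) g(2) by (intro card_hit_blocks_le) auto
      also have "\<dots> \<le> c" using C(2) S by blast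
      finally show "card {k. k < r \<and> \<gamma> k \<inter> (C - D S) \<noteq> {}} \<le> c" .
    qed
    also have "\<dots> \<le> 2 ^ s * c" using cS by simp
    finally show ?thesis .
  qed
  obtain i k where ik: "i < r" "k < r" "\<not> (\<exists>S\<subseteq>\<alpha> i. card S = q \<and> \<not> \<beta> k \<subseteq> D S)" "\<not> (\<exists>S\<subseteq>\<beta> k. card S = q \<and> \<not> \<alpha> i \<subseteq> D S)"
  proof (rule exists_pair_avoiding_sparse)
    fix i assume i: "i < r"
    show "card {k. k < r \<and> (\<exists>S\<subseteq>\<alpha> i. card S = q \<and> \<not> \<beta> k \<subseteq> D S)} \<le> 2 ^ s * c1"
    proof (rule count)
      show "finite (\<alpha> i)" using a(1)[OF i] fin(1) by (rule finite_subset)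
      show "card (\<alpha> i) = s" by (rule a(2)[OF i])
      show "finite B" by (rule fin)
      show "card (B - D S) \<le> c1" if "S \<subseteq> \<alpha> i" "card S = q" for S
        by (rule missA) (use that a(1)[OF i] in auto)
    qed (use b in auto)
  next
    fix k assume k: "k < r"
    show "card {i. i < r \<and> (\<exists>S\<subseteq>\<beta> k. card S = q \<and> \<not> \<alpha> i \<subseteq> D S)} \<le> 2 ^ s * c2"
    proof (rule count)
      show "finite (\<beta> k)" using b(1)[OF k] fin(2) by (rule finite_subset)
      show "card (\<beta> k) = s" by (rule b(2)[OF k])
      show "finite A" by (rule fin)
      show "card (A - D S) \<le> c2" if "S \<subseteq> \<beta> k" "card S = q" for S
        by (rule missB) (use that b(1)[OF k] in auto)
    qed (use a in auto)
  next
    show "2 ^ s * c1 + 2 ^ s * c2 < r" by (simp add: r_def algebra_simps)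
  qed
  show thesis
    by (rule that[of "\<alpha> i" "\<beta> k"]) (use ik a b in auto)
qed

text \<open>The weights in the second application of \<open>exists_heavy_trace\<close> are chosen so that a trace
  with at least \<open>q\<close> elements in \<open>A\<close> is too light; the heavy trace then nearly exhausts \<open>B\<close>.\<close>

lemma exists_crossing_sets:
  fixes J :: "nat set set" and I :: "'p \<Rightarrow> nat set" and m l q s :: nat
  assumes V: "finite V" "V \<noteq> {}"
    and I: "\<And>p. p \<in> V \<Longrightarrow> I p \<subseteq> {..<m}"
    and indep: "\<And>p S j. p \<in> V \<Longrightarrow> S \<subseteq> I p \<Longrightarrow> card S = q \<Longrightarrow> j \<in> I p - S \<Longrightarrow> insert j S \<notin> J"
    and half: "\<And>j. j < m \<Longrightarrow> card V \<le> 2 * card {p \<in> V. j \<in> I p}"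
    and codeg: "\<And>S. S \<subseteq> {..<m} \<Longrightarrow> card S = q \<Longrightarrow> m \<le> 2 * card {j \<in> {..<m} - S. insert j S \<in> J} + l"
    and m: "2 * ((2 ^ s * (3 * l + q) + 1) * s) + 5 * l + 2 * q + 4 \<le> m"
  obtains V1 V2 where "V1 \<subseteq> {..<m}" "V2 \<subseteq> {..<m}" "V1 \<inter> V2 = {}" "card V1 = s" "card V2 = s"
    "\<And>S j. S \<subseteq> V1 \<Longrightarrow> card S = q \<Longrightarrow> j \<in> V2 \<Longrightarrow> insert j S \<in> J"
    "\<And>S j. S \<subseteq> V2 \<Longrightarrow> card S = q \<Longrightarrow> j \<in> V1 \<Longrightarrow> insert j S \<in> J"
proof -
  define D where "D S = {j \<in> {..<m} - S. insert j S \<in> J}" for S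
  have finD: "finite (D S)" for S by (simp add: D_def)
  have disj: "D S \<inter> I p = {}" if "p \<in> V" "S \<subseteq> I p" "card S = q" for p S
    using indep[OF that] by (auto simp: D_def)
  have half': "card V \<le> 2 * card {p \<in> V. j \<in> I p}" if "j \<in> {..<m}" for j using half that by simp
  obtain p1 where p1: "p1 \<in> V" "sum (\<lambda>_. 1::nat) {..<m} \<le> 2 * sum (\<lambda>_. 1) ({..<m} \<inter> I p1)"
    by (rule exists_heavy_trace[OF V finite_lessThan half', where w = "\<lambda>_. 1"]) auto
  define A where "A = I p1"
  define B where "B = {..<m} - A"
  have A: "A \<subseteq> {..<m}" using I p1 by (simp add: A_def)
  have finAB: "finite A" "finite B" using A finite_subset by (auto simp: B_def)
  have cardAB: "card A + card B = m"
    using A finAB card_Un_disjoint[of A B] by (simp add: B_def Un_absorb1 Int_Diff)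
  have A2: "m \<le> 2 * card A" using p1(2) A by (simp add: A_def Int_absorb1)
  \<comment> \<open>All neighbours in the pattern of a \<open>q\<close>-set inside the trace
    \<open>A\<close> lie in \<open>B\<close>. Since \<open>card B\<close> is at most half of
    \<open>m\<close>, a codegree of \<open>(m - l) / 2\<close> fills \<open>B\<close> up to
    \<open>l / 2\<close> elements.\<close>
  have missA: "2 * card (B - D S) \<le> l" "card A + card (D S) \<le> m" if S: "S \<subseteq> A" "card S = q" for S
  proof -
    have "D S \<inter> A = {}" using disj[OF p1(1)] S by (simp add: A_def)
    then have DB: "D S \<subseteq> B" by (auto simp: B_def D_def)
    moreover have "m \<le> 2 * card (D S) + l" using codeg[of S] S A by (auto simp: D_def)
    moreover have "card (B - D S) = card B - card (D S)" using DB finD by (simp add: card_Diff_subset)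
    moreover have "card (D S) \<le> card B" using DB finAB by (simp add: card_mono)
    ultimately show "2 * card (B - D S) \<le> l" "card A + card (D S) \<le> m" using A2 cardAB by linarith+
  qed
  have "q \<le> card A" using A2 m by linarith
  then obtain S0 where S0: "S0 \<subseteq> A" "card S0 = q" by (rule obtain_subset_with_card_n)
  have "m \<le> 2 * card (D S0) + l" using codeg[of S0] S0 A by (auto simp: D_def)
  then have A3: "2 * card A \<le> m + l" using missA(2)[OF S0] by linarith
  have light: "card (I p \<inter> B) \<le> l" if p: "p \<in> V" "q \<le> card (I p \<inter> A)" for p
  proof -
    obtain S where S: "S \<subseteq> I p \<inter> A" "card S = q" using p(2) by (rule obtain_subset_with_card_n)
    have "D S \<inter> I p = {}" using disj[OF p(1)] S by simp
    then have "I p \<inter> B \<subseteq> B - D S" by auto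
    then have "card (I p \<inter> B) \<le> card (B - D S)" using finAB by (intro card_mono) auto
    then show ?thesis using missA(1)[of S] S by simp
  qed
  \<comment> \<open>The largest value that works: a trace with at least \<open>q\<close> elements in
    \<open>A\<close> weighs at most \<open>card A * (\<mu> + l)\<close>, and twice this falls short
    of the total \<open>card A * (\<mu> + card B)\<close> exactly when \<open>\<mu> + 2 * l\<close>
    is less than \<open>card B\<close>.\<close>
  define \<mu> where "\<mu> = card B - 2 * l - 1"
  have lam: "\<mu> + 2 * l + 1 = card B" using A3 cardAB m by (simp add: \<mu>_def)
  define w where "w j = (if j \<in> A then \<mu> else card A)" for j
  have wsum: "sum w K = \<mu> * card (K \<inter> A) + card A * card (K \<inter> B)" if "K \<subseteq> {..<m}" for K
  proof -
    have K: "finite K" using that finite_subset by auto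
    have "sum w K = (\<Sum>j\<in>K \<inter> A. \<mu>) + (\<Sum>j\<in>K \<inter> -A. card A)"
      unfolding w_def using K by (simp add: sum.If_cases)
    moreover have "K \<inter> -A = K \<inter> B" using that by (auto simp: B_def)
    ultimately show ?thesis by (simp add: mult.commute)
  qed
  obtain p2 where p2: "p2 \<in> V" "sum w {..<m} \<le> 2 * sum w ({..<m} \<inter> I p2)"
    by (rule exists_heavy_trace[OF V finite_lessThan half', where w = w]) auto
  define a b where "a = card (I p2 \<inter> A)" and "b = card (I p2 \<inter> B)"
  have Ip2: "{..<m} \<inter> I p2 = I p2" using I p2 by auto
  have int: "{..<m} \<inter> A = A" "{..<m} \<inter> B = B" using A by (auto simp: B_def)
  have ineq: "\<mu> * card A + card A * card B \<le> 2 * (\<mu> * a + card A * b)"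
    using p2(2) wsum[of "{..<m}"] wsum[OF I[OF p2(1)]] int by (simp add: Ip2 a_def b_def)
  have posA: "card A > 0" using A2 m by linarith
  have "a < q"
  proof (rule ccontr)
    assume "\<not> a < q"
    then have "b \<le> l" using light[OF p2(1)] by (simp add: a_def b_def)
    moreover have "a \<le> card A" unfolding a_def using finAB by (intro card_mono) auto
    ultimately have "\<mu> * a + card A * b \<le> \<mu> * card A + card A * l"
      by (intro add_mono mult_left_mono) auto
    then have "card A * (\<mu> + card B) \<le> card A * (2 * \<mu> + 2 * l)" using ineq by (simp add: algebra_simps)
    then have "\<mu> + card B \<le> 2 * \<mu> + 2 * l" using posA by simp
    then show False using lam by linarith
  qed
  \<comment> \<open>The fewer than \<open>q\<close> elements of the trace in \<open>A\<close> may
    thus be charged like elements of \<open>B\<close>, so dividing by \<open>card A\<close> leaves a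
    bound on the trace in \<open>B\<close> alone.\<close>
  have "\<mu> \<le> card A" using lam cardAB A2 by linarith
  then have "\<mu> * a \<le> card A * q" using \<open>a < q\<close> by (intro mult_mono) auto
  then have "card A * (\<mu> + card B) \<le> card A * (2 * q + 2 * b)" using ineq by (simp add: algebra_simps)
  then have "\<mu> + card B \<le> 2 * q + 2 * b" using posA by simp
  \<comment> \<open>The 1 in the definition of \<open>\<mu>\<close> would cost one half here;
    integrality removes it.\<close>
  then have b: "card B \<le> l + q + b" using lam by linarith
  define B' where "B' = I p2 \<inter> B"
  have B': "B' \<subseteq> B" "finite B'" "card B' = b" using finAB by (auto simp: B'_def b_def)
  \<comment> \<open>Neighbours of \<open>S\<close> in the pattern avoid \<open>B'\<close>, and
    \<open>B'\<close> is nearly all of \<open>B\<close>. So at most \<open>l + q\<close> of them lie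
    outside \<open>A\<close>, and the rest nearly fill \<open>A\<close>.\<close>
  have missB: "card (A - D S) \<le> 2 * l + q" if S: "S \<subseteq> B'" "card S = q" for S
  proof -
    have D0: "D S \<inter> B' = {}" using disj[OF p2(1)] S by (auto simp: B'_def)
    have sub: "S \<subseteq> {..<m}" using S B' by (auto simp: B_def)
    have "m \<le> 2 * card (D S) + l" using codeg[OF sub S(2)] by (simp add: D_def)
    moreover have "card (A - D S) + card (D S) + card B' \<le> m"
    proof -
      have "card ((A - D S) \<union> D S \<union> B') = card (A - D S) + card (D S) + card B'"
        using finAB finD B' D0 by (subst card_Un_disjoint; (subst card_Un_disjoint)?) (auto simp: B_def)
      moreover have "(A - D S) \<union> D S \<union> B' \<subseteq> {..<m}" using A B' by (auto simp: B_def D_def)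
      ultimately show ?thesis using card_mono[of "{..<m}" "(A - D S) \<union> D S \<union> B'"] by simp
    qed
    ultimately show ?thesis using b A3 cardAB B'(3) by linarith
  qed
  obtain V1 V2 where V12: "V1 \<subseteq> A" "V2 \<subseteq> B'" "card V1 = s" "card V2 = s"
    "\<And>S. S \<subseteq> V1 \<Longrightarrow> card S = q \<Longrightarrow> V2 \<subseteq> D S" "\<And>S. S \<subseteq> V2 \<Longrightarrow> card S = q \<Longrightarrow> V1 \<subseteq> D S"
  proof (rule exists_crossing_blocks[of A B' q D l "2 * l + q" s])
    show "card (B' - D S) \<le> l" if "S \<subseteq> A" "card S = q" for S
    proof -
      have "card (B' - D S) \<le> card (B - D S)" using B' finAB by (intro card_mono) auto
      then show ?thesis using missA(1)[OF that] by linarith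
    qed
    have e: "l + (2 * l + q) = 3 * l + q" by simp
    show "(2 ^ s * (l + (2 * l + q)) + 1) * s \<le> card A"
      unfolding e using m A2 by linarith
    show "(2 ^ s * (l + (2 * l + q)) + 1) * s \<le> card B'"
      unfolding e using m b A3 cardAB B'(3) by linarith
  qed (use finAB B' missB in auto)
  show thesis
  proof (rule that[of V1 V2])
    show "V1 \<subseteq> {..<m}" "V2 \<subseteq> {..<m}" "V1 \<inter> V2 = {}" using V12(1,2) A B'(1) by (auto simp: B_def)
    show "insert j S \<in> J" if "S \<subseteq> V1" "card S = q" "j \<in> V2" for S j
      using V12(5)[OF that(1,2)] that(3) by (auto simp: D_def)
    show "insert j S \<in> J" if "S \<subseteq> V2" "card S = q" "j \<in> V1" for S j
      using V12(6)[OF that(1,2)] that(3) by (auto simp: D_def)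
  qed (use V12 in auto)
qed

subsection \<open>Blow-ups of crossing families\<close>

text \<open>The vertex form of \<open>nbhd\<close>, without the wrapping into singletons;
  \<open>card_nbhd\<close> translates between the two.\<close>

definition nbrs :: "'v set \<Rightarrow> 'v set set \<Rightarrow> 'v set \<Rightarrow> 'v set" where
  "nbrs V E S = {v \<in> V - S. insert v S \<in> E}"

definition crossing_blowup ::
  "nat \<Rightarrow> nat \<Rightarrow> nat \<Rightarrow> 'v set \<Rightarrow> 'v set set \<Rightarrow> nat set \<Rightarrow> nat set \<Rightarrow> (nat \<Rightarrow> 'v set) \<Rightarrow> bool" where
  "crossing_blowup q s t V E V1 V2 Q \<longleftrightarrow>
     finite V1 \<and> finite V2 \<and> V1 \<inter> V2 = {} \<and> card V1 = s \<and> card V2 = s \<and>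
     (\<forall>i\<in>V1 \<union> V2. Q i \<subseteq> V \<and> card (Q i) = t) \<and>
     (\<forall>i\<in>V1 \<union> V2. \<forall>j\<in>V1 \<union> V2. i \<noteq> j \<longrightarrow> Q i \<inter> Q j = {}) \<and>
     (\<forall>S j g. S \<subseteq> V1 \<longrightarrow> card S = q \<longrightarrow> j \<in> V2 \<longrightarrow> (\<forall>i\<in>insert j S. g i \<in> Q i) \<longrightarrow> g ` insert j S \<in> E) \<and>
     (\<forall>S j g. S \<subseteq> V2 \<longrightarrow> card S = q \<longrightarrow> j \<in> V1 \<longrightarrow> (\<forall>i\<in>insert j S. g i \<in> Q i) \<longrightarrow> g ` insert j S \<in> E)"

context projective_plane
begin

text \<open>The form used in blow-ups: the transversals are known on whole parts \<open>Q i\<close>,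
  and the groups are \<open>q\<close>-subsets joined to \<open>p\<close>.\<close>

lemma contains_if_joined_groups:
  assumes e: "finite e" "card e = q + 1"
    and Q: "\<And>i. i \<in> e \<Longrightarrow> Q i \<subseteq> V" "\<And>i j. i \<in> e \<Longrightarrow> j \<in> e \<Longrightarrow> i \<noteq> j \<Longrightarrow> Q i \<inter> Q j = {}"
    and trans: "\<And>g. (\<And>i. i \<in> e \<Longrightarrow> g i \<in> Q i) \<Longrightarrow> g ` e \<in> E"
    and R: "\<And>i. i \<in> e \<Longrightarrow> R i \<subseteq> Q i" "\<And>i. i \<in> e \<Longrightarrow> card (R i) = q"
    and p: "\<And>i. i \<in> e \<Longrightarrow> p \<in> nbrs V E (R i)" and V: "finite V"
  shows "contains P L V E"
proof (rule contains_if_groups[of p V e R])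
  obtain i where i: "i \<in> e" using e by fastforce
  show "p \<in> V" using p[OF i] by (simp add: nbrs_def)
  show "finite e" "card e = q + 1" by (rule e)+
  show RV: "R i \<subseteq> V" if "i \<in> e" for i using Q(1) R(1) that by blast
  show "card (R i) = q" if "i \<in> e" for i using R that by simp
  show "finite (R i)" if "i \<in> e" for i using RV[OF that] V by (rule finite_subset)
  show "R i \<inter> R j = {}" if "i \<in> e" "j \<in> e" "i \<noteq> j" for i j
    using Q(2)[OF that] R(1)[OF that(1)] R(1)[OF that(2)] by blast
  show "p \<notin> R i" "insert p (R i) \<in> E" if "i \<in> e" for i using p[OF that] by (auto simp: nbrs_def)
  show "g ` e \<in> E" if "\<And>i. i \<in> e \<Longrightarrow> g i \<in> R i" for g
    using trans R(1) that by blast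
qed

lemma exists_crossing_blowup:
  assumes q: "1 \<le> q" "q \<le> t"
  shows "\<exists>N. \<forall>(V :: 'v set) E. finite V \<longrightarrow> N \<le> card V \<longrightarrow> \<not> contains P L V E \<longrightarrow>
    (\<forall>S. S \<subseteq> V \<longrightarrow> card S = q \<longrightarrow> card V \<le> 2 * card (nbrs V E S)) \<longrightarrow>
    (\<exists>V1 V2 Q. crossing_blowup q s t V E V1 V2 Q)"
proof -
  \<comment> \<open>Chosen so that \<open>2 * u * l\<close> dominates the size condition of
    \<open>exists_crossing_sets\<close> once \<open>q\<close> and the additive constants have been
    absorbed into \<open>l\<close>; for this \<open>l\<close> is taken to be at least
    \<open>q\<close> and 4.\<close>
  define u where "u = s * (2 ^ s * 4 + 1) + 6"
  obtain l where l: "l \<ge> max q 4" "4 * ((2 * real ((2 * u + 1) * l)) ^ q * exp (- 1 / (4 * real (u + 1))) ^ l) \<le> 1"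
    using exists_sample_size[of "max q 4" u q] by blast
  define m where "m = (2 * u + 1) * l"
  have mbig: "2 * ((2 ^ s * (3 * l + q) + 1) * s) + 5 * l + 2 * q + 4 \<le> m"
  proof -
    have "2 ^ s * (3 * l + q) \<le> 2 ^ s * (4 * l)" using l(1) by (intro mult_left_mono) auto
    then have "(2 ^ s * (3 * l + q) + 1) * s \<le> (2 ^ s * (4 * l) + l) * s"
      using l(1) by (intro mult_right_mono add_mono) auto
    then have "2 * ((2 ^ s * (3 * l + q) + 1) * s) + 5 * l + 2 * q + 4 \<le> 2 * ((2 ^ s * (4 * l) + l) * s) + 8 * l"
      using l(1) by linarith
    also have "\<dots> \<le> m" by (simp add: m_def u_def algebra_simps)
    finally show ?thesis .
  qed
  \<comment> \<open>There are \<open>2 ^ 2 ^ m\<close> set systems on the \<open>m\<close>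
    positions. Half of the tuples are good, so some pattern is shared by a proportion of at least
    \<open>1 / (2 * real M)\<close> of all tuples.\<close>
  define M :: nat where "M = 2 ^ 2 ^ m"
  define c where "c = 1 / (2 * real M)"
  have M: "M > 0" by (simp add: M_def)
  then have "c > 0" by (simp add: c_def)
  obtain N where N: "\<forall>(V :: 'v set) T. finite V \<longrightarrow> N \<le> card V \<longrightarrow> T \<subseteq> PiE {..<m} (\<lambda>_. V) \<longrightarrow>
    c * real (card V) ^ m \<le> real (card T) \<longrightarrow>
    (\<exists>Q. (\<forall>i<m. Q i \<subseteq> V \<and> card (Q i) = t) \<and> PiE {..<m} Q \<subseteq> T)"
    using complete_partite_in_dense_tuples[OF \<open>c > 0\<close>] by (rule exE)
  show ?thesis
  proof (intro exI[of _ "N + 4 * m * m + 1"] allI impI)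
    fix V :: "'v set" and E
    assume V: "finite V" "N + 4 * m * m + 1 \<le> card V" and free: "\<not> contains P L V E"
      and deg: "\<forall>S. S \<subseteq> V \<longrightarrow> card S = q \<longrightarrow> card V \<le> 2 * card (nbrs V E S)"
    have degS: "card V \<le> 2 * card (nbrs V E S)" if "S \<subseteq> V" "card S = q" for S using deg that by simp
    let ?P = "PiE {..<m} (\<lambda>_. V)"
    let ?good = "{f \<in> ?P. inj_on f {..<m} \<and>
      (\<forall>I. I \<subseteq> {..<m} \<longrightarrow> card I = q \<longrightarrow> u * l \<le> card {j \<in> {..<m} - I. f j \<in> nbrs V E (f ` I)})}"
    have finP: "finite ?P" using V by (simp add: finite_PiE)
    have "real (card V) ^ m \<le> 2 * real (card ?good)"
    proof (rule card_good_tuples[OF V(1) _ m_def])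
      show "u > 0" by (simp add: u_def)
      show "nbrs V E S \<subseteq> V \<and> card V \<le> 2 * card (nbrs V E S)" if "S \<subseteq> V" "card S = q" for S
        using degS[OF that] by (auto simp: nbrs_def)
      show "4 * ((2 * real m) ^ q * exp (- 1 / (4 * real (u + 1))) ^ l) \<le> 1" using l(2) by (simp only: m_def)
      show "4 * m * m \<le> card V" using V(2) by linarith
      show "0 < m" using mbig by linarith
    qed
    \<comment> \<open>The pattern is recorded on labelled positions, not up to isomorphism, so that
      tuples with the same pattern agree position by position.\<close>
    moreover define \<tau> where "\<tau> f = {e. e \<subseteq> {..<m} \<and> card e = q + 1 \<and> f ` e \<in> E}" for f :: "nat \<Rightarrow> 'v"
    have "\<tau> \<in> ?good \<rightarrow> Pow (Pow {..<m})" by (auto simp: \<tau>_def)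
    then have "\<exists>J\<in>Pow (Pow {..<m}). card (\<tau> -` {J} \<inter> ?good) * card (Pow (Pow {..<m})) \<ge> card ?good"
      using finP by (intro pigeonhole_card) auto
    then obtain J where "card ?good \<le> card (\<tau> -` {J} \<inter> ?good) * card (Pow (Pow {..<m}))" by blast
    then have J: "card ?good \<le> card (\<tau> -` {J} \<inter> ?good) * M"
      by (simp add: card_Pow M_def)
    define T where "T = \<tau> -` {J} \<inter> ?good"
    have "real (card ?good) \<le> real (card T) * real M"
      using of_nat_mono[OF J, where 'a = real] unfolding T_def by (simp only: of_nat_mult)
    ultimately have "c * real (card V) ^ m \<le> real (card T)"
      using M by (simp add: c_def field_simps)
    moreover have "T \<subseteq> ?P" by (auto simp: T_def)
    moreover have "N \<le> card V" using V(2) by linarith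
    ultimately have "\<exists>Q. (\<forall>i<m. Q i \<subseteq> V \<and> card (Q i) = t) \<and> PiE {..<m} Q \<subseteq> T"
      using N[THEN spec, THEN spec, of V T] V(1) by simp
    then obtain Q where Q: "\<forall>i<m. Q i \<subseteq> V \<and> card (Q i) = t" "PiE {..<m} Q \<subseteq> T" by (elim exE conjE)
    have QV: "Q i \<subseteq> V" and Qt: "card (Q i) = t" if "i < m" for i using Q(1) that by simp_all
    have T_D: "inj_on f {..<m}" "\<tau> f = J"
      "\<And>I. I \<subseteq> {..<m} \<Longrightarrow> card I = q \<Longrightarrow> u * l \<le> card {j \<in> {..<m} - I. f j \<in> nbrs V E (f ` I)}"
      if "f \<in> PiE {..<m} Q" for f
    proof -
      have "f \<in> T" using Q(2) that by (rule subsetD)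
      then have *: "f \<in> \<tau> -` {J}" "f \<in> ?good" unfolding T_def by (simp_all only: Int_iff)
      show "\<tau> f = J" using *(1) by simp
      show "inj_on f {..<m}" "\<And>I. I \<subseteq> {..<m} \<Longrightarrow> card I = q \<Longrightarrow> u * l \<le> card {j \<in> {..<m} - I. f j \<in> nbrs V E (f ` I)}"
        using *(2) by simp_all
    qed
    have "\<forall>i<m. \<exists>x. x \<in> Q i"
    proof (intro allI impI)
      fix i assume "i < m"
      then have "card (Q i) \<noteq> 0" using Qt q by simp
      then show "\<exists>x. x \<in> Q i" by (metis card.empty ex_in_conv)
    qed
    then obtain x where x: "\<And>i. i < m \<Longrightarrow> x i \<in> Q i" by metis
    \<comment> \<open>Completes a choice on \<open>e\<close> to a tuple over all parts:
      \<open>x\<close> fills the other positions, and \<open>undefined\<close> outside the index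
      range is what membership in \<open>PiE\<close> demands.\<close>
    define ext where "ext e g i = (if i < m then if i \<in> e then g i else x i else undefined)"
      for e and g :: "nat \<Rightarrow> 'v" and i
    have ext: "ext e g \<in> PiE {..<m} Q" if "\<And>i. i \<in> e \<Longrightarrow> i < m \<Longrightarrow> g i \<in> Q i" for e g
      using that x by (auto simp: ext_def PiE_iff extensional_def)
    \<comment> \<open>Disjointness comes for free: a common vertex of two parts would give a tuple
      in \<open>T\<close> that is not injective.\<close>
    have Qdisj: "Q i \<inter> Q j = {}" if ij: "i < m" "j < m" "i \<noteq> j" for i j
    proof (rule equals0I)
      fix y assume y: "y \<in> Q i \<inter> Q j"
      have "ext {i,j} (\<lambda>_. y) \<in> PiE {..<m} Q" by (rule ext) (use y in auto)
      then have "inj_on (ext {i,j} (\<lambda>_. y)) {..<m}" by (rule T_D(1))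
      then show False using ij inj_onD[of "ext {i,j} (\<lambda>_. y)" "{..<m}" i j] by (simp add: ext_def)
    qed
    have J_sub: "e \<subseteq> {..<m}" "card e = q + 1" if "e \<in> J" for e
      using T_D(2)[OF ext[of "{}" x]] that by (auto simp: \<tau>_def)
    have J_trans: "g ` e \<in> E" if e: "e \<in> J" and g: "\<And>i. i \<in> e \<Longrightarrow> g i \<in> Q i" for e g
    proof -
      have "ext e g \<in> PiE {..<m} Q" by (rule ext) (use g in auto)
      then have "\<tau> (ext e g) = J" by (rule T_D(2))
      then have "ext e g ` e \<in> E" using e by (auto simp: \<tau>_def)
      moreover have "ext e g ` e = g ` e"
        using J_sub(1)[OF e] by (intro image_cong) (auto simp: ext_def)
      ultimately show ?thesis by simp
    qed
    \<comment> \<open>Every tuple over \<open>Q\<close> is good and has pattern \<open>J\<close>, so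
      a single one transfers its degrees. The form of the bound is
      \<open>2 * (u * l) + l = m\<close>.\<close>
    have codeg: "m \<le> 2 * card {j \<in> {..<m} - S. insert j S \<in> J} + l" if S: "S \<subseteq> {..<m}" "card S = q" for S
    proof -
      define f where "f = ext {} x"
      have f: "f \<in> PiE {..<m} Q" unfolding f_def by (rule ext) auto
      have "{j \<in> {..<m} - S. f j \<in> nbrs V E (f ` S)} \<subseteq> {j \<in> {..<m} - S. insert j S \<in> J}"
      proof
        fix j assume j: "j \<in> {j \<in> {..<m} - S. f j \<in> nbrs V E (f ` S)}"
        then have "f ` insert j S \<in> E" by (simp add: nbrs_def)
        moreover have "card (insert j S) = q + 1" using j S finite_subset[OF S(1)] by simp
        ultimately have "insert j S \<in> \<tau> f" using j S by (auto simp: \<tau>_def)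
        then show "j \<in> {j \<in> {..<m} - S. insert j S \<in> J}" using T_D(2)[OF f] j by simp
      qed
      then have "card {j \<in> {..<m} - S. f j \<in> nbrs V E (f ` S)} \<le> card {j \<in> {..<m} - S. insert j S \<in> J}"
        by (intro card_mono) auto
      then have "u * l \<le> card {j \<in> {..<m} - S. insert j S \<in> J}" using T_D(3)[OF f S] by linarith
      then have "2 * (u * l) + l \<le> 2 * card {j \<in> {..<m} - S. insert j S \<in> J} + l" by linarith
      then show ?thesis by (simp add: m_def algebra_simps)
    qed
    have "\<forall>i<m. \<exists>R. R \<subseteq> Q i \<and> card R = q"
    proof (intro allI impI)
      fix i assume "i < m"
      then have "q \<le> card (Q i)" using Qt q by simp
      then show "\<exists>R. R \<subseteq> Q i \<and> card R = q" by (rule obtain_subset_with_card_n) blast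
    qed
    then obtain R where R: "\<And>i. i < m \<Longrightarrow> R i \<subseteq> Q i" "\<And>i. i < m \<Longrightarrow> card (R i) = q" by metis
    define I where "I p = {i. i < m \<and> p \<in> nbrs V E (R i)}" for p
    have indep: "insert j S \<notin> J" if pS: "p \<in> V" "S \<subseteq> I p" "card S = q" "j \<in> I p - S" for p S j
    proof
      assume e: "insert j S \<in> J"
      note sub = J_sub[OF e]
      have "contains P L V E"
      proof (rule contains_if_joined_groups[of "insert j S" Q V E R p])
        show "finite (insert j S)" using finite_subset[OF sub(1)] by simp
        show "card (insert j S) = q + 1" by (rule sub)
        show "p \<in> nbrs V E (R i)" if "i \<in> insert j S" for i using that pS by (auto simp: I_def)
        show "g ` insert j S \<in> E" if "\<And>i. i \<in> insert j S \<Longrightarrow> g i \<in> Q i" for g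
          using e that by (rule J_trans)
        show "Q i \<inter> Q k = {}" if "i \<in> insert j S" "k \<in> insert j S" "i \<noteq> k" for i k
          by (rule Qdisj) (use that sub in auto)
        fix i assume "i \<in> insert j S"
        then have "i < m" using sub(1) by blast
        then show "Q i \<subseteq> V" "R i \<subseteq> Q i" "card (R i) = q" using QV R by simp_all
      qed (rule V(1))
      then show False using free by blast
    qed
    have half: "card V \<le> 2 * card {p \<in> V. j \<in> I p}" if "j < m" for j
    proof -
      have "{p \<in> V. j \<in> I p} = nbrs V E (R j)" using that by (auto simp: I_def nbrs_def)
      moreover have "R j \<subseteq> V" using R(1)[OF that] QV[OF that] by simp
      ultimately show ?thesis using degS R(2)[OF that] by simp
    qed
    obtain V1 V2 where V12: "V1 \<subseteq> {..<m}" "V2 \<subseteq> {..<m}" "V1 \<inter> V2 = {}" "card V1 = s" "card V2 = s"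
      "\<And>S j. S \<subseteq> V1 \<Longrightarrow> card S = q \<Longrightarrow> j \<in> V2 \<Longrightarrow> insert j S \<in> J"
      "\<And>S j. S \<subseteq> V2 \<Longrightarrow> card S = q \<Longrightarrow> j \<in> V1 \<Longrightarrow> insert j S \<in> J"
    proof (rule exists_crossing_sets[of V I m q J l s])
      show "V \<noteq> {}" using V(2) by auto
      show "I p \<subseteq> {..<m}" for p by (auto simp: I_def)
    qed (use V(1) indep half codeg mbig in auto)
    have lt: "i < m" if "i \<in> V1 \<union> V2" for i using that V12(1,2) by auto
    have fin: "finite V1" "finite V2" using finite_subset[OF V12(1)] finite_subset[OF V12(2)] by simp_all
    have "crossing_blowup q s t V E V1 V2 Q"
      unfolding crossing_blowup_def
    proof (intro conjI ballI allI impI)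
      show "Q i \<inter> Q j = {}" if "i \<in> V1 \<union> V2" "j \<in> V1 \<union> V2" "i \<noteq> j" for i j
        using lt[OF that(1)] lt[OF that(2)] that(3) by (rule Qdisj)
      show "g ` insert j S \<in> E" if "S \<subseteq> V1" "card S = q" "j \<in> V2" "\<forall>i\<in>insert j S. g i \<in> Q i" for S j g
        using V12(6)[OF that(1-3)] that(4) by (intro J_trans) auto
      show "g ` insert j S \<in> E" if "S \<subseteq> V2" "card S = q" "j \<in> V1" "\<forall>i\<in>insert j S. g i \<in> Q i" for S j g
        using V12(7)[OF that(1-3)] that(4) by (intro J_trans) auto
    qed (use V12 fin QV Qt lt in auto)
    then show "\<exists>V1 V2 Q. crossing_blowup q s t V E V1 V2 Q" by blast
  qed
qed

text \<open>If \<open>p\<close> is joined to \<open>q\<close> parts of one family and to one part of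
  the other, these \<open>q + 1\<close> parts carry all transversals and a plane appears. So
  \<open>K p\<close> lies within one family, or it has fewer than \<open>q\<close> parts in each and
  thus fewer than \<open>2 * q\<close> in all.\<close>

lemma crossing_blowup_trace:
  assumes cb: "crossing_blowup q s t V E V1 V2 Q" and V: "finite V" and free: "\<not> contains P L V E"
    and s: "1 \<le> q" "2 * q \<le> s"
    and R: "\<And>i. i \<in> V1 \<union> V2 \<Longrightarrow> R i \<subseteq> Q i" "\<And>i. i \<in> V1 \<union> V2 \<Longrightarrow> card (R i) = q"
  defines "K \<equiv> \<lambda>p. {i \<in> V1 \<union> V2. p \<in> nbrs V E (R i)}"
  shows "card (K p) \<le> s" and "card (K p) = s \<Longrightarrow> K p = V1 \<or> K p = V2"
proof -
  have fin: "finite V1" "finite V2" "V1 \<inter> V2 = {}" and cs: "card V1 = s" "card V2 = s"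
    and QV: "\<And>i. i \<in> V1 \<union> V2 \<Longrightarrow> Q i \<subseteq> V"
    and disj: "\<And>i j. i \<in> V1 \<union> V2 \<Longrightarrow> j \<in> V1 \<union> V2 \<Longrightarrow> i \<noteq> j \<Longrightarrow> Q i \<inter> Q j = {}"
    and tr1: "\<And>S j g. S \<subseteq> V1 \<Longrightarrow> card S = q \<Longrightarrow> j \<in> V2 \<Longrightarrow> (\<forall>i\<in>insert j S. g i \<in> Q i) \<Longrightarrow> g ` insert j S \<in> E"
    and tr2: "\<And>S j g. S \<subseteq> V2 \<Longrightarrow> card S = q \<Longrightarrow> j \<in> V1 \<Longrightarrow> (\<forall>i\<in>insert j S. g i \<in> Q i) \<Longrightarrow> g ` insert j S \<in> E"
    using cb unfolding crossing_blowup_def by simp_all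
  have finK: "finite (K p)" using fin by (simp add: K_def)
  have one_sided: "K p \<inter> W' = {}" if W: "(W = V1 \<and> W' = V2) \<or> (W = V2 \<and> W' = V1)" and big: "q \<le> card (K p \<inter> W)" for W W'
  proof (rule equals0I)
    fix j assume j: "j \<in> K p \<inter> W'"
    obtain S where S: "S \<subseteq> K p \<inter> W" "card S = q" using big by (rule obtain_subset_with_card_n)
    have sub: "insert j S \<subseteq> V1 \<union> V2" using S j W by auto
    have jS: "j \<notin> S" using S j W fin(3) by auto
    have "contains P L V E"
    proof (rule contains_if_joined_groups[of "insert j S" Q V E R p])
      show "finite (insert j S)" using finite_subset[OF sub] fin by simp
      then show "card (insert j S) = q + 1" using jS S by simp
      show "p \<in> nbrs V E (R i)" if "i \<in> insert j S" for i using that S j by (auto simp: K_def)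
      show "g ` insert j S \<in> E" if g: "\<And>i. i \<in> insert j S \<Longrightarrow> g i \<in> Q i" for g
        using W
      proof
        assume "W = V1 \<and> W' = V2"
        then show ?thesis using S j g by (intro tr1) auto
      next
        assume "W = V2 \<and> W' = V1"
        then show ?thesis using S j g by (intro tr2) auto
      qed
      show "Q i \<inter> Q k = {}" if "i \<in> insert j S" "k \<in> insert j S" "i \<noteq> k" for i k
        by (rule disj) (use that sub in auto)
      show "Q i \<subseteq> V" "R i \<subseteq> Q i" "card (R i) = q" if "i \<in> insert j S" for i
        using that sub QV R by blast+
    qed (rule V)
    then show False using free by blast
  qed
  have split: "card (K p) = card (K p \<inter> V1) + card (K p \<inter> V2)"
  proof -
    have "K p = (K p \<inter> V1) \<union> (K p \<inter> V2)" by (auto simp: K_def)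
    moreover have "card ((K p \<inter> V1) \<union> (K p \<inter> V2)) = card (K p \<inter> V1) + card (K p \<inter> V2)"
      using finK fin by (intro card_Un_disjoint) auto
    ultimately show ?thesis by simp
  qed
  consider "q \<le> card (K p \<inter> V1)" | "q \<le> card (K p \<inter> V2)" | "card (K p \<inter> V1) < q" "card (K p \<inter> V2) < q"
    by linarith
  then have "card (K p) \<le> s \<and> (card (K p) = s \<longrightarrow> K p = V1 \<or> K p = V2)"
  proof cases
    case 1
    then have "K p \<inter> V2 = {}" using one_sided by blast
    then have "K p \<subseteq> V1" by (auto simp: K_def)
    then show ?thesis using card_mono[OF fin(1)] card_subset_eq[OF fin(1)] cs by auto
  next
    case 2
    then have "K p \<inter> V1 = {}" using one_sided by blast
    then have "K p \<subseteq> V2" by (auto simp: K_def)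
    then show ?thesis using card_mono[OF fin(2)] card_subset_eq[OF fin(2)] cs by auto
  next
    case 3
    then show ?thesis using split s by linarith
  qed
  then show "card (K p) \<le> s" and "card (K p) = s \<Longrightarrow> K p = V1 \<or> K p = V2" by blast+
qed

text \<open>Pairs of a vertex and a part joined to it are counted twice: at most \<open>s\<close>
  per vertex, and at least half of the vertices for each of the \<open>2 * s\<close> parts. The two
  bounds agree, so equality holds everywhere and the equality case of
  \<open>crossing_blowup_trace\<close> applies.\<close>

lemma crossing_blowup_exact:
  assumes cb: "crossing_blowup q s t V E V1 V2 Q" and V: "finite V" and free: "\<not> contains P L V E"
    and s: "1 \<le> q" "2 * q \<le> s"
    and R: "\<And>i. i \<in> V1 \<union> V2 \<Longrightarrow> R i \<subseteq> Q i" "\<And>i. i \<in> V1 \<union> V2 \<Longrightarrow> card (R i) = q"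
    and deg: "\<And>i. i \<in> V1 \<union> V2 \<Longrightarrow> card V \<le> 2 * card (nbrs V E (R i))"
  defines "K \<equiv> \<lambda>p. {i \<in> V1 \<union> V2. p \<in> nbrs V E (R i)}"
  shows "\<And>p. p \<in> V \<Longrightarrow> K p = V1 \<or> K p = V2"
    and "\<And>i. i \<in> V1 \<union> V2 \<Longrightarrow> 2 * card (nbrs V E (R i)) = card V"
proof -
  have tr: "card (K p) \<le> s" "card (K p) = s \<Longrightarrow> K p = V1 \<or> K p = V2" for p
    unfolding K_def by (rule crossing_blowup_trace[OF cb V free s R]; assumption)+
  have fin: "finite V1" "finite V2" "V1 \<inter> V2 = {}" and cs: "card V1 = s" "card V2 = s"
    using cb unfolding crossing_blowup_def by simp_all
  let ?W = "V1 \<union> V2"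
  have cW: "card ?W = 2 * s" "finite ?W" using fin cs by (simp_all add: card_Un_disjoint)
  have nb: "{p \<in> V. p \<in> nbrs V E (R i)} = nbrs V E (R i)" for i by (auto simp: nbrs_def)
  have count: "(\<Sum>p\<in>V. card (K p)) = (\<Sum>i\<in>?W. card (nbrs V E (R i)))"
    unfolding K_def by (rule sum_multicount_gen) (use V cW nb in auto)
  have up: "(\<Sum>p\<in>V. card (K p)) \<le> card V * s"
    using sum_mono[of V "\<lambda>p. card (K p)" "\<lambda>_. s"] tr(1) by simp
  have low: "2 * s * card V \<le> (\<Sum>i\<in>?W. 2 * card (nbrs V E (R i)))"
    using sum_mono[of ?W "\<lambda>_. card V" "\<lambda>i. 2 * card (nbrs V E (R i))"] deg cW by simp
  have eq: "(\<Sum>p\<in>V. card (K p)) = card V * s" "(\<Sum>i\<in>?W. 2 * card (nbrs V E (R i))) = 2 * s * card V"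
    using count up low by (simp_all add: sum_distrib_left[symmetric] mult.commute)
  show "K p = V1 \<or> K p = V2" if p: "p \<in> V" for p
  proof (rule tr(2), rule ccontr)
    assume "card (K p) \<noteq> s"
    then have "card (K p) < s" using tr(1)[of p] by linarith
    then have "(\<Sum>p\<in>V. card (K p)) < (\<Sum>p\<in>V. s)"
      using tr(1) p V by (intro sum_strict_mono_ex1) auto
    then show False using eq(1) by simp
  qed
  show "2 * card (nbrs V E (R i)) = card V" if i: "i \<in> ?W" for i
  proof (rule ccontr)
    assume "2 * card (nbrs V E (R i)) \<noteq> card V"
    then have "card V < 2 * card (nbrs V E (R i))" using deg[OF i] by linarith
    then have "(\<Sum>i\<in>?W. card V) < (\<Sum>i\<in>?W. 2 * card (nbrs V E (R i)))"
      using deg i cW(2) by (intro sum_strict_mono_ex1) auto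
    then show False using eq(2) cW by simp
  qed
qed

end

subsection \<open>Plane-free hypergraphs\<close>

lemma card_image_inter:
  assumes "inj_on f P" "l \<subseteq> P"
  shows "card (f ` l \<inter> A) = card (l \<inter> {x \<in> P. f x \<in> A})"
proof -
  have "f ` l \<inter> A = f ` (l \<inter> {x \<in> P. f x \<in> A})" using assms(2) by auto
  moreover have "inj_on f (l \<inter> {x \<in> P. f x \<in> A})" using assms by (auto intro: inj_on_subset)
  ultimately show ?thesis by (simp add: card_image)
qed

context projective_plane
begin

lemma exists_line: obtains l where "l \<in> L"
proof -
  obtain p where "p \<in> P" using triangle by blast
  then show thesis using exists_line_avoiding that by blast
qed

text \<open>The lines through \<open>p\<close> partition the other points, so the parity of
  \<open>A - {p}\<close> is that of the number of lines with an odd contribution. If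
  \<open>p\<close> is in \<open>A\<close>, these are the lines with even trace; otherwise they are
  the lines with odd trace, whose number has the same parity as that of the even ones because the
  pencil has \<open>q + 1\<close> lines, an even number.\<close>

lemma even_card_iff_pencil:
  assumes A: "A \<subseteq> P" and p: "p \<in> P" and q: "odd q"
  shows "even (card A) \<longleftrightarrow> (if p \<in> A then odd (card {l \<in> pencil p. even (card (l \<inter> A))})
     else even (card {l \<in> pencil p. even (card (l \<inter> A))}))"
proof -
  let ?ev = "{l \<in> pencil p. even (card (l \<inter> A))}" and ?od = "{l \<in> pencil p. odd (card (l \<inter> A))}"
  have finA: "finite A" using A finite_points finite_subset by blast
  show ?thesis
  proof (cases "p \<in> A")
    case True
    have "odd (card (l \<inter> A - {p})) \<longleftrightarrow> even (card (l \<inter> A))" if "l \<in> pencil p" for l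
    proof -
      have "finite (l \<inter> A)" "p \<in> l \<inter> A" using True that finA by (auto simp: pencil_def)
      then have c: "card (l \<inter> A) = Suc (card (l \<inter> A - {p}))" by (rule card.remove)
      show ?thesis unfolding c by simp
    qed
    then have "{l \<in> pencil p. odd (card (l \<inter> A - {p}))} = ?ev" by blast
    then have "even (card (A - {p})) \<longleftrightarrow> even (card ?ev)"
      using sum_pencil[OF A p] even_sum_iff[OF finite_pencil, of "\<lambda>l. card (l \<inter> A - {p})" p] by simp
    moreover have "even (card A) \<longleftrightarrow> odd (card (A - {p}))" by (subst card.remove[OF finA True]) simp
    ultimately show ?thesis using True by (simp only: if_True)
  next
    case False
    then have "A - {p} = A" "l \<inter> A - {p} = l \<inter> A" for l by auto
    then have "even (card A) \<longleftrightarrow> even (card ?od)"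
      using sum_pencil[OF A p] even_sum_iff[OF finite_pencil, of "\<lambda>l. card (l \<inter> A)" p] by simp
    moreover have "card (pencil p) = card ?od + card ?ev"
    proof -
      have "pencil p = ?od \<union> ?ev" by blast
      moreover have "card (?od \<union> ?ev) = card ?od + card ?ev"
        by (rule card_Un_disjoint) (auto simp: finite_pencil)
      ultimately show ?thesis by simp
    qed
    moreover have "even (card (pencil p))" using card_pencil[OF p] q by simp
    ultimately show ?thesis using False by simp
  qed
qed

lemma odd_graph_free:
  assumes q: "odd q" and E: "\<And>e. e \<in> E \<Longrightarrow> odd (card (e \<inter> A))"
  shows "\<not> contains P L V E"
proof
  assume "contains P L V E"
  then obtain f where f: "inj_on f P" "\<And>l. l \<in> L \<Longrightarrow> f ` l \<in> E" unfolding contains_def by blast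
  define S where "S = {x \<in> P. f x \<in> A}"
  have odd: "odd (card (l \<inter> S))" if "l \<in> L" for l
    using E[OF f(2)[OF that]] card_image_inter[OF f(1) line_subset[OF that], of A] by (simp add: S_def)
  have SP: "S \<subseteq> P" by (auto simp: S_def)
  have none: "{l \<in> pencil p. even (card (l \<inter> S))} = {}" for p using odd by (auto simp: pencil_def)
  obtain l where l: "l \<in> L" by (rule exists_line)
  have "l \<inter> S \<noteq> {}" using odd[OF l] by auto
  then obtain a where a: "a \<in> S" by blast
  \<comment> \<open>A line has an even number \<open>q + 1\<close> of points, so an odd trace cannot
    be the whole line.\<close>
  have "l \<inter> S \<noteq> l" using odd[OF l] card_line[OF l] q by auto
  then obtain b where b: "b \<in> l" "b \<notin> S" by blast
  have "odd (card S)" using even_card_iff_pencil[OF SP _ q, of a] a SP none[of a] by auto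
  moreover have "even (card S)"
    using even_card_iff_pencil[OF SP _ q, of b] b l line_subset none[of b] by auto
  ultimately show False by simp
qed

text \<open>For \<open>q = 3\<close> the number of lines meeting \<open>S\<close> in two points is \<open>card S * (13 - card S) - 39\<close>,
  which is odd; counting these lines through their unique point of \<open>C\<close> instead contradicts this.\<close>

lemma perturbed_odd_graph_free:
  assumes q: "q = 3" and C: "C \<subseteq> A" "card C \<le> 2" "finite C"
    and E: "\<And>e. e \<in> E \<Longrightarrow> odd (card (e \<inter> A)) \<or> (card (e \<inter> A) = 2 \<and> card (e \<inter> C) = 1)"
  shows "\<not> contains P L V E"
proof
  assume "contains P L V E"
  then obtain f where f: "inj_on f P" "\<And>l. l \<in> L \<Longrightarrow> f ` l \<in> E" unfolding contains_def by blast
  define S where "S = {x \<in> P. f x \<in> A}"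
  define D where "D = {x \<in> P. f x \<in> C}"
  have SP: "S \<subseteq> P" "D \<subseteq> S" "finite S" "finite D" using C finite_points by (auto simp: S_def D_def)
  have oq: "odd q" using q by simp
  have cases: "odd (card (l \<inter> S)) \<or> (card (l \<inter> S) = 2 \<and> card (l \<inter> D) = 1)" if "l \<in> L" for l
    using E[OF f(2)[OF that]] card_image_inter[OF f(1) line_subset[OF that], of A]
      card_image_inter[OF f(1) line_subset[OF that], of C] by (simp add: S_def D_def)
  have cardD: "card D \<le> 2"
  proof -
    have "inj_on f D" using f(1) by (rule inj_on_subset) (auto simp: D_def)
    then have "card D \<le> card C" using C(3) by (intro card_inj_on_le[of f]) (auto simp: D_def)
    then show ?thesis using C by simp
  qed
  define T where "T = {l \<in> L. even (card (l \<inter> S))}"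
  define ev where "ev p = card {l \<in> T. p \<in> l}" for p
  have ev_eq: "{l \<in> pencil p. even (card (l \<inter> S))} = {l \<in> T. p \<in> l}" for p by (auto simp: pencil_def T_def)
  have finT: "finite T" using finite_lines by (simp add: T_def)
  have T2: "card (l \<inter> S) = 2" "card (l \<inter> D) = 1" if "l \<in> T" for l
    using cases[of l] that by (auto simp: T_def)
  have par: "even (card S) \<longleftrightarrow> (if p \<in> S then odd (ev p) else even (ev p))" if "p \<in> P" for p
    using even_card_iff_pencil[OF SP(1) that oq] unfolding ev_eq ev_def .
  \<comment> \<open>An odd trace splits the four points of a line as 1 and 3, an even one as 2 and
    2.\<close>
  have compl: "card (l \<inter> S) * card (l \<inter> (P - S)) = (if l \<in> T then 4 else 3)" if l: "l \<in> L" for l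
  proof -
    have "card (l \<inter> S) + card (l \<inter> (P - S)) = 4"
    proof -
      have "l = (l \<inter> S) \<union> (l \<inter> (P - S))" using line_subset[OF l] by blast
      moreover have "card ((l \<inter> S) \<union> (l \<inter> (P - S))) = card (l \<inter> S) + card (l \<inter> (P - S))"
        using finite_line[OF l] by (intro card_Un_disjoint) auto
      ultimately show ?thesis using card_line[OF l] q by simp
    qed
    then have "card (l \<inter> S) \<le> 4" "card (l \<inter> (P - S)) = 4 - card (l \<inter> S)" by simp_all
    moreover have "odd (card (l \<inter> S)) \<Longrightarrow> card (l \<inter> S) \<le> 4 \<Longrightarrow> card (l \<inter> S) = 1 \<or> card (l \<inter> S) = 3"
      by presburger
    ultimately show ?thesis using T2[of l] l by (auto simp: T_def)
  qed
  have "card S * card (P - S) = (\<Sum>l\<in>L. if l \<in> T then 4 else 3)"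
    using sum_line_products[of S "P - S"] compl SP by simp
  also have "\<dots> = (\<Sum>l\<in>L. 3 + (if l \<in> T then 1 else 0))" by (intro sum.cong) auto
  also have "\<dots> = 3 * card L + card T"
  proof -
    have "L \<inter> T = T" by (auto simp: T_def)
    then show ?thesis using finite_lines by (simp add: sum.distrib sum.If_cases)
  qed
  finally have "card S * card (P - S) = 39 + card T" using card_lines q by simp
  moreover have "card S + card (P - S) = 13"
    using card_points q card_Diff_subset[OF SP(3,1)] card_mono[OF finite_points SP(1)] by simp
  \<comment> \<open>Of two numbers with sum 13 one is even. As 39 is odd, \<open>card T\<close> must
    be odd.\<close>
  moreover have "even (x * y)" if "x + y = 13" for x y :: nat
  proof -
    have "odd (x + y)" using that by simp
    then show ?thesis by auto
  qed
  ultimately have "even (39 + card T)" by metis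
  then have oddT: "odd (card T)" by simp
  have "card T = (\<Sum>d\<in>D. ev d)"
  proof -
    have "(\<Sum>d\<in>D. card {l \<in> T. d \<in> l}) = (\<Sum>l\<in>T. 1)"
    proof (rule sum_multicount_gen[OF SP(4) finT], rule ballI)
      fix l assume "l \<in> T"
      then have "card (l \<inter> D) = 1" by (rule T2)
      moreover have "l \<inter> D = {i \<in> D. i \<in> l}" by blast
      ultimately show "card {i \<in> D. i \<in> l} = 1" by simp
    qed
    then show ?thesis by (simp add: ev_def)
  qed
  moreover have "odd (ev d) \<longleftrightarrow> even (card S)" if "d \<in> D" for d
  proof -
    have "d \<in> S" "d \<in> P" using that SP by auto
    then show ?thesis using par[of d] by simp
  qed
  then have "{d \<in> D. odd (ev d)} = (if even (card S) then D else {})" by auto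
  ultimately have "even (card T) \<longleftrightarrow> even (card (if even (card S) then D else {}))"
    using even_sum_iff[OF SP(4), of ev] by simp
  \<comment> \<open>Were \<open>card S\<close> odd, every point of \<open>D\<close> would lie on an
    even number of lines in \<open>T\<close>, making \<open>card T\<close> even. So all these
    numbers are odd, and \<open>card T\<close> has the parity of \<open>card D\<close>.\<close>
  then have evS: "even (card S)" and "odd (card D)" using oddT by (auto split: if_splits)
  then have "card D = 1" using cardD by (cases "card D = 0 \<or> card D = 1 \<or> card D = 2") auto
  then obtain d where d: "D = {d}" by (rule card_1_singletonE)
  have dl: "d \<in> l" if "l \<in> T" for l
  proof -
    have "l \<inter> D \<noteq> {}" using T2(2)[OF that] by (metis card.empty zero_neq_one)
    then show ?thesis using d by blast
  qed
  have "T \<noteq> {}" using oddT by auto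
  then obtain l where l: "l \<in> T" by blast
  have lL: "l \<in> L" using l by (simp add: T_def)
  have "\<not> l \<subseteq> S"
  proof
    assume "l \<subseteq> S"
    then have "l \<inter> S = l" by blast
    then show False using T2(1)[OF l] card_line[OF lL] q by simp
  qed
  then obtain b where b: "b \<in> l" "b \<notin> S" by blast
  have bd: "b \<noteq> d" using b SP(2) d by auto
  \<comment> \<open>All lines in \<open>T\<close> pass through \<open>d\<close>, and only one line
    joins \<open>d\<close> and \<open>b\<close>. Thus \<open>ev b\<close> is 1, while
    \<open>par\<close> demands an even number at a point outside \<open>S\<close>.\<close>
  have "{l' \<in> T. b \<in> l'} = {l}"
  proof (intro equalityI subsetI)
    fix l' assume "l' \<in> {l' \<in> T. b \<in> l'}"
    then have "l' \<in> L" "b \<in> l'" "d \<in> l'" using dl by (auto simp: T_def)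
    then show "l' \<in> {l}" using lines_eqI[of l' l b d] lL b bd dl[OF l] by blast
  qed (use l b in auto)
  then have "ev b = 1" by (simp add: ev_def)
  moreover have "b \<in> P" using b lL line_subset by blast
  ultimately show False using par[of b] b(2) evS by simp
qed

end

subsection \<open>The exact bipartition\<close>

lemma inj_on_disjoint_images:
  "inj_on f A \<Longrightarrow> inj_on f B \<Longrightarrow> f ` A \<inter> f ` B = {} \<Longrightarrow> inj_on f (A \<union> B)"
  by (auto simp: inj_on_Un)

context projective_plane
begin

text \<open>One part of each family suffices for \<open>X\<close> and \<open>Y\<close>. By
  \<open>crossing_blowup_exact\<close> the neighbours of the \<open>q\<close>-set chosen in one of
  them are the complement of those of the \<open>q\<close>-set chosen in the other, so changing the
  choice in one part alone cannot change its neighbours.\<close>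

lemma exists_exact_bipartition:
  assumes q: "1 \<le> q" "q \<le> t"
  shows "\<exists>N. \<forall>(V :: 'v set) E. finite V \<longrightarrow> N \<le> card V \<longrightarrow> \<not> contains P L V E \<longrightarrow>
    (\<forall>S. S \<subseteq> V \<longrightarrow> card S = q \<longrightarrow> card V \<le> 2 * card (nbrs V E S)) \<longrightarrow>
    (\<exists>A B X Y. A \<union> B = V \<and> A \<inter> B = {} \<and> 2 * card A = card V \<and> 2 * card B = card V \<and>
      X \<subseteq> A \<and> Y \<subseteq> B \<and> card X = t \<and> card Y = t \<and>
      (\<forall>R. R \<subseteq> X \<longrightarrow> card R = q \<longrightarrow> nbrs V E R = B) \<and> (\<forall>R. R \<subseteq> Y \<longrightarrow> card R = q \<longrightarrow> nbrs V E R = A))"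
proof -
  obtain N where N: "\<forall>(V :: 'v set) E. finite V \<longrightarrow> N \<le> card V \<longrightarrow> \<not> contains P L V E \<longrightarrow>
    (\<forall>S. S \<subseteq> V \<longrightarrow> card S = q \<longrightarrow> card V \<le> 2 * card (nbrs V E S)) \<longrightarrow>
    (\<exists>V1 V2 Q. crossing_blowup q (2 * q) t V E V1 V2 Q)"
    using exists_crossing_blowup[OF q(1,2)] by (rule exE)
  show ?thesis
  proof (intro exI[of _ N] allI impI)
    fix V :: "'v set" and E
    assume V: "finite V" "N \<le> card V" and free: "\<not> contains P L V E"
      and deg: "\<forall>S. S \<subseteq> V \<longrightarrow> card S = q \<longrightarrow> card V \<le> 2 * card (nbrs V E S)"
    have "\<exists>V1 V2 Q. crossing_blowup q (2 * q) t V E V1 V2 Q"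
      using N[THEN spec, THEN spec, of V E] V free deg by simp
    then obtain V1 V2 Q where cb: "crossing_blowup q (2 * q) t V E V1 V2 Q" by (elim exE)
    have fin: "V1 \<inter> V2 = {}" and cs: "card V1 = 2 * q" "card V2 = 2 * q"
      and QV: "\<And>i. i \<in> V1 \<union> V2 \<Longrightarrow> Q i \<subseteq> V" and Qt: "\<And>i. i \<in> V1 \<union> V2 \<Longrightarrow> card (Q i) = t"
      using cb unfolding crossing_blowup_def by simp_all
    have "V1 \<noteq> {}" "V2 \<noteq> {}" using cs q(1) by auto
    then obtain i1 i2 where i: "i1 \<in> V1" "i2 \<in> V2" by blast
    have i12: "i1 \<notin> V2" "i2 \<notin> V1" "i1 \<noteq> i2" using i fin by auto
    have "\<forall>i\<in>V1 \<union> V2. \<exists>R. R \<subseteq> Q i \<and> card R = q"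
    proof
      fix i assume "i \<in> V1 \<union> V2"
      then have "q \<le> card (Q i)" using Qt q by simp
      then show "\<exists>R. R \<subseteq> Q i \<and> card R = q" by (rule obtain_subset_with_card_n) blast
    qed
    then obtain R0 where R0: "\<And>i. i \<in> V1 \<union> V2 \<Longrightarrow> R0 i \<subseteq> Q i" "\<And>i. i \<in> V1 \<union> V2 \<Longrightarrow> card (R0 i) = q"
      by metis
    define K where "K R p = {i \<in> V1 \<union> V2. p \<in> nbrs V E (R i)}" for R p
    have exact: "\<And>p. p \<in> V \<Longrightarrow> K R p = V1 \<or> K R p = V2" "\<And>i. i \<in> V1 \<union> V2 \<Longrightarrow> 2 * card (nbrs V E (R i)) = card V"
      if R: "\<And>i. i \<in> V1 \<union> V2 \<Longrightarrow> R i \<subseteq> Q i" "\<And>i. i \<in> V1 \<union> V2 \<Longrightarrow> card (R i) = q" for R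
    proof -
      have d: "card V \<le> 2 * card (nbrs V E (R i))" if "i \<in> V1 \<union> V2" for i
      proof -
        have "R i \<subseteq> V" using R(1)[OF that] QV[OF that] by (rule order_trans)
        then show ?thesis using deg R(2)[OF that] by simp
      qed
      show "K R p = V1 \<or> K R p = V2" if "p \<in> V" for p
        unfolding K_def by (rule crossing_blowup_exact(1)[OF cb V(1) free q(1) order_refl R d that])
      show "2 * card (nbrs V E (R i)) = card V" if "i \<in> V1 \<union> V2" for i
        by (rule crossing_blowup_exact(2)[OF cb V(1) free q(1) order_refl R d that])
    qed
    \<comment> \<open>The classes are named crosswise: \<open>B\<close> consists of the vertices
      joined to the part \<open>i1\<close>, and this part itself turns out to lie in
      \<open>A\<close>.\<close>
    define B where "B = nbrs V E (R0 i1)"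
    define A where "A = nbrs V E (R0 i2)"
    have sub: "A \<subseteq> V" "B \<subseteq> V" by (auto simp: A_def B_def nbrs_def)
    have opp: "p \<in> nbrs V E (R i1) \<longleftrightarrow> p \<notin> nbrs V E (R i2)"
      if "p \<in> V" "\<And>i. i \<in> V1 \<union> V2 \<Longrightarrow> R i \<subseteq> Q i" "\<And>i. i \<in> V1 \<union> V2 \<Longrightarrow> card (R i) = q" for R p
    proof -
      have "i1 \<in> K R p \<longleftrightarrow> i2 \<notin> K R p" using exact(1)[OF that(2,3) that(1)] i i12 by auto
      then show ?thesis using i by (simp add: K_def)
    qed
    have nbr_sub: "nbrs V E R \<subseteq> V" for R by (auto simp: nbrs_def)
    have nX: "nbrs V E R = B" if R: "R \<subseteq> Q i1" "card R = q" for R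
    proof -
      let ?R = "R0(i1 := R)"
      have "?R i \<subseteq> Q i" "card (?R i) = q" if "i \<in> V1 \<union> V2" for i using R R0 that by auto
      then have "p \<in> nbrs V E R \<longleftrightarrow> p \<in> B" if "p \<in> V" for p
        using opp[OF that, of ?R] opp[OF that R0] i12 by (simp add: B_def)
      then show ?thesis using nbr_sub sub by blast
    qed
    have nY: "nbrs V E R = A" if R: "R \<subseteq> Q i2" "card R = q" for R
    proof -
      let ?R = "R0(i2 := R)"
      have "?R i \<subseteq> Q i" "card (?R i) = q" if "i \<in> V1 \<union> V2" for i using R R0 that by auto
      then have "p \<in> nbrs V E R \<longleftrightarrow> p \<in> A" if "p \<in> V" for p
        using opp[OF that, of ?R] opp[OF that R0] i12 by (simp add: A_def)
      then show ?thesis using nbr_sub sub by blast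
    qed
    have part: "p \<in> B \<longleftrightarrow> p \<notin> A" if "p \<in> V" for p
      using opp[OF that R0] by (simp add: A_def B_def)
    \<comment> \<open>A vertex \<open>x\<close> of a part belongs to some \<open>q\<close>-subset of
      that part and is not a neighbour of a set containing it; but all these
      \<open>q\<close>-subsets have the same neighbours.\<close>
    have avoid: "x \<notin> C" if x: "x \<in> Q i" and i: "i \<in> V1 \<union> V2" and C: "\<And>R. R \<subseteq> Q i \<Longrightarrow> card R = q \<Longrightarrow> nbrs V E R = C" for x i C
    proof -
      have "finite (Q i)" using QV[OF i] V(1) by (rule finite_subset)
      then have "card (Q i - {x}) = t - 1" using x Qt[OF i] by simp
      then have "q - 1 \<le> card (Q i - {x})" using q by simp
      then obtain R where R: "R \<subseteq> Q i - {x}" "card R = q - 1" "finite R" by (rule obtain_subset_with_card_n)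
      have "x \<notin> R" using R(1) by blast
      then have "card (insert x R) = q" using R q by simp
      then have "nbrs V E (insert x R) = C" using R x by (intro C) auto
      then show ?thesis by (auto simp: nbrs_def)
    qed
    have "A \<union> B = V" "A \<inter> B = {}" using part sub by auto
    moreover have "2 * card A = card V" "2 * card B = card V"
      using exact(2)[OF R0] i by (simp_all add: A_def B_def)
    moreover have "Q i1 \<subseteq> A" using avoid[of _ i1 B] nX i part QV[of i1] by blast
    moreover have "Q i2 \<subseteq> B" using avoid[of _ i2 A] nY i part QV[of i2] by blast
    moreover have "card (Q i1) = t" "card (Q i2) = t" using Qt i by simp_all
    ultimately show "\<exists>A B X Y. A \<union> B = V \<and> A \<inter> B = {} \<and> 2 * card A = card V \<and> 2 * card B = card V \<and>
      X \<subseteq> A \<and> Y \<subseteq> B \<and> card X = t \<and> card Y = t \<and>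
      (\<forall>R. R \<subseteq> X \<longrightarrow> card R = q \<longrightarrow> nbrs V E R = B) \<and> (\<forall>R. R \<subseteq> Y \<longrightarrow> card R = q \<longrightarrow> nbrs V E R = A)"
      using nX nY by (intro exI[of _ A] exI[of _ B] exI[of _ "Q i1"] exI[of _ "Q i2"]) simp
  qed
qed

text \<open>The vertices of a triangle go to \<open>d1\<close>, \<open>d2\<close>,
  \<open>d3\<close>, the two remaining points of each side go to \<open>e1\<close>,
  \<open>e2\<close>, \<open>e3\<close> in \<open>A\<close>, and the other four points go to
  \<open>B\<close>; this accounts for the 7 vertices of \<open>B\<close>. Only the three sides have
  an even trace on \<open>A\<close>, and their images are the prescribed edges.\<close>

lemma contains_if_triangle:
  assumes q: "q = 3" and V: "A \<subseteq> V" "B \<subseteq> V" "A \<inter> B = {}" "finite V"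
    and odd_edges: "\<And>e. e \<subseteq> A \<union> B \<Longrightarrow> card e = 4 \<Longrightarrow> odd (card (e \<inter> A)) \<Longrightarrow> e \<in> E"
    and B7: "7 \<le> card B"
    and d: "d1 \<in> B" "d2 \<in> B" "d3 \<in> B" "d1 \<noteq> d2" "d1 \<noteq> d3" "d2 \<noteq> d3"
    and e: "e1 \<subseteq> A" "e2 \<subseteq> A" "e3 \<subseteq> A" "card e1 = 2" "card e2 = 2" "card e3 = 2"
      "e1 \<inter> e2 = {}" "e1 \<inter> e3 = {}" "e2 \<inter> e3 = {}"
    and eE: "e1 \<union> {d2, d3} \<in> E" "e2 \<union> {d1, d3} \<in> E" "e3 \<union> {d1, d2} \<in> E"
  shows "contains P L V E"
proof -
  obtain x1 x2 x3 where x: "x1 \<in> P" "x2 \<in> P" "x3 \<in> P" "x1 \<noteq> x2" "x1 \<noteq> x3" "x2 \<noteq> x3"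
    and nc: "\<forall>l\<in>L. \<not> {x1,x2,x3} \<subseteq> l" using triangle by blast
  obtain l1 where l1: "l1 \<in> L" "x2 \<in> l1" "x3 \<in> l1" using exists_join[OF x(2,3,6)] by blast
  obtain l2 where l2: "l2 \<in> L" "x1 \<in> l2" "x3 \<in> l2" using exists_join[OF x(1,3,5)] by blast
  obtain l3 where l3: "l3 \<in> L" "x1 \<in> l3" "x2 \<in> l3" using exists_join[OF x(1,2,4)] by blast
  have nx: "x1 \<notin> l1" "x2 \<notin> l2" "x3 \<notin> l3" using nc l1 l2 l3 by auto
  have ne: "l1 \<noteq> l2" "l1 \<noteq> l3" "l2 \<noteq> l3" using nx l1 l2 l3 by auto
  have m12: "y = x3" if "y \<in> l1" "y \<in> l2" for y using lines_eqI[of l1 l2 y x3] l1 l2 ne that by auto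
  have m13: "y = x2" if "y \<in> l1" "y \<in> l3" for y using lines_eqI[of l1 l3 y x2] l1 l3 ne that by auto
  have m23: "y = x1" if "y \<in> l2" "y \<in> l3" for y using lines_eqI[of l2 l3 y x1] l2 l3 ne that by auto
  define M1 M2 M3 where "M1 = l1 - {x2, x3}" and "M2 = l2 - {x1, x3}" and "M3 = l3 - {x1, x2}"
  have cM: "card M1 = 2" "card M2 = 2" "card M3 = 2"
    using card_line[OF l1(1)] card_line[OF l2(1)] card_line[OF l3(1)] l1 l2 l3 x q
    by (simp_all add: M1_def M2_def M3_def card_Diff_insert card_Diff_singleton)
  have fM: "finite M1" "finite M2" "finite M3"
    using finite_line l1(1) l2(1) l3(1) by (simp_all add: M1_def M2_def M3_def)
  have dM: "M1 \<inter> M2 = {}" "M1 \<inter> M3 = {}" "M2 \<inter> M3 = {}"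
    using m12 m13 m23 by (auto simp: M1_def M2_def M3_def)
  define S where "S = M1 \<union> M2 \<union> M3"
  define X where "X = {x1, x2, x3}"
  have SX: "S \<inter> X = {}" using nx by (auto simp: S_def X_def M1_def M2_def M3_def)
  have SP: "S \<subseteq> P" using line_subset[OF l1(1)] line_subset[OF l2(1)] line_subset[OF l3(1)]
    by (auto simp: S_def M1_def M2_def M3_def)
  have XP: "X \<subseteq> P" "card X = 3" using x by (auto simp: X_def)
  have cS: "card S = 6"
  proof -
    have "card (M1 \<union> M2) = 4" using fM dM cM by (simp add: card_Un_disjoint)
    moreover have "(M1 \<union> M2) \<inter> M3 = {}" using dM by blast
    ultimately show ?thesis using fM cM unfolding S_def by (simp add: card_Un_disjoint)
  qed
  have fe: "finite e1" "finite e2" "finite e3" using e(4-6) by (simp_all add: card_ge_0_finite)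
  obtain g1 where g1: "bij_betw g1 M1 e1" using finite_same_card_bij[OF fM(1) fe(1)] cM e by auto
  obtain g2 where g2: "bij_betw g2 M2 e2" using finite_same_card_bij[OF fM(2) fe(2)] cM e by auto
  obtain g3 where g3: "bij_betw g3 M3 e3" using finite_same_card_bij[OF fM(3) fe(3)] cM e by auto
  have finB: "finite B" using V(2,4) by (rule finite_subset)
  have "card (P - S - X) = 4"
  proof -
    have "card (P - S) = 7" using card_points cS SP q card_Diff_subset[of S P] finite_subset[OF SP finite_points] by simp
    moreover have "X \<subseteq> P - S" using XP SX by blast
    moreover have "finite X" by (simp add: X_def)
    ultimately show ?thesis using XP(2) by (simp add: card_Diff_subset)
  qed
  moreover have "4 \<le> card (B - {d1,d2,d3})"
  proof -
    have "card {d1,d2,d3} = 3" using d by simp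
    then show ?thesis using B7 d card_Diff_subset[of "{d1,d2,d3}" B] by simp
  qed
  ultimately obtain h where h: "inj_on h (P - S - X)" "h ` (P - S - X) \<subseteq> B - {d1,d2,d3}"
    using card_le_inj[of "P - S - X" "B - {d1,d2,d3}"] finite_points finB by auto
  define f where "f y = (if y \<in> M1 then g1 y else if y \<in> M2 then g2 y else if y \<in> M3 then g3 y
    else if y = x1 then d1 else if y = x2 then d2 else if y = x3 then d3 else h y)" for y
  have fM1: "f y = g1 y" if "y \<in> M1" for y using that by (simp add: f_def)
  have fM2: "f y = g2 y" if "y \<in> M2" for y using that dM by (auto simp: f_def)
  have fM3: "f y = g3 y" if "y \<in> M3" for y using that dM by (auto simp: f_def)
  have notM: "y \<notin> M1" "y \<notin> M2" "y \<notin> M3" if "y \<notin> S" for y using that by (auto simp: S_def)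
  have xS: "x1 \<notin> S" "x2 \<notin> S" "x3 \<notin> S" using SX by (auto simp: X_def)
  have fx: "f x1 = d1" "f x2 = d2" "f x3 = d3"
    using notM[OF xS(1)] notM[OF xS(2)] notM[OF xS(3)] x by (simp_all add: f_def)
  have fh: "f y = h y" if "y \<in> P - S - X" for y
    using that notM[of y] by (simp add: f_def X_def)
  have bij: "bij_betw f M1 e1" "bij_betw f M2 e2" "bij_betw f M3 e3"
    using bij_betw_cong[of M1 f g1 e1, OF fM1] bij_betw_cong[of M2 f g2 e2, OF fM2]
      bij_betw_cong[of M3 f g3 e3, OF fM3] g1 g2 g3 by simp_all
  note img = bij(1)[THEN bij_betw_imp_surj_on] bij(2)[THEN bij_betw_imp_surj_on]
    bij(3)[THEN bij_betw_imp_surj_on]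
  note injM = bij(1)[THEN bij_betw_imp_inj_on] bij(2)[THEN bij_betw_imp_inj_on]
    bij(3)[THEN bij_betw_imp_inj_on]
  have imgX: "f ` X = {d1,d2,d3}" using fx by (simp add: X_def)
  have injX: "inj_on f X" using fx d by (auto simp: X_def)
  have imgR: "f ` (P - S - X) \<subseteq> B - {d1,d2,d3}" using h(2) fh by (simp cong: image_cong_simp)
  have injR: "inj_on f (P - S - X)" using h(1) inj_on_cong[of "P - S - X" f h, OF fh] by simp
  have PS: "P - S = X \<union> (P - S - X)" using XP SX by blast
  have imgB: "f ` (P - S) \<subseteq> B"
  proof -
    have "f ` (P - S) = f ` X \<union> f ` (P - S - X)" using arg_cong[OF PS, of "image f"] by (simp only: image_Un)
    also have "\<dots> \<subseteq> B" unfolding imgX using imgR d by blast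
    finally show ?thesis .
  qed
  have imgS: "f ` S = e1 \<union> e2 \<union> e3" unfolding S_def image_Un img ..
  have fA: "f y \<in> A" if "y \<in> S" for y using imageI[OF that, of f] e(1-3) unfolding imgS by blast
  have fB: "f y \<in> B" if "y \<in> P - S" for y using imageI[OF that, of f] imgB by blast
  have injS: "inj_on f S" unfolding S_def
    by (intro inj_on_disjoint_images injM) (use e(7-9) in \<open>auto simp only: image_Un img\<close>)
  have injB: "inj_on f (P - S)"
    by (subst PS, intro inj_on_disjoint_images injX injR) (use imgX imgR in blast)
  have inj: "inj_on f P"
  proof -
    have "inj_on f (S \<union> (P - S))"
      by (intro inj_on_disjoint_images injS injB) (use imgB imgS e(1-3) V(3) in blast)
    moreover have "S \<union> (P - S) = P" using SP by blast
    ultimately show ?thesis by simp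
  qed
  have fP: "f ` P \<subseteq> A \<union> B" using fA fB by blast
  have cnt: "card (f ` l \<inter> A) = card (l \<inter> S)" if "l \<in> L" for l
  proof -
    have lP: "l \<subseteq> P" using that by (rule line_subset)
    have "f ` l \<inter> A = f ` (l \<inter> S)" using lP fA fB V(3) by blast
    moreover have "inj_on f (l \<inter> S)" using injS by (rule inj_on_subset) blast
    ultimately show ?thesis by (simp add: card_image)
  qed
  have "f ` l \<in> E" if l: "l \<in> L" for l
  proof -
    consider "l = l1" | "l = l2" | "l = l3" | "l \<noteq> l1" "l \<noteq> l2" "l \<noteq> l3" by blast
    then show ?thesis
    proof cases
      case 1
      have "l1 = M1 \<union> {x2, x3}" using l1 by (auto simp: M1_def)
      then have "f ` l1 = e1 \<union> {d2, d3}" using img fx by (simp add: image_Un)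
      then show ?thesis using eE 1 by simp
    next
      case 2
      have "l2 = M2 \<union> {x1, x3}" using l2 by (auto simp: M2_def)
      then have "f ` l2 = e2 \<union> {d1, d3}" using img fx by (simp add: image_Un)
      then show ?thesis using eE 2 by simp
    next
      case 3
      have "l3 = M3 \<union> {x1, x2}" using l3 by (auto simp: M3_def)
      then have "f ` l3 = e3 \<union> {d1, d2}" using img fx by (simp add: image_Un)
      then show ?thesis using eE 3 by simp
    next
      case 4
      obtain y1 where y1: "l \<inter> l1 = {y1}" using meet[OF l l1(1) 4(1)] by blast
      obtain y2 where y2: "l \<inter> l2 = {y2}" using meet[OF l l2(1) 4(2)] by blast
      obtain y3 where y3: "l \<inter> l3 = {y3}" using meet[OF l l3(1) 4(3)] by blast
      have two: "\<not> (x1 \<in> l \<and> x2 \<in> l)" "\<not> (x1 \<in> l \<and> x3 \<in> l)" "\<not> (x2 \<in> l \<and> x3 \<in> l)"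
        using lines_eqI[OF l l3(1), of x1 x2] lines_eqI[OF l l2(1), of x1 x3] lines_eqI[OF l l1(1), of x2 x3]
          l1 l2 l3 4 x by auto
      have y: "y1 \<in> l" "y1 \<in> l1" "y2 \<in> l" "y2 \<in> l2" "y3 \<in> l" "y3 \<in> l3" using y1 y2 y3 by blast+
      have my: "y = y1" if "y \<in> l" "y \<in> l1" for y using y1 that by blast
      have my2: "y = y2" if "y \<in> l" "y \<in> l2" for y using y2 that by blast
      have my3: "y = y3" if "y \<in> l" "y \<in> l3" for y using y3 that by blast
      have iS: "l \<inter> S = (({y1} - {x2,x3}) \<union> ({y2} - {x1,x3})) \<union> ({y3} - {x1,x2})"
        using y1 y2 y3 by (auto simp: S_def M1_def M2_def M3_def)
      \<comment> \<open>A line through one vertex of the triangle, other than a side, meets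
        \<open>S\<close> only on the opposite side; a line through no vertex meets the three sides
        in three points of \<open>S\<close>.\<close>
      have "odd (card (l \<inter> S))"
      proof -
        consider "x1 \<in> l" | "x2 \<in> l" | "x3 \<in> l" | "x1 \<notin> l" "x2 \<notin> l" "x3 \<notin> l" by blast
        then show ?thesis
        proof cases
          case 1
          then have "x1 = y2" "x1 = y3" using my2 my3 l2 l3 by blast+
          moreover have "y1 \<noteq> x2" "y1 \<noteq> x3" using two 1 y by metis+
          ultimately have "l \<inter> S = {y1}" using iS by auto
          then show ?thesis by simp
        next
          case 2
          then have "x2 = y1" "x2 = y3" using my my3 l1 l3 by blast+
          moreover have "y2 \<noteq> x1" "y2 \<noteq> x3" using two 2 y by metis+
          ultimately have "l \<inter> S = {y2}" using iS by auto
          then show ?thesis by simp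
        next
          case 3
          then have "x3 = y1" "x3 = y2" using my my2 l1 l2 by blast+
          moreover have "y3 \<noteq> x1" "y3 \<noteq> x2" using two 3 y by metis+
          ultimately have "l \<inter> S = {y3}" using iS by auto
          then show ?thesis by simp
        next
          case 4
          have "y1 \<noteq> y2" "y1 \<noteq> y3" "y2 \<noteq> y3" using m12[of y1] m13[of y1] m23[of y2] y 4 by auto
          moreover have "l \<inter> S = {y1, y2, y3}" using iS y 4 by auto
          ultimately show ?thesis by simp
        qed
      qed
      moreover have "card (f ` l) = 4"
        using card_image[OF inj_on_subset[OF inj line_subset[OF l]]] card_line[OF l] q by simp
      moreover have "f ` l \<subseteq> A \<union> B" using fP line_subset[OF l] by blast
      ultimately show ?thesis using cnt[OF l] by (intro odd_edges) simp_all
    qed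
  qed
  then show ?thesis using inj fP V(1,2) unfolding contains_def by blast
qed

end

subsection \<open>Planes of order three\<close>

text \<open>Three distinct flexible vertices for three graphs allow a greedy choice of disjoint edges.\<close>

definition flexible :: "'v set \<Rightarrow> ('v \<Rightarrow> 'v \<Rightarrow> bool) \<Rightarrow> 'v \<Rightarrow> bool" where
  "flexible A G x \<longleftrightarrow> (\<forall>X. finite X \<longrightarrow> card X \<le> 4 \<longrightarrow> x \<notin> X \<longrightarrow> (\<exists>u\<in>A - X. \<exists>v\<in>A - X. u \<noteq> v \<and> G u v))"

lemma flexibleD:
  assumes "flexible A G x" "finite X" "card X \<le> 4" "x \<notin> X"
  obtains u v where "u \<in> A - X" "v \<in> A - X" "u \<noteq> v" "G u v"
proof -
  have "\<exists>u\<in>A - X. \<exists>v\<in>A - X. u \<noteq> v \<and> G u v" using assms by (simp add: flexible_def)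
  then show thesis using that by blast
qed

text \<open>If some vertex is not flexible, a set \<open>X\<close> of at most 4 vertices meets all
  edges, so every vertex outside \<open>X\<close> has two neighbours in \<open>X\<close>. A vertex
  with 5 neighbours is flexible; hence with at most one flexible vertex, \<open>X\<close> receives
  at most \<open>card A + 16\<close> edges from outside, against at least
  \<open>2 * (card A - 4)\<close>. This fails from \<open>card A = 25\<close> on.\<close>

lemma two_flexible:
  assumes A: "finite A" "25 \<le> card A" and sym: "\<And>u v. G u v \<Longrightarrow> G v u"
    and deg: "\<And>u. u \<in> A \<Longrightarrow> 2 \<le> card {v \<in> A - {u}. G u v}"
  shows "2 \<le> card {x \<in> A. flexible A G x}"
proof (rule ccontr)
  assume few: "\<not> 2 \<le> card {x \<in> A. flexible A G x}"
  let ?F = "{x \<in> A. flexible A G x}"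
  let ?N = "\<lambda>u. {v \<in> A - {u}. G u v}"
  have "\<exists>X. finite X \<and> card X \<le> 4 \<and> \<not> (\<exists>u\<in>A - X. \<exists>v\<in>A - X. u \<noteq> v \<and> G u v)"
  proof (rule ccontr)
    assume "\<not> ?thesis"
    then have "?F = A" unfolding flexible_def by blast
    then show False using few A(2) by simp
  qed
  then obtain X where X: "finite X" "card X \<le> 4" "\<And>u v. u \<in> A - X \<Longrightarrow> v \<in> A - X \<Longrightarrow> u \<noteq> v \<Longrightarrow> \<not> G u v"
    by blast
  have big: "flexible A G x" if x: "x \<in> A" "5 \<le> card (?N x)" for x
    unfolding flexible_def
  proof (intro allI impI)
    fix Z assume Z: "finite Z" "card Z \<le> 4" "x \<notin> Z"
    have "\<not> ?N x \<subseteq> Z" using card_mono[OF Z(1), of "?N x"] Z(2) x(2) by linarith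
    then obtain v where "v \<in> ?N x" "v \<notin> Z" by blast
    then show "\<exists>u\<in>A - Z. \<exists>v\<in>A - Z. u \<noteq> v \<and> G u v"
      using x(1) Z(3) by (intro bexI[of _ x] bexI[of _ v]) auto
  qed
  have finN: "finite (?N u)" for u using A by simp
  have leA: "card (?N u) \<le> card A" for u using A by (intro card_mono) auto
  have "2 * card (A - X) \<le> (\<Sum>u\<in>A - X. card (?N u))"
    using sum_mono[of "A - X" "\<lambda>_. 2" "\<lambda>u. card (?N u)"] deg by simp
  also have "\<dots> = (\<Sum>u\<in>A - X. card {x \<in> X \<inter> A. x \<noteq> u \<and> G u x})"
  proof (rule sum.cong)
    fix u assume u: "u \<in> A - X"
    have "?N u = {x \<in> X \<inter> A. x \<noteq> u \<and> G u x}" using X(3)[OF u] by blast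
    then show "card (?N u) = card {x \<in> X \<inter> A. x \<noteq> u \<and> G u x}" by simp
  qed simp
  also have "\<dots> = (\<Sum>x\<in>X \<inter> A. card {u \<in> A - X. x \<noteq> u \<and> G u x})"
    by (rule sum_multicount_gen) (use A X in auto)
  also have "\<dots> \<le> (\<Sum>x\<in>X \<inter> A. (if x \<in> ?F then card A else 0) + 4)"
  proof (rule sum_mono)
    fix x assume x: "x \<in> X \<inter> A"
    have "{u \<in> A - X. x \<noteq> u \<and> G u x} \<subseteq> ?N x" using sym by blast
    then have "card {u \<in> A - X. x \<noteq> u \<and> G u x} \<le> card (?N x)" using finN by (rule card_mono[rotated])
    then show "card {u \<in> A - X. x \<noteq> u \<and> G u x} \<le> (if x \<in> ?F then card A else 0) + 4"
      using leA[of x] big[of x] x by (cases "5 \<le> card (?N x)") auto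
  qed
  also have "\<dots> = card (X \<inter> A \<inter> ?F) * card A + 4 * card (X \<inter> A)"
  proof -
    have "(\<Sum>x\<in>X \<inter> A. if x \<in> F then card A else 0) = card (X \<inter> A \<inter> F) * card A" for F
      using A by (simp add: sum.If_cases)
    then show ?thesis by (simp only: sum.distrib sum_constant) simp
  qed
  also have "\<dots> \<le> 1 * card A + 4 * 4"
  proof (intro add_mono mult_mono)
    have "card (X \<inter> A \<inter> ?F) \<le> card ?F" using A by (intro card_mono) auto
    then show "card (X \<inter> A \<inter> ?F) \<le> 1" using few by linarith
    have "card (X \<inter> A) \<le> card X" using X by (intro card_mono) auto
    then show "card (X \<inter> A) \<le> 4" using X by linarith
  qed auto
  finally have "2 * card (A - X) \<le> card A + 16" by simp
  moreover have "card A - card X \<le> card (A - X)" by (rule diff_card_le_card_Diff[OF X(1)])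
  ultimately show False using X(2) A(2) by linarith
qed

section \<open>Distinct representatives of three sets\<close>

lemma exists_two_representatives:
  assumes "2 \<le> card F" "2 \<le> card G" "x \<notin> F"
  shows "\<exists>y\<in>F. \<exists>z\<in>G. x \<noteq> y \<and> x \<noteq> z \<and> y \<noteq> z"
proof -
  have other: "\<exists>z\<in>H. z \<noteq> a" if "2 \<le> card H" for H :: "'a set" and a
  proof (rule ccontr)
    assume "\<not> ?thesis"
    then have "H \<subseteq> {a}" by blast
    then have "card H \<le> 1" using card_mono[of "{a}" H] by simp
    then show False using that by simp
  qed
  obtain z where z: "z \<in> G" "z \<noteq> x" using other[OF assms(2)] by blast
  obtain y where y: "y \<in> F" "y \<noteq> z" using other[OF assms(1)] by blast
  have "x \<noteq> y" using y assms(3) by blast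
  then show ?thesis using y z by (intro bexI[of _ y] bexI[of _ z]) auto
qed

text \<open>The case of Hall's theorem where three sets with at least two elements each have a union
  of size 2. An element of one set missing from another could be completed to distinct
  representatives, and so could three elements of a common set.\<close>

lemma no_representatives_imp_eq:
  assumes c: "2 \<le> card F1" "2 \<le> card F2" "2 \<le> card F3"
    and no: "\<And>x y z. x \<in> F1 \<Longrightarrow> y \<in> F2 \<Longrightarrow> z \<in> F3 \<Longrightarrow> x \<noteq> y \<Longrightarrow> x \<noteq> z \<Longrightarrow> y \<noteq> z \<Longrightarrow> False"
  shows "F2 = F1" "F3 = F1" "card F1 = 2"
proof -
  have 12: "F1 \<subseteq> F2" using exists_two_representatives[OF c(2,3)] no by (metis subsetI)
  have 13: "F1 \<subseteq> F3" using exists_two_representatives[OF c(3,2)] no by (metis subsetI)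
  have 21: "F2 \<subseteq> F1" using exists_two_representatives[OF c(1,3)] no by (metis subsetI)
  have 31: "F3 \<subseteq> F1" using exists_two_representatives[OF c(1,2)] no by (metis subsetI)
  show eq: "F2 = F1" "F3 = F1" using 12 13 21 31 by blast+
  show "card F1 = 2"
  proof (rule ccontr)
    assume "card F1 \<noteq> 2"
    then have "3 \<le> card F1" using c(1) by linarith
    then obtain T where T: "T \<subseteq> F1" "card T = 3" by (rule obtain_subset_with_card_n)
    then obtain x y z where "T = {x,y,z}" "x \<noteq> y" "x \<noteq> z" "y \<noteq> z" by (auto simp: card_3_iff)
    then show False using no[of x y z] T eq by auto
  qed
qed

context projective_plane
begin

text \<open>Each pair in \<open>B\<close> defines a graph on \<open>A\<close>, and a plane arises
  from three disjoint edges in the graphs of the pairs from a triple. Distinct flexible vertices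
  would yield them, so all triples share one pair \<open>C\<close> of flexible vertices. Then one
  edge avoiding \<open>C\<close> is taken from \<open>degB\<close>, and the two vertices of
  \<open>C\<close> serve the other two graphs.\<close>

lemma contains_if_mixed_edges:
  assumes q: "q = 3" and V: "A \<subseteq> V" "B \<subseteq> V" "A \<inter> B = {}" "finite V"
    and sizes: "25 \<le> card A" "7 \<le> card B"
    and odd_edges: "\<And>e. e \<subseteq> A \<union> B \<Longrightarrow> card e = 4 \<Longrightarrow> odd (card (e \<inter> A)) \<Longrightarrow> e \<in> E"
    and degA: "\<And>a b b'. a \<in> A \<Longrightarrow> b \<in> B \<Longrightarrow> b' \<in> B \<Longrightarrow> b \<noteq> b' \<Longrightarrow> 2 \<le> card {a' \<in> A - {a}. {a,a',b,b'} \<in> E}"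
    and degB: "\<And>a a' b. a \<in> A \<Longrightarrow> a' \<in> A \<Longrightarrow> a \<noteq> a' \<Longrightarrow> b \<in> B \<Longrightarrow> \<exists>b'\<in>B - {b}. {a,a',b,b'} \<in> E"
  shows "contains P L V E"
proof (rule ccontr)
  assume free: "\<not> contains P L V E"
  define G where "G b b' u v \<longleftrightarrow> {u,v,b,b'} \<in> E" for b b' u v
  define \<Phi> where "\<Phi> b b' = {x \<in> A. flexible A (G b b') x}" for b b'
  have finA: "finite A" using V(1,4) by (rule finite_subset)
  have Phi2: "2 \<le> card (\<Phi> b b')" if "b \<in> B" "b' \<in> B" "b \<noteq> b'" for b b'
    unfolding \<Phi>_def
  proof (rule two_flexible[OF finA sizes(1)])
    show "G b b' v u" if "G b b' u v" for u v using that unfolding G_def by (simp add: insert_commute)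
    show "2 \<le> card {v \<in> A - {u}. G b b' u v}" if "u \<in> A" for u
      unfolding G_def by (rule degA) fact+
  qed
  have tri: False
    if d: "d1 \<in> B" "d2 \<in> B" "d3 \<in> B" "d1 \<noteq> d2" "d1 \<noteq> d3" "d2 \<noteq> d3"
      and u: "u1 \<in> A" "v1 \<in> A" "u1 \<noteq> v1" "u2 \<in> A - {u1,v1}" "v2 \<in> A - {u1,v1}" "u2 \<noteq> v2"
        "u3 \<in> A - {u1,v1,u2,v2}" "v3 \<in> A - {u1,v1,u2,v2}" "u3 \<noteq> v3"
      and g: "G d2 d3 u1 v1" "G d1 d3 u2 v2" "G d1 d2 u3 v3"
    for d1 d2 d3 u1 v1 u2 v2 u3 v3
  proof -
    have "contains P L V E"
    proof (rule contains_if_triangle[OF q V odd_edges sizes(2) d, where ?e1.0 = "{u1,v1}" and ?e2.0 = "{u2,v2}" and ?e3.0 = "{u3,v3}"])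
      show "{u1,v1} \<union> {d2,d3} \<in> E" "{u2,v2} \<union> {d1,d3} \<in> E" "{u3,v3} \<union> {d1,d2} \<in> E"
        using g unfolding G_def by (simp_all only: Un_insert_left Un_empty_left)
    qed (use u in auto)
    then show False using free by simp
  qed
  have sdr: False
    if d: "d1 \<in> B" "d2 \<in> B" "d3 \<in> B" "d1 \<noteq> d2" "d1 \<noteq> d3" "d2 \<noteq> d3"
      and x: "x1 \<in> \<Phi> d2 d3" "x2 \<in> \<Phi> d1 d3" "x3 \<in> \<Phi> d1 d2" "x1 \<noteq> x2" "x1 \<noteq> x3" "x2 \<noteq> x3"
    for d1 d2 d3 x1 x2 x3
  proof -
    have fl: "flexible A (G d2 d3) x1" "flexible A (G d1 d3) x2" "flexible A (G d1 d2) x3"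
      using x by (simp_all add: \<Phi>_def)
    \<comment> \<open>Each edge avoids the edges chosen before and the flexible vertices reserved
      for the later graphs. At most four vertices are ever forbidden, which is the bound in
      \<open>flexible\<close>.\<close>
    obtain u1 v1 where e1: "u1 \<in> A - {x2,x3}" "v1 \<in> A - {x2,x3}" "u1 \<noteq> v1" "G d2 d3 u1 v1"
      by (rule flexibleD[OF fl(1), of "{x2,x3}"]) (use x in \<open>auto simp: card_insert_if\<close>)
    obtain u2 v2 where e2: "u2 \<in> A - {u1,v1,x3}" "v2 \<in> A - {u1,v1,x3}" "u2 \<noteq> v2" "G d1 d3 u2 v2"
      by (rule flexibleD[OF fl(2), of "{u1,v1,x3}"]) (use x e1 in \<open>auto simp: card_insert_if\<close>)
    obtain u3 v3 where e3: "u3 \<in> A - {u1,v1,u2,v2}" "v3 \<in> A - {u1,v1,u2,v2}" "u3 \<noteq> v3" "G d1 d2 u3 v3"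
      by (rule flexibleD[OF fl(3), of "{u1,v1,u2,v2}"]) (use x e1 e2 in \<open>auto simp: card_insert_if\<close>)
    show False by (rule tri[OF d _ _ e1(3) _ _ e2(3) e3(1-3) e1(4) e2(4) e3(4)]) (use e1 e2 in auto)
  qed
  have eq: "\<Phi> d1 d3 = \<Phi> d2 d3" "\<Phi> d1 d2 = \<Phi> d2 d3" "card (\<Phi> d2 d3) = 2"
    if d: "d1 \<in> B" "d2 \<in> B" "d3 \<in> B" "d1 \<noteq> d2" "d1 \<noteq> d3" "d2 \<noteq> d3" for d1 d2 d3
    by (rule no_representatives_imp_eq[OF Phi2[OF d(2,3,6)] Phi2[OF d(1,3,5)] Phi2[OF d(1,2,4)] sdr[OF d]]; assumption)+
  have "2 \<le> card B" using sizes by simp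
  then obtain T where T: "T \<subseteq> B" "card T = 2" by (rule obtain_subset_with_card_n)
  then obtain b b0 where b: "b \<in> B" "b0 \<in> B" "b0 \<noteq> b" by (auto simp: card_2_iff)
  define C where "C = \<Phi> b b0"
  have starC: "\<Phi> b y = C" if "y \<in> B" "y \<noteq> b" for y
  proof (cases "y = b0")
    case False
    show ?thesis unfolding C_def using eq(1,2)[of b b0 y] b that False by simp
  qed (simp add: C_def)
  have "card C = 2"
  proof -
    have "{b,b0} \<subseteq> B" "card {b,b0} = 2" using b by auto
    then have "B \<noteq> {b,b0}" using sizes by auto
    then obtain y where y: "y \<in> B" "y \<noteq> b" "y \<noteq> b0" using b by blast
    show ?thesis using eq(3)[of b0 b y] eq(2)[of b0 b y] starC[of y] b y by simp
  qed
  then obtain c c' where c: "C = {c,c'}" "c \<noteq> c'" by (auto simp: card_2_iff)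
  have "2 \<le> card (A - C)"
    using diff_card_le_card_Diff[of C A] \<open>card C = 2\<close> sizes(1) c(1) by simp
  then obtain T' where T': "T' \<subseteq> A - C" "card T' = 2" by (rule obtain_subset_with_card_n)
  then obtain a a' where a: "a \<in> A - C" "a' \<in> A - C" "a \<noteq> a'" by (auto simp: card_2_iff)
  \<comment> \<open>Here the pair in \<open>A\<close> is prescribed and the partner
    \<open>b'\<close> of \<open>b\<close> is found, so the edge \<open>{a, a'}\<close> misses
    \<open>C\<close> without using flexibility.\<close>
  obtain b' where b': "b' \<in> B" "b' \<noteq> b" "{a,a',b,b'} \<in> E" using degB[of a a' b] a b by blast
  have "card {b,b'} = 2" using b' by simp
  then have "B \<noteq> {b,b'}" using sizes by auto
  then obtain d where d: "d \<in> B" "d \<noteq> b" "d \<noteq> b'" using b b' by blast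
  have "\<Phi> b d = C" "\<Phi> b' d = C" using starC[of d] eq(1)[of b b' d] b b' d by simp_all
  then have fl: "flexible A (G b d) c" "flexible A (G b' d) c'" using c by (auto simp: \<Phi>_def)
  obtain u v where e1: "u \<in> A - {a,a',c'}" "v \<in> A - {a,a',c'}" "u \<noteq> v" "G b d u v"
    by (rule flexibleD[OF fl(1), of "{a,a',c'}"]) (use a c in \<open>auto simp: card_insert_if\<close>)
  obtain w z where e2: "w \<in> A - {a,a',u,v}" "z \<in> A - {a,a',u,v}" "w \<noteq> z" "G b' d w z"
    by (rule flexibleD[OF fl(2), of "{a,a',u,v}"]) (use a c e1 in \<open>auto simp: card_insert_if\<close>)
  have G_swap: "G x y = G y x" for x y by (intro ext) (simp add: G_def insert_commute)
  have "G b' b a a'" using b'(3) unfolding G_swap[of b' b] by (simp add: G_def)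
  moreover have "G d b u v" "G d b' w z" using e1(4) e2(4) G_swap[of d] by simp_all
  ultimately show False
    using e1(1-3) e2(1-3) a b b' d by (intro tri[of d b' b a a' u v w z]) auto
qed

text \<open>The parts \<open>X\<close> and \<open>Y\<close> have 9 vertices so that
  \<open>contains_if_affine\<close> can place the \<open>q * q\<close> points off an edge lying
  inside the opposite class. The summand 50 gives each class the 25 vertices required by
  \<open>two_flexible\<close>.\<close>

lemma exists_extremal_contains:
  assumes q: "q = 3"
  shows "\<exists>N. \<forall>(V :: 'v set) E. finite V \<longrightarrow> N \<le> card V \<longrightarrow>
    (\<forall>S. S \<subseteq> V \<longrightarrow> card S = 3 \<longrightarrow> card V \<le> 2 * card (nbrs V E S)) \<longrightarrow> contains P L V E"
proof -
  have q9: "1 \<le> q" "q \<le> 9" using q by simp_all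
  obtain N where N: "\<forall>(V :: 'v set) E. finite V \<longrightarrow> N \<le> card V \<longrightarrow> \<not> contains P L V E \<longrightarrow>
    (\<forall>S. S \<subseteq> V \<longrightarrow> card S = q \<longrightarrow> card V \<le> 2 * card (nbrs V E S)) \<longrightarrow>
    (\<exists>A B X Y. A \<union> B = V \<and> A \<inter> B = {} \<and> 2 * card A = card V \<and> 2 * card B = card V \<and>
      X \<subseteq> A \<and> Y \<subseteq> B \<and> card X = 9 \<and> card Y = 9 \<and>
      (\<forall>R. R \<subseteq> X \<longrightarrow> card R = q \<longrightarrow> nbrs V E R = B) \<and> (\<forall>R. R \<subseteq> Y \<longrightarrow> card R = q \<longrightarrow> nbrs V E R = A))"
    using exists_exact_bipartition[OF q9] by (rule exE)
  show ?thesis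
  proof (intro exI[of _ "N + 50"] allI impI, rule ccontr)
    fix V :: "'v set" and E
    assume V: "finite V" "N + 50 \<le> card V"
      and deg0: "\<forall>S. S \<subseteq> V \<longrightarrow> card S = 3 \<longrightarrow> card V \<le> 2 * card (nbrs V E S)"
      and free: "\<not> contains P L V E"
    have deg: "card V \<le> 2 * card (nbrs V E S)" if "S \<subseteq> V" "card S = 3" for S using deg0 that by simp
    have "\<exists>A B X Y. A \<union> B = V \<and> A \<inter> B = {} \<and> 2 * card A = card V \<and> 2 * card B = card V \<and>
      X \<subseteq> A \<and> Y \<subseteq> B \<and> card X = 9 \<and> card Y = 9 \<and>
      (\<forall>R. R \<subseteq> X \<longrightarrow> card R = q \<longrightarrow> nbrs V E R = B) \<and> (\<forall>R. R \<subseteq> Y \<longrightarrow> card R = q \<longrightarrow> nbrs V E R = A)"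
      using N[THEN spec, THEN spec, of V E] V free deg0 q by simp
    then obtain A B X Y where AB: "A \<union> B = V" "A \<inter> B = {}" "2 * card A = card V" "2 * card B = card V"
      and XY: "X \<subseteq> A" "Y \<subseteq> B" "card X = 9" "card Y = 9"
      and nX: "\<forall>R. R \<subseteq> X \<longrightarrow> card R = q \<longrightarrow> nbrs V E R = B" and nY: "\<forall>R. R \<subseteq> Y \<longrightarrow> card R = q \<longrightarrow> nbrs V E R = A"
      by (elim exE conjE)
    have fin: "finite A" "finite B" "A \<subseteq> V" "B \<subseteq> V" using AB(1) V(1) by auto
    \<comment> \<open>An edge inside \<open>C\<close> would complete a plane with the affine part in
      \<open>Z\<close>. So all neighbours of a triple in \<open>C\<close> lie in \<open>D\<close>,
      and the degree bound leaves no vertex of \<open>D\<close> out.\<close>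
    have full: "nbrs V E S = D"
      if D: "C \<union> D = V" "C \<inter> D = {}" "2 * card D = card V" and Z: "Z \<subseteq> D" "card Z = 9"
        and nZ: "\<And>R. R \<subseteq> Z \<Longrightarrow> card R = q \<Longrightarrow> nbrs V E R = C" and S: "S \<subseteq> C" "card S = 3" for C D Z S
    proof -
      have finD: "finite D" using D(1) V(1) by auto
      have "nbrs V E S \<subseteq> D"
      proof
        fix v assume v: "v \<in> nbrs V E S"
        show "v \<in> D"
        proof (rule ccontr)
          assume "v \<notin> D"
          then have e: "insert v S \<subseteq> C" "insert v S \<in> E" "v \<notin> S" using v S D(1) by (auto simp: nbrs_def)
          have "contains P L V E"
          proof (rule contains_if_affine[of "insert v S" V E Z])
            show "insert v S \<subseteq> V" using e D(1) by blast
            show "card (insert v S) = q + 1" using e S q card_ge_0_finite[of S] by simp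
            show "insert v S \<in> E" by fact
            show "Z \<subseteq> V - insert v S" using Z e D by blast
            show "q * q \<le> card Z" using Z q by simp
            show "finite Z" using Z finD finite_subset by blast
            show "insert a R \<in> E" if "a \<in> insert v S" "R \<subseteq> Z" "card R = q" for a R
            proof -
              have "a \<in> nbrs V E R" unfolding nZ[OF that(2,3)] using that(1) e by blast
              then show ?thesis by (simp add: nbrs_def)
            qed
          qed
          then show False using free by simp
        qed
      qed
      moreover have "card D \<le> card (nbrs V E S)"
      proof -
        have "S \<subseteq> V" using S(1) D(1) by blast
        then show ?thesis using deg[of S] S(2) D(3) by linarith
      qed
      ultimately show ?thesis using finD by (intro card_seteq) auto
    qed
    have fullA: "nbrs V E S = B" if "S \<subseteq> A" "card S = 3" for S
      by (rule full[OF AB(1,2,4) XY(2,4) _ that]) (use nY in simp)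
    have fullB: "nbrs V E S = A" if "S \<subseteq> B" "card S = 3" for S
    proof (rule full[OF _ _ AB(3) XY(1,3) _ that])
      show "B \<union> A = V" "B \<inter> A = {}" using AB by auto
    qed (use nX in simp)
    have odd_edges: "e \<in> E" if e: "e \<subseteq> A \<union> B" "card e = 4" "odd (card (e \<inter> A))" for e
    proof -
      have fe: "finite e" using e(2) by (simp add: card_ge_0_finite)
      have "e = (e \<inter> A) \<union> (e \<inter> B)" using e(1) by blast
      moreover have "card ((e \<inter> A) \<union> (e \<inter> B)) = card (e \<inter> A) + card (e \<inter> B)"
        using fe AB(2) by (intro card_Un_disjoint) auto
      ultimately have sum4: "card (e \<inter> A) + card (e \<inter> B) = 4" using e(2) by simp
      then have "card (e \<inter> A) = 1 \<or> card (e \<inter> A) = 3" using e(3) by presburger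
      then show ?thesis
      proof
        assume c: "card (e \<inter> A) = 1"
        then obtain a where a: "e \<inter> A = {a}" by (rule card_1_singletonE)
        then have "a \<in> nbrs V E (e \<inter> B)" using fullB[of "e \<inter> B"] sum4 c by auto
        moreover have "insert a (e \<inter> B) = e" using a e(1) by blast
        ultimately show ?thesis by (simp add: nbrs_def)
      next
        assume c: "card (e \<inter> A) = 3"
        then have "card (e \<inter> B) = 1" using sum4 by simp
        then obtain b where b: "e \<inter> B = {b}" by (rule card_1_singletonE)
        then have "b \<in> nbrs V E (e \<inter> A)" using fullA[of "e \<inter> A"] c by auto
        moreover have "insert b (e \<inter> A) = e" using b e(1) by blast
        ultimately show ?thesis by (simp add: nbrs_def)
      qed
    qed
    \<comment> \<open>The triple has at least \<open>card D\<close> neighbours, but two vertices of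
      \<open>D\<close> belong to it; at least two neighbours must therefore lie in
      \<open>C\<close>.\<close>
    have mixed: "2 \<le> card {x \<in> C - {y}. insert x {y,z,z'} \<in> E}"
      if C: "C \<union> D = V" "C \<inter> D = {}" "2 * card D = card V" and y: "y \<in> C" "z \<in> D" "z' \<in> D" "z \<noteq> z'" for C D y z z'
    proof -
      have finCD: "finite C" "finite D" using C(1) V(1) by auto
      have yz: "y \<noteq> z" "y \<noteq> z'" using y C(2) by auto
      have sub: "{y,z,z'} \<subseteq> V" using y C(1) by blast
      have "card {y,z,z'} = 3" using y yz by simp
      then have "card D \<le> card (nbrs V E {y,z,z'})" using deg[OF sub] C(3) by linarith
      also have "\<dots> \<le> card ({x \<in> C - {y}. insert x {y,z,z'} \<in> E} \<union> (D - {z,z'}))"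
        using finCD C(1) by (intro card_mono) (auto simp: nbrs_def)
      also have "\<dots> \<le> card {x \<in> C - {y}. insert x {y,z,z'} \<in> E} + card (D - {z,z'})" by (rule card_Un_le)
      also have "card (D - {z,z'}) = card D - 2" using y finCD by (subst card_Diff_subset) auto
      finally have "card D \<le> card {x \<in> C - {y}. insert x {y,z,z'} \<in> E} + (card D - 2)" .
      moreover have "2 \<le> card D" using C(3) V(2) by linarith
      ultimately show ?thesis by linarith
    qed
    have "contains P L V E"
    proof (rule contains_if_mixed_edges[OF q fin(3,4) AB(2) V(1)])
      show "25 \<le> card A" "7 \<le> card B" using AB(3,4) V(2) by linarith+
      show "2 \<le> card {a' \<in> A - {a}. {a,a',b,b'} \<in> E}" if "a \<in> A" "b \<in> B" "b' \<in> B" "b \<noteq> b'" for a b b'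
        using mixed[OF AB(1,2,4) that] by (simp add: insert_commute)
      show "\<exists>b'\<in>B - {b}. {a,a',b,b'} \<in> E" if a: "a \<in> A" "a' \<in> A" "a \<noteq> a'" "b \<in> B" for a a' b
      proof -
        have "2 \<le> card {x \<in> B - {b}. insert x {b,a,a'} \<in> E}"
          by (rule mixed[of B A]) (use AB a in auto)
        then have "{x \<in> B - {b}. insert x {b,a,a'} \<in> E} \<noteq> {}" by (metis card.empty not_numeral_le_zero)
        then obtain x where "x \<in> B - {b}" "insert x {b,a,a'} \<in> E" by blast
        moreover have "insert x {b,a,a'} = {a,a',b,x}" by blast
        ultimately show ?thesis by metis
      qed
    qed (use odd_edges in auto)
    then show False using free by simp
  qed
qed

end

subsection \<open>Codegree bounds\<close>

lemma card_nbhd: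
  assumes E: "k_graph (q + 1) V E" and S: "S \<subseteq> V" "card S = q" "1 \<le> q"
  shows "card (nbhd V E S) = card (nbrs V E S)"
proof -
  have finV: "finite V" using E by (simp add: k_graph_def)
  have finS: "finite S" using S(1) finV by (rule finite_subset)
  have "nbhd V E S = (\<lambda>v. {v}) ` nbrs V E S"
  proof (intro equalityI subsetI)
    fix T assume "T \<in> nbhd V E S"
    then have T: "T \<subseteq> V - S" "S \<union> T \<in> E" by (auto simp: nbhd_def)
    have finT: "finite T" using T(1) finV finite_subset by blast
    have "card (S \<union> T) = q + 1" using E T by (auto simp: k_graph_def)
    moreover have "card (S \<union> T) = card S + card T" using finS finT T(1) by (intro card_Un_disjoint) auto
    ultimately have "card T = 1" using S(2) by simp
    then obtain v where "T = {v}" by (rule card_1_singletonE)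
    then show "T \<in> (\<lambda>v. {v}) ` nbrs V E S" using T by (auto simp: nbrs_def)
  qed (auto simp: nbhd_def nbrs_def)
  then show ?thesis by (simp add: card_image)
qed

context projective_plane
begin

text \<open>With codegrees above \<open>n / 2\<close> the exact bipartition would still exist, and
  its \<open>q\<close>-set \<open>X\<close> has codegree only \<open>card B\<close>, which is
  \<open>n / 2\<close>.\<close>

lemma free_codegree_le:
  assumes q: "1 \<le> q"
  shows "\<exists>N. \<forall>n\<ge>N. \<forall>E m. k_graph (q + 1) {..<n::nat} E \<longrightarrow> \<not> contains P L {..<n} E \<longrightarrow>
    min_codeg_ge q {..<n} E m \<longrightarrow> 2 * m \<le> n"
proof -
  obtain N where N: "\<forall>(V :: nat set) E. finite V \<longrightarrow> N \<le> card V \<longrightarrow> \<not> contains P L V E \<longrightarrow>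
    (\<forall>S. S \<subseteq> V \<longrightarrow> card S = q \<longrightarrow> card V \<le> 2 * card (nbrs V E S)) \<longrightarrow>
    (\<exists>A B X Y. A \<union> B = V \<and> A \<inter> B = {} \<and> 2 * card A = card V \<and> 2 * card B = card V \<and>
      X \<subseteq> A \<and> Y \<subseteq> B \<and> card X = q \<and> card Y = q \<and>
      (\<forall>R. R \<subseteq> X \<longrightarrow> card R = q \<longrightarrow> nbrs V E R = B) \<and> (\<forall>R. R \<subseteq> Y \<longrightarrow> card R = q \<longrightarrow> nbrs V E R = A))"
    using exists_exact_bipartition[OF q order_refl] by (rule exE)
  show ?thesis
  proof (intro exI[of _ N] allI impI, rule ccontr)
    fix n E m
    assume n: "N \<le> n" and E: "k_graph (q + 1) {..<n} E" and free: "\<not> contains P L {..<n} E"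
      and codeg: "min_codeg_ge q {..<n} E m" and big: "\<not> 2 * m \<le> n"
    let ?V = "{..<n}"
    have deg: "m \<le> card (nbrs ?V E S)" if "S \<subseteq> ?V" "card S = q" for S
      using codeg card_nbhd[OF E that q] that by (auto simp: min_codeg_ge_def)
    have "\<exists>A B X Y. A \<union> B = ?V \<and> A \<inter> B = {} \<and> 2 * card A = card ?V \<and> 2 * card B = card ?V \<and>
      X \<subseteq> A \<and> Y \<subseteq> B \<and> card X = q \<and> card Y = q \<and>
      (\<forall>R. R \<subseteq> X \<longrightarrow> card R = q \<longrightarrow> nbrs ?V E R = B) \<and> (\<forall>R. R \<subseteq> Y \<longrightarrow> card R = q \<longrightarrow> nbrs ?V E R = A)"
    proof (rule N[THEN spec, THEN spec, of ?V E, rule_format])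
      show "card ?V \<le> 2 * card (nbrs ?V E S)" if "S \<subseteq> ?V" "card S = q" for S
        using deg[OF that] big by simp
    qed (use n free in auto)
    then obtain A B X Y where AB: "A \<union> B = ?V" "2 * card B = card ?V" "X \<subseteq> A" "card X = q"
      and nX: "\<forall>R. R \<subseteq> X \<longrightarrow> card R = q \<longrightarrow> nbrs ?V E R = B" by (elim exE conjE)
    have "nbrs ?V E X = B" using nX AB(4) by simp
    moreover have "X \<subseteq> ?V" using AB(1,3) by blast
    ultimately have "m \<le> card B" using deg[of X] AB(4) by simp
    then show False using AB(2) big by simp
  qed
qed

lemma free_codegree_lt:
  assumes q: "q = 3"
  shows "\<exists>N. \<forall>n\<ge>N. \<forall>E m. k_graph (q + 1) {..<n::nat} E \<longrightarrow> \<not> contains P L {..<n} E \<longrightarrow>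
    min_codeg_ge q {..<n} E m \<longrightarrow> 2 * m < n"
proof -
  obtain N where N: "\<forall>(V :: nat set) E. finite V \<longrightarrow> N \<le> card V \<longrightarrow>
    (\<forall>S. S \<subseteq> V \<longrightarrow> card S = 3 \<longrightarrow> card V \<le> 2 * card (nbrs V E S)) \<longrightarrow> contains P L V E"
    using exists_extremal_contains[OF q] by (rule exE)
  show ?thesis
  proof (intro exI[of _ N] allI impI, rule ccontr)
    fix n E m
    assume n: "N \<le> n" and E: "k_graph (q + 1) {..<n} E" and free: "\<not> contains P L {..<n} E"
      and codeg: "min_codeg_ge q {..<n} E m" and big: "\<not> 2 * m < n"
    let ?V = "{..<n}"
    have "contains P L ?V E"
    proof (rule N[THEN spec, THEN spec, of ?V E, rule_format])
      fix S assume S: "S \<subseteq> ?V" "card S = 3"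
      then have "card (nbhd ?V E S) = card (nbrs ?V E S)" using q by (intro card_nbhd[OF E]) auto
      then have "m \<le> card (nbrs ?V E S)" using codeg S q by (auto simp: min_codeg_ge_def)
      then show "card ?V \<le> 2 * card (nbrs ?V E S)" using big by simp
    qed (use n in auto)
    then show False using free by simp
  qed
qed

text \<open>As \<open>q\<close> is odd, a \<open>q\<close>-set has an even trace on exactly one of
  the two classes, and adding any new vertex of that class gives an edge. The even trace has at most
  \<open>q - 1\<close> elements, which is the loss in the codegree.\<close>

lemma exists_free_odd:
  assumes q: "odd q" and n: "2 * q \<le> n"
  shows "\<exists>E :: nat set set. k_graph (q + 1) {..<n} E \<and> \<not> contains P L {..<n} E \<and>
    min_codeg_ge q {..<n} E (n div 2 - (q - 1))"
proof -
  define A B where "A = {..<n div 2}" and "B = {n div 2..<n}"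
  let ?V = "{..<n}"
  define E where "E = {e. e \<subseteq> ?V \<and> card e = q + 1 \<and> odd (card (e \<inter> A))}"
  have AB: "A \<subseteq> ?V" "B \<subseteq> ?V" "A \<inter> B = {}" "A \<union> B = ?V" "finite A" "finite B" by (auto simp: A_def B_def)
  have sz: "n div 2 \<le> card A" "n div 2 \<le> card B" by (auto simp: A_def B_def)
  have E: "k_graph (q + 1) ?V E" by (auto simp: k_graph_def E_def)
  have "\<not> contains P L ?V E" by (rule odd_graph_free[OF q, of _ A]) (simp add: E_def)
  moreover have "min_codeg_ge q ?V E (n div 2 - (q - 1))"
    unfolding min_codeg_ge_def
  proof (intro allI impI, elim conjE)
    fix S assume S: "S \<subseteq> ?V" "card S = q"
    have fS: "finite S" using S(1) finite_subset by blast
    have "S = (S \<inter> A) \<union> (S \<inter> B)" using S AB by blast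
    moreover have "card ((S \<inter> A) \<union> (S \<inter> B)) = card (S \<inter> A) + card (S \<inter> B)"
      using fS AB by (intro card_Un_disjoint) auto
    ultimately have sumq: "card (S \<inter> A) + card (S \<inter> B) = q" using S by simp
    have key: "n div 2 - (q - 1) \<le> card (nbrs ?V E S)"
      if C: "C = A \<or> C = B" and ev: "even (card (S \<inter> C))" for C
    proof -
      have finC: "finite C" "C \<subseteq> ?V" "n div 2 \<le> card C" using C AB sz by auto
      have "C - S \<subseteq> nbrs ?V E S"
      proof
        fix v assume v: "v \<in> C - S"
        have "card (insert v S) = q + 1" using v fS S by simp
        moreover have "odd (card (insert v S \<inter> A))"
        proof (cases "C = A")
          case True
          then have "insert v S \<inter> A = insert v (S \<inter> A)" "v \<notin> S \<inter> A" using v by auto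
          then show ?thesis using ev True fS by simp
        next
          case False
          then have "C = B" using C by simp
          then have "insert v S \<inter> A = S \<inter> A" using v AB by auto
          moreover have "even (card (S \<inter> B))" using ev \<open>C = B\<close> by simp
          then have "odd (card (S \<inter> A))" using sumq q by (metis even_add)
          ultimately show ?thesis by simp
        qed
        ultimately show "v \<in> nbrs ?V E S" using v S finC by (auto simp: nbrs_def E_def)
      qed
      then have "card (C - S) \<le> card (nbrs ?V E S)" by (intro card_mono) (auto simp: nbrs_def)
      moreover have "card (C - S) = card C - card (S \<inter> C)"
        using fS by (simp add: card_Diff_subset_Int Int_commute)
      moreover have "card (S \<inter> C) \<le> q - 1"
      proof -
        have "card (S \<inter> C) \<le> q" using S fS card_mono[of S "S \<inter> C"] by simp
        moreover have "card (S \<inter> C) \<noteq> q" using ev q by metis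
        ultimately show ?thesis by linarith
      qed
      ultimately show ?thesis using finC(3) by linarith
    qed
    have "even (card (S \<inter> A)) \<or> even (card (S \<inter> B))" using sumq q by (metis even_add)
    then have "n div 2 - (q - 1) \<le> card (nbrs ?V E S)" using key by blast
    moreover have "1 \<le> q" using q by (cases q) auto
    ultimately show "n div 2 - (q - 1) \<le> card (nbhd ?V E S)" using card_nbhd[OF E S] by simp
  qed
  ultimately show ?thesis using E by blast
qed

text \<open>With classes of sizes \<open>h + 1\<close> and \<open>h - 1\<close>, triples with 0, 2
  or 3 points in \<open>A\<close> have codegree at least \<open>h - 1\<close> from odd sets alone. A
  triple with one point in \<open>A\<close> reaches only \<open>h - 3\<close> in \<open>B\<close>;
  the added sets repair this, by the two vertices of \<open>C\<close> if that point is outside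
  \<open>C\<close>, and by all of \<open>A - C\<close> otherwise.\<close>

lemma exists_free_perturbed_odd:
  assumes q: "q = 3" and h: "3 \<le> h"
  shows "\<exists>E :: nat set set. k_graph (q + 1) {..<2 * h} E \<and> \<not> contains P L {..<2 * h} E \<and>
    min_codeg_ge q {..<2 * h} E (h - 1)"
proof -
  define A B C where "A = {..<h + 1}" and "B = {h + 1..<2 * h}" and "C = {0, 1::nat}"
  let ?V = "{..<2 * h}"
  define E where "E = {e. e \<subseteq> ?V \<and> card e = 4 \<and> (odd (card (e \<inter> A)) \<or> (card (e \<inter> A) = 2 \<and> card (e \<inter> C) = 1))}"
  have AB: "A \<subseteq> ?V" "B \<subseteq> ?V" "A \<inter> B = {}" "A \<union> B = ?V" "finite A" "finite B"
    using h by (auto simp: A_def B_def)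
  have sz: "card A = h + 1" "card B = h - 1" by (auto simp: A_def B_def)
  have C: "C \<subseteq> A" "card C = 2" "finite C" using h by (auto simp: A_def C_def)
  have E: "k_graph (q + 1) ?V E" using q by (auto simp: k_graph_def E_def)
  have "\<not> contains P L ?V E"
    by (rule perturbed_odd_graph_free[OF q C(1) _ C(3)]) (use C in \<open>auto simp: E_def\<close>)
  moreover have "min_codeg_ge q ?V E (h - 1)"
    unfolding min_codeg_ge_def
  proof (intro allI impI, elim conjE)
    fix S assume S: "S \<subseteq> ?V" "card S = q"
    have S3: "card S = 3" using S q by simp
    have fS: "finite S" using S(1) finite_subset by blast
    have "S = (S \<inter> A) \<union> (S \<inter> B)" using S AB by blast
    moreover have "card ((S \<inter> A) \<union> (S \<inter> B)) = card (S \<inter> A) + card (S \<inter> B)"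
      using fS AB by (intro card_Un_disjoint) auto
    ultimately have sum3: "card (S \<inter> A) + card (S \<inter> B) = 3" using S3 by simp
    have nbr: "v \<in> nbrs ?V E S" if "v \<in> ?V" "v \<notin> S"
      "odd (card (insert v S \<inter> A)) \<or> (card (insert v S \<inter> A) = 2 \<and> card (insert v S \<inter> C) = 1)" for v
      using that fS S3 S(1) by (simp add: nbrs_def E_def)
    have ins: "card (insert v S \<inter> A) = card (S \<inter> A) + 1" if "v \<in> A - S" for v
    proof -
      have "insert v S \<inter> A = insert v (S \<inter> A)" "v \<notin> S \<inter> A" using that by auto
      then show ?thesis using fS by simp
    qed
    have insB: "insert v S \<inter> A = S \<inter> A" if "v \<in> B" for v using that AB by auto
    have minus: "card (D - S) = card D - card (S \<inter> D)" for D
      using fS by (simp add: card_Diff_subset_Int Int_commute)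
    have finN: "finite (nbrs ?V E S)" by (simp add: nbrs_def)
    have nA: "A - S \<subseteq> nbrs ?V E S" if "even (card (S \<inter> A))"
      using that AB by (intro subsetI nbr) (auto simp: ins)
    have nB: "B - S \<subseteq> nbrs ?V E S" if "odd (card (S \<inter> A))"
      using that AB by (intro subsetI nbr) (auto simp: insB)
    consider "card (S \<inter> A) = 0" | "card (S \<inter> A) = 1" | "card (S \<inter> A) = 2" | "card (S \<inter> A) = 3"
      using sum3 by linarith
    then have "h - 1 \<le> card (nbrs ?V E S)"
    proof cases
      case 1
      then show ?thesis using card_mono[OF finN nA] minus[of A] sz by simp
    next
      case 3
      then show ?thesis using card_mono[OF finN nA] minus[of A] sz by simp
    next
      case 4
      then show ?thesis using card_mono[OF finN nB] minus[of B] sz sum3 by simp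
    next
      case 2
      then obtain x where x: "S \<inter> A = {x}" by (rule card_1_singletonE)
      have xS: "y = x" if "y \<in> S" "y \<in> A" for y using x that by blast
      have x_mem: "x \<in> S" using x by blast
      show ?thesis
      proof (cases "x \<in> C")
        case True
        have "A - C \<subseteq> nbrs ?V E S"
        proof
          fix v assume v: "v \<in> A - C"
          then have "v \<notin> S" using xS[of v] True by auto
          moreover have "insert v S \<inter> C = {x}" using xS x_mem True v C(1) by auto
          ultimately show "v \<in> nbrs ?V E S" using v AB(1) ins[of v] 2 by (intro nbr) auto
        qed
        then have "card (A - C) \<le> card (nbrs ?V E S)" by (rule card_mono[OF finN])
        then show ?thesis using C sz by (simp add: card_Diff_subset)
      next
        case False
        have SC: "S \<inter> C = {}" using xS False C(1) by auto
        have "C \<subseteq> nbrs ?V E S"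
        proof
          fix v assume v: "v \<in> C"
          then have "v \<notin> S" using SC by blast
          have "insert v S \<inter> C = {v}" using SC v by blast
          then have "card (insert v S \<inter> C) = 1" by (simp only: card_1_singleton_iff) simp
          moreover have "v \<in> A - S" "v \<in> ?V" using \<open>v \<notin> S\<close> v AB(1) C(1) by blast+
          ultimately show "v \<in> nbrs ?V E S" using ins[of v] 2 by (intro nbr) simp_all
        qed
        moreover have "B - S \<subseteq> nbrs ?V E S" using nB 2 by simp
        ultimately have "card (C \<union> (B - S)) \<le> card (nbrs ?V E S)" by (intro card_mono[OF finN]) auto
        moreover have "card (C \<union> (B - S)) = card C + card (B - S)"
          using C AB by (intro card_Un_disjoint) auto
        moreover have "card (B - S) = h - 1 - 2" using minus[of B] sz sum3 2 by simp
        ultimately show ?thesis using C(2) h by linarith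
      qed
    qed
    then show "h - 1 \<le> card (nbhd ?V E S)" using card_nbhd[OF E S] q by simp
  qed
  ultimately show ?thesis using E by blast
qed

text \<open>\<open>GREATEST\<close> is meaningful only for a bounded predicate. The condition
  \<open>q \<le> n\<close> provides a \<open>q\<close>-set, whose codegree bounds the admissible
  values; with no \<open>q\<close>-set every value would be admissible.\<close>

lemma ex_codeg_bounds:
  assumes q: "1 \<le> q" and n: "q \<le> n"
    and E: "k_graph (q + 1) {..<n} E" "\<not> contains P L {..<n} E" "min_codeg_ge q {..<n} E m"
  shows "m \<le> ex_codeg (q + 1) q n P L"
    and "\<exists>E. k_graph (q + 1) {..<n} E \<and> \<not> contains P L {..<n} E \<and>
      min_codeg_ge q {..<n} E (ex_codeg (q + 1) q n P L)"
proof -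
  let ?Q = "\<lambda>m. \<exists>E :: nat set set. k_graph (q + 1) {..<n} E \<and> \<not> contains P L {..<n} E \<and> min_codeg_ge q {..<n} E m"
  have bound: "k \<le> n" if "?Q k" for k
  proof -
    obtain E where E: "k_graph (q + 1) {..<n} E" "min_codeg_ge q {..<n} E k" using \<open>?Q k\<close> by blast
    have S: "{..<q} \<subseteq> {..<n}" "card {..<q} = q" using n by auto
    have "k \<le> card (nbhd {..<n} E {..<q})" using E(2) S by (auto simp: min_codeg_ge_def)
    also have "\<dots> = card (nbrs {..<n} E {..<q})" by (rule card_nbhd[OF E(1) S q])
    also have "\<dots> \<le> card {..<n}" by (intro card_mono) (auto simp: nbrs_def)
    finally show ?thesis by simp
  qed
  have Qm: "?Q m" using E by blast
  show "m \<le> ex_codeg (q + 1) q n P L"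
    unfolding ex_codeg_def by (rule Greatest_le_nat[where P = ?Q, OF Qm bound])
  show "?Q (ex_codeg (q + 1) q n P L)"
    unfolding ex_codeg_def by (rule GreatestI_nat[where P = ?Q, OF Qm bound])
qed

theorem ex_codeg_plane_bounds:
  assumes q: "odd q"
  shows "\<exists>N. \<forall>n\<ge>N. n div 2 - (q - 1) \<le> ex_codeg (q + 1) q n P L \<and> 2 * ex_codeg (q + 1) q n P L \<le> n"
proof -
  have q1: "1 \<le> q" using q by (cases q) auto
  obtain N where N: "\<forall>n\<ge>N. \<forall>E m. k_graph (q + 1) {..<n::nat} E \<longrightarrow> \<not> contains P L {..<n} E \<longrightarrow>
    min_codeg_ge q {..<n} E m \<longrightarrow> 2 * m \<le> n" using free_codegree_le[OF q1] by (rule exE)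
  show ?thesis
  proof (intro exI[of _ "N + 2 * q"] allI impI)
    fix n assume n: "N + 2 * q \<le> n"
    then have n2: "2 * q \<le> n" "q \<le> n" "N \<le> n" by linarith+
    obtain E where E: "k_graph (q + 1) {..<n} E" "\<not> contains P L {..<n} E" "min_codeg_ge q {..<n} E (n div 2 - (q - 1))"
      using exists_free_odd[OF q n2(1)] by blast
    note ex = ex_codeg_bounds[OF q1 n2(2) E]
    obtain E' where "k_graph (q + 1) {..<n} E'" "\<not> contains P L {..<n} E'"
      "min_codeg_ge q {..<n} E' (ex_codeg (q + 1) q n P L)" using ex(2) by blast
    then have "2 * ex_codeg (q + 1) q n P L \<le> n" using N n2(3) by blast
    then show "n div 2 - (q - 1) \<le> ex_codeg (q + 1) q n P L \<and> 2 * ex_codeg (q + 1) q n P L \<le> n"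
      using ex(1) by blast
  qed
qed

theorem ex_codeg_plane_order_3:
  assumes q: "q = 3"
  shows "\<exists>N. \<forall>n\<ge>N. even n \<longrightarrow> ex_codeg (q + 1) q n P L + 1 = n div 2"
proof -
  have q1: "1 \<le> q" using q by simp
  obtain N where N: "\<forall>n\<ge>N. \<forall>E m. k_graph (q + 1) {..<n::nat} E \<longrightarrow> \<not> contains P L {..<n} E \<longrightarrow>
    min_codeg_ge q {..<n} E m \<longrightarrow> 2 * m < n" using free_codegree_lt[OF q] by (rule exE)
  show ?thesis
  proof (intro exI[of _ "N + 6"] allI impI)
    fix n :: nat assume n: "N + 6 \<le> n" "even n"
    then obtain h where h: "n = 2 * h" by (auto elim: evenE)
    have n2: "q \<le> n" "N \<le> n" "3 \<le> h" using n q h by linarith+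
    obtain E where E: "k_graph (q + 1) {..<n} E" "\<not> contains P L {..<n} E" "min_codeg_ge q {..<n} E (h - 1)"
      using exists_free_perturbed_odd[OF q n2(3)] unfolding h by blast
    note ex = ex_codeg_bounds[OF q1 n2(1) E]
    obtain E' where "k_graph (q + 1) {..<n} E'" "\<not> contains P L {..<n} E'"
      "min_codeg_ge q {..<n} E' (ex_codeg (q + 1) q n P L)" using ex(2) by blast
    then have "2 * ex_codeg (q + 1) q n P L < n" using N n2(2) by blast
    moreover have "n div 2 = h" using h by simp
    ultimately show "ex_codeg (q + 1) q n P L + 1 = n div 2" using ex(1) h n2(3) by linarith
  qed
qed

end

theorem mainTheorem2:
  assumes "odd (card (UNIV :: 'f::finite_field set))"
  shows "(\<exists>N. \<forall>n\<ge>N.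
            real (n div 2) - real (card (UNIV :: 'f set)) + 1
              \<le> real (ex_codeg (card (UNIV :: 'f set) + 1) (card (UNIV :: 'f set)) n
                        (PG2_points :: 'f vec3 set set) PG2_edges)
          \<and> real (ex_codeg (card (UNIV :: 'f set) + 1) (card (UNIV :: 'f set)) n
                        (PG2_points :: 'f vec3 set set) PG2_edges) \<le> real n / 2)
       \<and> (card (UNIV :: 'f set) = 3 \<longrightarrow>
          (\<exists>N. \<forall>n\<ge>N. even n \<longrightarrow>
             int (ex_codeg (card (UNIV :: 'f set) + 1) (card (UNIV :: 'f set)) n
                    (PG2_points :: 'f vec3 set set) PG2_edges) = int (n div 2) - 1))"
proof -
  let ?q = "card (UNIV :: 'f set)"
  let ?ex = "\<lambda>n. ex_codeg (?q + 1) ?q n (PG2_points :: 'f vec3 set set) PG2_edges"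
  interpret projective_plane "PG2_points :: 'f vec3 set set" PG2_edges ?q
    by (rule projective_plane_PG2)
  obtain N where N: "\<And>n. N \<le> n \<Longrightarrow> n div 2 - (?q - 1) \<le> ?ex n \<and> 2 * ?ex n \<le> n"
    using ex_codeg_plane_bounds[OF assms] by blast
  have "real (n div 2) - real ?q + 1 \<le> real (?ex n) \<and> real (?ex n) \<le> real n / 2" if "N \<le> n" for n
  proof -
    \<comment> \<open>Positivity of \<open>?q\<close> turns the truncated subtraction of natural
      numbers into an additive inequality that survives the passage to reals.\<close>
    have "0 < ?q" using assms by (cases ?q) auto
    then have "n div 2 + 1 \<le> ?ex n + ?q" "2 * ?ex n \<le> n" using N[OF that] by linarith+
    then have "real (n div 2 + 1) \<le> real (?ex n + ?q)" "real (2 * ?ex n) \<le> real n"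
      by (simp_all only: of_nat_le_iff)
    then show ?thesis by simp
  qed
  moreover have "\<exists>N. \<forall>n\<ge>N. even n \<longrightarrow> int (?ex n) = int (n div 2) - 1" if q3: "?q = 3"
  proof -
    obtain N where N: "\<And>n. N \<le> n \<Longrightarrow> even n \<Longrightarrow> ?ex n + 1 = n div 2"
      using ex_codeg_plane_order_3[OF q3] by blast
    have "int (?ex n) = int (n div 2) - 1" if "N \<le> n" "even n" for n
      using N[OF that] by linarith
    then show ?thesis by blast
  qed
  ultimately show ?thesis by blast
qed

end
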